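(* Let $A$ be a commutative ring. (1) The abelian group $\mathcal E(A)$ is torsion free. (2) The space $$X(A)=\left(\mathcal E(A)\times(0,\infty)\right)/(\mathbb N\times\{\pm1\})$$ is a module over the hyperring $\mathbb H_{\mathbb Q}$. (3) For any rational prime $p$, $X(\mathbb C_p)$ is a free module of rank one over $\mathbb H_{\mathbb Q}$.
   Context: $\mathbb N$ is the multiplicative semigroup of positive integers; $\mathbb C_p$ is the completion of an algebraic closure of $\mathbb Q_p$. $\mathcal E(A)=\mathrm{Hom}(\mathbb Z[\mathbb Q/\mathbb Z],A)=\mathrm{Hom}(\mathbb Q/\mathbb Z,A^\times)$, an abelian group under pointwise multiplication (coming from the coproduct $\Delta(e(\gamma))=e(\gamma)\otimes e(\gamma)$). $(0,\infty)$ is a multiplicative group. The element $m=\pm n$ of $\mathbb N\times\{\pm1\}$ acts on $\mathcal E(A)\times(0,\infty)$ by $(\xi,x)\mapsto(\xi(m\,\cdot),x^m)$, i.e. by the $m$-th power in the abelian group $\mathcal E(A)\times(0,\infty)$; $X(A)$ is the quotient by the generated equivalence relation, so that $$X(A)=\left((\mathcal E(A)\times(0,\infty))\otimes_{\mathbb Z}\mathbb Q\right)/\mathbb Q^\times .$$ For a $\mathbb Q$-vector space $V$, the quotient $V/\mathbb Q^\times$ is a (commutative) hypergroup: the multivalued sum of two classes $[u],[w]$ is the set of classes $[u'+w']$ with $u'\in\mathbb Q^\times u$, $w'\in\mathbb Q^\times w$. Similarly $\mathbb H_{\mathbb Q}=\mathbb A_{\mathbb Q}/\mathbb Q^\times=((\hat{\mathbb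 Z}\times\mathbb R)\otimes_{\mathbb Z}\mathbb Q)/\mathbb Q^\times$ is a hyperring (induced multiplication; the multivalued sum of two classes $[a],[b]$, $a,b\in\mathbb A_{\mathbb Q}$, is the set of classes $[a'+b']$ with $a'\in\mathbb Q^\times a$, $b'\in\mathbb Q^\times b$). The action of $\mathbb H_{\mathbb Q}$ on $X(A)$ is induced by the ring homomorphism $\hat{\mathbb Z}\times\mathbb R\to\mathrm{End}_{\mathbb Z}(\mathcal E(A)\times(0,\infty))$ sending $(\alpha,t)$ to $(\xi,x)\mapsto(\xi\circ\alpha,x^t)$, where $\hat{\mathbb Z}=\mathrm{End}_{\mathbb Z}(\mathbb Q/\mathbb Z)$. A module over a hyperring is a hypergroup with a compatible (associative, unital, distributive) action; free of rank one means isomorphic, as a module, to the hyperring via $h\mapsto h\cdot g$ for some generator $g$. *)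

theory Defs
  imports
    "HOL-Algebra.Algebra"
    "HOL-Algebra.Algebraic_Closure_Type"
    "HOL-Analysis.Abstract_Metric_Spaces"
begin

section \<open>Canonical hypergroups, hyperrings and their modules\<close>

record 'a hypergroup = "'a partial_object" +
  hadd :: "'a \<Rightarrow> 'a \<Rightarrow> 'a set" (infixl \<open>\<boxplus>\<index>\<close> 65)
  hzero :: 'a

record 'a hyperring = "'a hypergroup" +
  hmult :: "'a \<Rightarrow> 'a \<Rightarrow> 'a" (infixl \<open>\<boxdot>\<index>\<close> 70)
  hone :: 'a

record ('r, 'a) hypermodule = "'a hypergroup" +
  hact :: "'r \<Rightarrow> 'a \<Rightarrow> 'a"

text \<open>Canonical hypergroups in the sense of Krasner; in particular the addition is commutative.\<close>

locale hypergroup =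
  fixes H (structure)
  assumes hadd_closed: "\<lbrakk>x \<in> carrier H; y \<in> carrier H\<rbrakk> \<Longrightarrow> x \<boxplus> y \<subseteq> carrier H"
    and hadd_nonempty: "\<lbrakk>x \<in> carrier H; y \<in> carrier H\<rbrakk> \<Longrightarrow> x \<boxplus> y \<noteq> {}"
    and hadd_comm: "\<lbrakk>x \<in> carrier H; y \<in> carrier H\<rbrakk> \<Longrightarrow> x \<boxplus> y = y \<boxplus> x"
    and hadd_assoc: "\<lbrakk>x \<in> carrier H; y \<in> carrier H; z \<in> carrier H\<rbrakk> \<Longrightarrow>
      (\<Union>u \<in> x \<boxplus> y. u \<boxplus> z) = (\<Union>w \<in> y \<boxplus> z. x \<boxplus> w)"
    and hzero_closed: "hzero H \<in> carrier H"
    and hadd_zero: "x \<in> carrier H \<Longrightarrow> x \<boxplus> hzero H = {x}"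
    and hneg_ex1: "x \<in> carrier H \<Longrightarrow> \<exists>!y. y \<in> carrier H \<and> hzero H \<in> x \<boxplus> y"
    and hadd_reversible:
      "\<lbrakk>x \<in> carrier H; y \<in> carrier H; z \<in> carrier H; z' \<in> carrier H;
        x \<in> y \<boxplus> z; hzero H \<in> z \<boxplus> z'\<rbrakk> \<Longrightarrow> y \<in> x \<boxplus> z'"

locale hyperring = hypergroup R for R (structure) +
  assumes hmult_closed: "\<lbrakk>x \<in> carrier R; y \<in> carrier R\<rbrakk> \<Longrightarrow> x \<boxdot> y \<in> carrier R"
    and hmult_assoc: "\<lbrakk>x \<in> carrier R; y \<in> carrier R; z \<in> carrier R\<rbrakk> \<Longrightarrow>
      (x \<boxdot> y) \<boxdot> z = x \<boxdot> (y \<boxdot> z)"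
    and hone_closed: "hone R \<in> carrier R"
    and hone_left: "x \<in> carrier R \<Longrightarrow> hone R \<boxdot> x = x"
    and hone_right: "x \<in> carrier R \<Longrightarrow> x \<boxdot> hone R = x"
    and hdistrib_left: "\<lbrakk>x \<in> carrier R; y \<in> carrier R; z \<in> carrier R\<rbrakk> \<Longrightarrow>
      (\<lambda>u. x \<boxdot> u) ` (y \<boxplus> z) = x \<boxdot> y \<boxplus> x \<boxdot> z"
    and hdistrib_right: "\<lbrakk>x \<in> carrier R; y \<in> carrier R; z \<in> carrier R\<rbrakk> \<Longrightarrow>
      (\<lambda>u. u \<boxdot> x) ` (y \<boxplus> z) = y \<boxdot> x \<boxplus> z \<boxdot> x"
    and hzero_left: "x \<in> carrier R \<Longrightarrow> hzero R \<boxdot> x = hzero R"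
    and hzero_right: "x \<in> carrier R \<Longrightarrow> x \<boxdot> hzero R = hzero R"
    and hone_neq_hzero: "hone R \<noteq> hzero R"

locale hypermodule = R?: hyperring R + M?: hypergroup M
  for R :: "('r, 'm) hyperring_scheme" (structure)
  and M :: "('r, 'a, 'n) hypermodule_scheme" (structure) +
  assumes hact_closed: "\<lbrakk>r \<in> carrier R; x \<in> carrier M\<rbrakk> \<Longrightarrow> hact M r x \<in> carrier M"
    and hact_assoc: "\<lbrakk>r \<in> carrier R; s \<in> carrier R; x \<in> carrier M\<rbrakk> \<Longrightarrow>
      hact M (r \<boxdot>\<^bsub>R\<^esub> s) x = hact M r (hact M s x)"
    and hact_one: "x \<in> carrier M \<Longrightarrow> hact M (hone R) x = x"
    and hact_distrib_left: "\<lbrakk>r \<in> carrier R; x \<in> carrier M; y \<in> carrier M\<rbrakk> \<Longrightarrow>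
      hact M r ` (x \<boxplus>\<^bsub>M\<^esub> y) = hact M r x \<boxplus>\<^bsub>M\<^esub> hact M r y"
    and hact_distrib_right: "\<lbrakk>r \<in> carrier R; s \<in> carrier R; x \<in> carrier M\<rbrakk> \<Longrightarrow>
      (\<lambda>t. hact M t x) ` (r \<boxplus>\<^bsub>R\<^esub> s) = hact M r x \<boxplus>\<^bsub>M\<^esub> hact M s x"
    and hact_zero_left: "x \<in> carrier M \<Longrightarrow> hact M (hzero R) x = hzero M"
    and hact_zero_right: "r \<in> carrier R \<Longrightarrow> hact M r (hzero M) = hzero M"

definition regular_hypermodule :: "('r, 'm) hyperring_scheme \<Rightarrow> ('r, 'r) hypermodule"
  where "regular_hypermodule R =
    \<lparr>carrier = carrier R, hadd = hadd R, hzero = hzero R, hact = hmult R\<rparr>"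

definition hypermodule_iso ::
  "('r, 'k) hyperring_scheme \<Rightarrow> ('r, 'a, 'm) hypermodule_scheme \<Rightarrow>
   ('r, 'b, 'n) hypermodule_scheme \<Rightarrow> ('a \<Rightarrow> 'b) set"
  where "hypermodule_iso R M N =
    {f. bij_betw f (carrier M) (carrier N) \<and>
        f (hzero M) = hzero N \<and>
        (\<forall>x \<in> carrier M. \<forall>y \<in> carrier M. f ` (x \<boxplus>\<^bsub>M\<^esub> y) = f x \<boxplus>\<^bsub>N\<^esub> f y) \<and>
        (\<forall>r \<in> carrier R. \<forall>x \<in> carrier M. f (hact M r x) = hact N r (f x))}"

definition free_of_rank_one ::
  "('r, 'k) hyperring_scheme \<Rightarrow> ('r, 'a, 'm) hypermodule_scheme \<Rightarrow> bool"
  where "free_of_rank_one R M \<longleftrightarrow> hypermodule R M \<and>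
    (\<exists>g \<in> carrier M. (\<lambda>r. hact M r g) \<in> hypermodule_iso R (regular_hypermodule R) M)"


section \<open>Tensor product with the rationals\<close>

text \<open>Abelian groups are written multiplicatively, as \<^typ>\<open>'a monoid\<close>. The tensor product over
  the integers is the free abelian group on the product of the carriers, modulo the bilinearity
  relations.\<close>

definition tensor_relations ::
  "('a, 'm) monoid_scheme \<Rightarrow> ('b, 'n) monoid_scheme \<Rightarrow> ('a \<times> 'b \<Rightarrow>\<^sub>0 int) set"
  where "tensor_relations G H = generate (free_Abelian_group (carrier G \<times> carrier H))
    ({frag_of (a \<otimes>\<^bsub>G\<^esub> a', b) - frag_of (a, b) - frag_of (a', b) | a a' b.
        a \<in> carrier G \<and> a' \<in> carrier G \<and> b \<in> carrier H} \<union>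
     {frag_of (a, b \<otimes>\<^bsub>H\<^esub> b') - frag_of (a, b) - frag_of (a, b') | a b b'.
        a \<in> carrier G \<and> b \<in> carrier H \<and> b' \<in> carrier H})"

definition tensor_group ::
  "('a, 'm) monoid_scheme \<Rightarrow> ('b, 'n) monoid_scheme \<Rightarrow> ('a \<times> 'b \<Rightarrow>\<^sub>0 int) set monoid"
  where "tensor_group G H =
    free_Abelian_group (carrier G \<times> carrier H) Mod tensor_relations G H"

definition pure_tensor ::
  "('a, 'm) monoid_scheme \<Rightarrow> ('b, 'n) monoid_scheme \<Rightarrow> 'a \<Rightarrow> 'b \<Rightarrow> ('a \<times> 'b \<Rightarrow>\<^sub>0 int) set"
  where "pure_tensor G H a b =
    tensor_relations G H #>\<^bsub>free_Abelian_group (carrier G \<times> carrier H)\<^esub> frag_of (a, b)"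

abbreviation rat_ring :: "rat ring"
  where "rat_ring \<equiv> ring_of_type_algebra"

abbreviation rat_tensor :: "('a, 'm) monoid_scheme \<Rightarrow> ('a \<times> rat \<Rightarrow>\<^sub>0 int) set monoid"
  where "rat_tensor G \<equiv> tensor_group G (add_monoid rat_ring)"

abbreviation rpure :: "('a, 'm) monoid_scheme \<Rightarrow> 'a \<Rightarrow> rat \<Rightarrow> ('a \<times> rat \<Rightarrow>\<^sub>0 int) set"
  where "rpure G \<equiv> pure_tensor G (add_monoid rat_ring)"

text \<open>Every element of \<^term>\<open>rat_tensor G\<close> is a pure tensor, because finitely generated subgroups
  of the rationals are cyclic. Hence the scalar multiplication by rationals and the extension of a
  biadditive map are determined by their values on pure tensors.\<close>

definition rscale :: "('a, 'm) monoid_scheme \<Rightarrow> rat \<Rightarrow>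
    ('a \<times> rat \<Rightarrow>\<^sub>0 int) set \<Rightarrow> ('a \<times> rat \<Rightarrow>\<^sub>0 int) set"
  where "rscale G q v = (THE w. \<exists>m \<in> carrier G. \<exists>r. v = rpure G m r \<and> w = rpure G m (q * r))"

definition rat_extend :: "('a, 'k) monoid_scheme \<Rightarrow> ('b, 'm) monoid_scheme \<Rightarrow>
    ('c, 'n) monoid_scheme \<Rightarrow> ('a \<Rightarrow> 'b \<Rightarrow> 'c) \<Rightarrow>
    ('a \<times> rat \<Rightarrow>\<^sub>0 int) set \<Rightarrow> ('b \<times> rat \<Rightarrow>\<^sub>0 int) set \<Rightarrow> ('c \<times> rat \<Rightarrow>\<^sub>0 int) set"
  where "rat_extend G H K f x y =
    (THE z. \<exists>a \<in> carrier G. \<exists>b \<in> carrier H. \<exists>q r.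
       x = rpure G a q \<and> y = rpure H b r \<and> z = rpure K (f a b) (q * r))"

definition rat_ring_tensor :: "('a, 'm) ring_scheme \<Rightarrow> ('a \<times> rat \<Rightarrow>\<^sub>0 int) set ring"
  where "rat_ring_tensor R = (let G = add_monoid R in
    \<lparr>carrier = carrier (rat_tensor G),
     monoid.mult = rat_extend G G G (monoid.mult R),
     one = rpure G \<one>\<^bsub>R\<^esub> 1,
     ring.zero = \<one>\<^bsub>rat_tensor G\<^esub>,
     add = monoid.mult (rat_tensor G)\<rparr>)"


section \<open>Quotients by the nonzero rationals\<close>

definition rorbit :: "('a, 'm) monoid_scheme \<Rightarrow>
    ('a \<times> rat \<Rightarrow>\<^sub>0 int) set \<Rightarrow> ('a \<times> rat \<Rightarrow>\<^sub>0 int) set set"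
  where "rorbit G v = {rscale G q v | q. q \<noteq> 0}"

definition rquotient :: "('a, 'm) monoid_scheme \<Rightarrow> ('a \<times> rat \<Rightarrow>\<^sub>0 int) set set hypergroup"
  where "rquotient G =
    \<lparr>carrier = rorbit G ` carrier (rat_tensor G),
     hadd = (\<lambda>c d. {rorbit G (u \<otimes>\<^bsub>rat_tensor G\<^esub> w) | u w. u \<in> c \<and> w \<in> d}),
     hzero = rorbit G \<one>\<^bsub>rat_tensor G\<^esub>\<rparr>"

text \<open>The product of the orbits of \<open>a\<close> and \<open>b\<close> is the orbit of \<open>a b\<close>, which is the set of all
  products of their elements.\<close>

definition rquotient_hyperring ::
  "('a, 'm) ring_scheme \<Rightarrow> ('a \<times> rat \<Rightarrow>\<^sub>0 int) set set hyperring"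
  where "rquotient_hyperring R =
    \<lparr>carrier = carrier (rquotient (add_monoid R)),
     hadd = hadd (rquotient (add_monoid R)),
     hzero = hzero (rquotient (add_monoid R)),
     hmult = (\<lambda>c d. {a \<otimes>\<^bsub>rat_ring_tensor R\<^esub> b | a b. a \<in> c \<and> b \<in> d}),
     hone = rorbit (add_monoid R) \<one>\<^bsub>rat_ring_tensor R\<^esub>\<rparr>"

definition rquotient_act :: "('r, 'k) ring_scheme \<Rightarrow> ('a, 'm) monoid_scheme \<Rightarrow>
    ('r \<Rightarrow> 'a \<Rightarrow> 'a) \<Rightarrow> ('r \<times> rat \<Rightarrow>\<^sub>0 int) set set \<Rightarrow>
    ('a \<times> rat \<Rightarrow>\<^sub>0 int) set set \<Rightarrow> ('a \<times> rat \<Rightarrow>\<^sub>0 int) set set"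
  where "rquotient_act R G f h c =
    {rat_extend (add_monoid R) G G f a v | a v. a \<in> h \<and> v \<in> c}"


section \<open>The adele class hyperring\<close>

text \<open>\<open>QZ\<close> is the group of rationals modulo integers, with its addition written
  multiplicatively as is usual for groups in this library.\<close>

definition QZ :: "rat set monoid"
  where "QZ = add_monoid rat_ring Mod \<int>"

definition zhat :: "(rat set \<Rightarrow> rat set) ring"
  where "zhat =
    \<lparr>carrier = hom QZ QZ \<inter> extensional (carrier QZ),
     monoid.mult = compose (carrier QZ),
     one = (\<lambda>\<gamma> \<in> carrier QZ. \<gamma>),
     ring.zero = (\<lambda>\<gamma> \<in> carrier QZ. \<one>\<^bsub>QZ\<^esub>),
     add = (\<lambda>\<alpha> \<beta>. \<lambda>\<gamma> \<in> carrier QZ. \<alpha> \<gamma> \<otimes>\<^bsub>QZ\<^esub> \<beta> \<gamma>)\<rparr>"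

abbreviation real_ring :: "real ring"
  where "real_ring \<equiv> ring_of_type_algebra"

abbreviation zhat_real :: "((rat set \<Rightarrow> rat set) \<times> real) ring"
  where "zhat_real \<equiv> RDirProd zhat real_ring"

definition adele_class_hyperring ::
  "(((rat set \<Rightarrow> rat set) \<times> real) \<times> rat \<Rightarrow>\<^sub>0 int) set set hyperring"
  where "adele_class_hyperring = rquotient_hyperring zhat_real"


section \<open>The space attached to a commutative ring\<close>

definition torsion_free :: "('a, 'm) monoid_scheme \<Rightarrow> bool"
  where "torsion_free G \<longleftrightarrow>
    (\<forall>x \<in> carrier G. \<forall>n::nat. n > 0 \<longrightarrow> x [^]\<^bsub>G\<^esub> n = \<one>\<^bsub>G\<^esub> \<longrightarrow> x = \<one>\<^bsub>G\<^esub>)"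

definition E_group :: "('a, 'm) ring_scheme \<Rightarrow> (rat set \<Rightarrow> 'a) monoid"
  where "E_group A =
    \<lparr>carrier = hom QZ (units_of A) \<inter> extensional (carrier QZ),
     monoid.mult = (\<lambda>\<xi> \<eta>. \<lambda>\<gamma> \<in> carrier QZ. \<xi> \<gamma> \<otimes>\<^bsub>A\<^esub> \<eta> \<gamma>),
     one = (\<lambda>\<gamma> \<in> carrier QZ. \<one>\<^bsub>A\<^esub>)\<rparr>"

definition pos_reals :: "real monoid"
  where "pos_reals = \<lparr>carrier = {0<..}, monoid.mult = (*), one = 1\<rparr>"

abbreviation EP_group :: "('a, 'm) ring_scheme \<Rightarrow> ((rat set \<Rightarrow> 'a) \<times> real) monoid"
  where "EP_group A \<equiv> E_group A \<times>\<times> pos_reals"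

text \<open>An element \<open>(n, \<plusminus>1)\<close> of the acting monoid is encoded as the nonzero integer \<open>m = \<plusminus>n\<close>.\<close>

definition int_act :: "int \<Rightarrow> (rat set \<Rightarrow> 'a) \<times> real \<Rightarrow> (rat set \<Rightarrow> 'a) \<times> real"
  where "int_act m = (\<lambda>(\<xi>, x). (\<lambda>\<gamma> \<in> carrier QZ. \<xi> (\<gamma> [^]\<^bsub>QZ\<^esub> m), x powi m))"

definition X_rel :: "('a, 'm) ring_scheme \<Rightarrow>
    (((rat set \<Rightarrow> 'a) \<times> real) \<times> ((rat set \<Rightarrow> 'a) \<times> real)) set"
  where "X_rel A = (let S = {(u, int_act m u) | u m. u \<in> carrier (EP_group A) \<and> m \<noteq> 0}
    in (S \<union> S\<inverse>)\<^sup>* \<inter> carrier (EP_group A) \<times> carrier (EP_group A))"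

definition X_space :: "('a, 'm) ring_scheme \<Rightarrow> ((rat set \<Rightarrow> 'a) \<times> real) set set"
  where "X_space A = carrier (EP_group A) // X_rel A"

text \<open>The canonical map from \<^term>\<open>X_space A\<close> to the quotient of
  \<^term>\<open>rat_tensor (EP_group A)\<close> by the nonzero rationals sends the class of \<open>u\<close> to the orbit of
  \<open>u \<otimes> 1\<close>; the union is over representatives, which all give the same orbit.\<close>

definition X_embed :: "('a, 'm) ring_scheme \<Rightarrow> ((rat set \<Rightarrow> 'a) \<times> real) set \<Rightarrow>
    (((rat set \<Rightarrow> 'a) \<times> real) \<times> rat \<Rightarrow>\<^sub>0 int) set set"
  where "X_embed A c = (\<Union>u \<in> c. rorbit (EP_group A) (rpure (EP_group A) u 1))"

definition zhat_real_act :: "(rat set \<Rightarrow> rat set) \<times> real \<Rightarrow>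
    (rat set \<Rightarrow> 'a) \<times> real \<Rightarrow> (rat set \<Rightarrow> 'a) \<times> real"
  where "zhat_real_act = (\<lambda>(\<alpha>, t) (\<xi>, x). (compose (carrier QZ) \<xi> \<alpha>, x powr t))"

text \<open>The hypergroup structure and the action are transported along \<^const>\<open>X_embed\<close>.\<close>

definition X_module :: "('a, 'm) ring_scheme \<Rightarrow>
    ((((rat set \<Rightarrow> rat set) \<times> real) \<times> rat \<Rightarrow>\<^sub>0 int) set set,
     ((rat set \<Rightarrow> 'a) \<times> real) set) hypermodule"
  where "X_module A =
    \<lparr>carrier = X_space A,
     hadd = (\<lambda>c d. {e \<in> X_space A.
       X_embed A e \<in> X_embed A c \<boxplus>\<^bsub>rquotient (EP_group A)\<^esub> X_embed A d}),
     hzero = X_rel A `` {\<one>\<^bsub>EP_group A\<^esub>},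
     hact = (\<lambda>h c. inv_into (X_space A) (X_embed A)
       (rquotient_act zhat_real (EP_group A) zhat_real_act h (X_embed A c)))\<rparr>"


section \<open>Completions of algebraic closures of p-adic fields\<close>

locale absolute_value = field K
  for K :: "('a, 'm) ring_scheme" (structure) and v :: "'a \<Rightarrow> real" +
  assumes av_nonneg: "x \<in> carrier K \<Longrightarrow> 0 \<le> v x"
    and av_eq_0: "x \<in> carrier K \<Longrightarrow> v x = 0 \<longleftrightarrow> x = \<zero>"
    and av_mult: "\<lbrakk>x \<in> carrier K; y \<in> carrier K\<rbrakk> \<Longrightarrow> v (x \<otimes> y) = v x * v y"
    and av_triangle: "\<lbrakk>x \<in> carrier K; y \<in> carrier K\<rbrakk> \<Longrightarrow> v (x \<oplus> y) \<le> v x + v y"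

text \<open>The value 0 off the carrier is there because \<^const>\<open>Metric_space\<close> requires nonnegativity
  and symmetry on the whole type.\<close>

definition av_dist :: "('a, 'm) ring_scheme \<Rightarrow> ('a \<Rightarrow> real) \<Rightarrow> 'a \<Rightarrow> 'a \<Rightarrow> real"
  where "av_dist K v x y =
    (if x \<in> carrier K \<and> y \<in> carrier K then v (x \<ominus>\<^bsub>K\<^esub> y) else 0)"

definition is_completion :: "('a, 'm) ring_scheme \<Rightarrow> ('a \<Rightarrow> real) \<Rightarrow> ('a \<Rightarrow> 'b) \<Rightarrow>
    ('b, 'n) ring_scheme \<Rightarrow> ('b \<Rightarrow> real) \<Rightarrow> bool"
  where "is_completion F w i K v \<longleftrightarrow>
    absolute_value F w \<and> absolute_value K v \<and>
    Metric_space.mcomplete (carrier K) (av_dist K v) \<and>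
    i \<in> ring_hom F K \<and> (\<forall>x \<in> carrier F. v (i x) = w x) \<and>
    Abstract_Topology.closure_of (Metric_space.mtopology (carrier K) (av_dist K v))
      (i ` carrier F) = carrier K"

definition padic_abs :: "nat \<Rightarrow> rat \<Rightarrow> real"
  where "padic_abs p x = (if x = 0 then 0 else
    real p powi (int (multiplicity (int p) (snd (quotient_of x))) -
                 int (multiplicity (int p) (fst (quotient_of x)))))"

text \<open>\<open>C\<close> with the absolute value \<open>v\<close> is a completion of \<open>L\<close>, an algebraic closure of the
  completion \<open>Q\<close> of the rationals for the p-adic absolute value; \<open>v\<close> on \<open>L\<close> is an extension of
  the p-adic absolute value, hence the unique one.\<close>

definition is_Cp :: "nat \<Rightarrow> 'a ring \<Rightarrow> ('a \<Rightarrow> real) \<Rightarrow> bool"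
  where "is_Cp p C v \<longleftrightarrow> (\<exists>L Q i.
    subfield L C \<and>
    is_completion rat_ring (padic_abs p) i (C\<lparr>carrier := Q\<rparr>) v \<and>
    algebraic_closure (C\<lparr>carrier := L\<rparr>) Q \<and>
    is_completion (C\<lparr>carrier := L\<rparr>) v (\<lambda>x. x) C v)"

end

theory Submission
  imports Defs
begin

text \<open>Every element of \<open>G \<otimes> \<rat>\<close> is a pure tensor \<open>g \<otimes> 1/n\<close>, and two pure tensors agree exactly when they
  become equal in \<open>G\<close> after multiplication by a common denominator. Hence scalar multiplication and
  extensions of biadditive maps can be computed on pure tensors, and the quotient of a rational
  vector space by \<open>\<rat>\<^sup>\<times>\<close> inherits its hypergroup axioms from the group; distributivity holds with
  equality because the acting scalars form a group. The orbit of \<open>u \<otimes> 1\<close> determines \<open>u\<close> up to equality of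
  nonzero powers, which identifies \<open>X(A)\<close> with the quotient of the tensor product.

  Torsion freeness of \<open>\<E>(A)\<close> is the divisibility of \<open>\<rat>/\<int>\<close>. The action is associative
  because endomorphisms of \<open>\<rat>/\<int>\<close> are power maps on cyclic subgroups and therefore commute. For
  \<open>\<complex>\<^sub>p\<close> the roots of unity form a copy of \<open>\<rat>/\<int>\<close>; an embedding \<open>j\<close> of \<open>\<rat>/\<int>\<close> onto them makes
  \<open>\<alpha> \<mapsto> j \<circ> \<alpha>\<close> and \<open>t \<mapsto> e\<^sup>t\<close> bijective, so the class of \<open>(j, e)\<close> is a generator.\<close>

section \<open>Tensor products with the rationals\<close>

text \<open>\<open>rscale\<close> and \<open>rat_extend\<close> are definite descriptions over
  representations as pure tensors, so nothing about them can be computed before it is known when two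
  representations coincide. That criterion, \<open>qpure_eq_iff\<close>, is the technical core: the
  group may have torsion and need not be divisible, so its tensor product with Q is not visible
  inside the group, and equality has to be detected by maps back to the group.

  The sum of two classes modulo nonzero rationals is parametrised by the ratio of the two scalars,
  so the hypergroup axioms become statements about one ratio. As -1 is a nonzero rational, every
  class is its own negative.

  For \<open>C\<close> the roots of unity are extracted in the algebraically closed subfield
  \<open>L\<close>, and a count in the field \<open>C\<close> shows that none is missing. The
  compatible system of roots has orders n!, since factorials form a divisibility chain and every
  denominator divides one of them. In a prime step the freedom to multiply a q-th root by a q-th
  root of unity is just enough to force the order to grow by the factor q.\<close>

text \<open>Opaque, because the simplifier otherwise rewrites inside \<^term>\<open>add_monoid rat_ring\<close>, which
  occurs as an argument of the tensor product.\<close>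

definition rat_group :: "rat monoid"
  where "rat_group = add_monoid rat_ring"

lemma rat_group_simps [simp]:
  "carrier rat_group = UNIV" "x \<otimes>\<^bsub>rat_group\<^esub> y = x + y" "\<one>\<^bsub>rat_group\<^esub> = 0"
  by (simp_all add: rat_group_def ring_of_type_algebra_def)

lemma comm_group_rat_group: "comm_group rat_group"
  unfolding rat_group_def
  by (metis abelian_group.a_comm_group cring_from_type_algebra ring.is_abelian_group cring.axioms(1))

lemma int_pow_rat_group: "x [^]\<^bsub>rat_group\<^esub> (k::int) = of_int k * x"
proof -
  interpret comm_group rat_group by (rule comm_group_rat_group)
  have nat_case: "x [^]\<^bsub>rat_group\<^esub> (n::nat) = of_nat n * x" for n
    by (induction n) (simp_all add: algebra_simps)
  have inv_case: "inv\<^bsub>rat_group\<^esub> y = - y" for y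
    by (rule inv_equality) simp_all
  show ?thesis
    by (cases k rule: int_cases2) (simp_all add: int_pow_int int_pow_neg nat_case inv_case)
qed

abbreviation qtensor :: "('a, 'm) monoid_scheme \<Rightarrow> ('a \<times> rat \<Rightarrow>\<^sub>0 int) set monoid"
  where "qtensor G \<equiv> tensor_group G rat_group"

abbreviation qpure :: "('a, 'm) monoid_scheme \<Rightarrow> 'a \<Rightarrow> rat \<Rightarrow> ('a \<times> rat \<Rightarrow>\<^sub>0 int) set"
  where "qpure G \<equiv> pure_tensor G rat_group"

lemma (in group) rcos_eq_iff:
  assumes "subgroup N G" "x \<in> carrier G" "y \<in> carrier G"
  shows "N #> x = N #> y \<longleftrightarrow> x \<otimes> inv y \<in> N"
proof -
  have "N #> x = N #> y \<longleftrightarrow> x \<in> N #> y"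
    using assms rcos_self repr_independence by metis
  also have "\<dots> \<longleftrightarrow> x \<otimes> inv y \<in> N"
    using assms by (meson subgroup.rcos_module is_group)
  finally show ?thesis .
qed

lemma rat_common_denom:
  fixes q r :: rat
  obtains n a b :: int where "n > 0" "q = of_int a * (1 / of_int n)" "r = of_int b * (1 / of_int n)"
proof -
  obtain a n where q: "q = of_int a / of_int n" "n > (0::int)"
    by (metis quotient_of_denom_pos quotient_of_div surj_pair)
  obtain b m where r: "r = of_int b / of_int m" "m > (0::int)"
    by (metis quotient_of_denom_pos quotient_of_div surj_pair)
  show thesis
    by (rule that[of "n * m" "a * m" "b * n"]) (use q r in \<open>auto simp: field_simps\<close>)
qed

context comm_group
begin

lemma tensor_relations_subgroup:
  "subgroup (tensor_relations G rat_group) (free_Abelian_group (carrier G \<times> UNIV))"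
  unfolding tensor_relations_def
  by (simp, rule group.generate_is_subgroup[OF group_free_Abelian_group])
    (auto simp: subset_iff dest!: set_mp[OF keys_diff])

lemma tensor_relations_normal:
  "tensor_relations G rat_group \<lhd> free_Abelian_group (carrier G \<times> UNIV)"
  by (rule comm_group.normal_iff_subgroup[THEN iffD2, OF abelian_free_Abelian_group
        tensor_relations_subgroup])

lemma comm_group_qtensor: "comm_group (qtensor G)"
  unfolding tensor_group_def
  using comm_group.abelian_FactGroup[OF abelian_free_Abelian_group tensor_relations_subgroup]
  by simp

lemma qtensor_mult_coset:
  assumes "Poly_Mapping.keys x \<subseteq> carrier G \<times> UNIV" "Poly_Mapping.keys y \<subseteq> carrier G \<times> UNIV"
  shows "(tensor_relations G rat_group #>\<^bsub>free_Abelian_group (carrier G \<times> UNIV)\<^esub> x)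
      \<otimes>\<^bsub>qtensor G\<^esub> (tensor_relations G rat_group #>\<^bsub>free_Abelian_group (carrier G \<times> UNIV)\<^esub> y)
     = tensor_relations G rat_group #>\<^bsub>free_Abelian_group (carrier G \<times> UNIV)\<^esub> (x + y)"
  using normal.rcos_sum[OF tensor_relations_normal, of x y] assms
  by (simp add: tensor_group_def FactGroup_def)

lemma qpure_closed: "g \<in> carrier G \<Longrightarrow> qpure G g q \<in> carrier (qtensor G)"
  by (auto simp: tensor_group_def pure_tensor_def FactGroup_def RCOSETS_def)

lemma qpure_mult:
  assumes "g \<in> carrier G" "h \<in> carrier G"
  shows "qpure G (g \<otimes> h) q = qpure G g q \<otimes>\<^bsub>qtensor G\<^esub> qpure G h q"
proof -
  have "frag_of (g \<otimes> h, q) - frag_of (g, q) - frag_of (h, q) \<in> tensor_relations G rat_group"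
    unfolding tensor_relations_def by (rule generate.incl) (use assms in auto)
  moreover have "Poly_Mapping.keys (frag_of (g, q) + frag_of (h, q)) \<subseteq> carrier G \<times> UNIV"
    using assms by (auto dest!: set_mp[OF keys_add])
  ultimately show ?thesis
    using assms group.rcos_eq_iff[OF group_free_Abelian_group tensor_relations_subgroup]
    by (simp add: pure_tensor_def qtensor_mult_coset algebra_simps)
qed

lemma qpure_add:
  assumes "g \<in> carrier G"
  shows "qpure G g (q + r) = qpure G g q \<otimes>\<^bsub>qtensor G\<^esub> qpure G g r"
proof -
  have "frag_of (g, q + r) - frag_of (g, q) - frag_of (g, r) \<in> tensor_relations G rat_group"
    unfolding tensor_relations_def by (rule generate.incl) (use assms in force)
  moreover have "Poly_Mapping.keys (frag_of (g, q) + frag_of (g, r)) \<subseteq> carrier G \<times> UNIV"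
    using assms by (auto dest!: set_mp[OF keys_add])
  ultimately show ?thesis
    using assms group.rcos_eq_iff[OF group_free_Abelian_group tensor_relations_subgroup]
    by (simp add: pure_tensor_def qtensor_mult_coset algebra_simps)
qed

text \<open>An integer moves between the two slots because the pure tensor is a homomorphism in each
  of them: both sides are the k-th power of \<open>qpure G g q\<close>. Passing to common
  denominators rests on this.\<close>

lemma qpure_int_pow:
  assumes "g \<in> carrier G"
  shows "qpure G (g [^] (k::int)) q = qpure G g (of_int k * q)"
proof -
  have "(\<lambda>g. qpure G g q) \<in> hom G (qtensor G)"
    by (rule homI) (simp_all add: qpure_closed qpure_mult)
  from hom_int_pow[OF this assms is_group]
  have "qpure G (g [^] k) q = qpure G g q [^]\<^bsub>qtensor G\<^esub> k"
    using comm_group_qtensor comm_group.axioms(2) by blast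
  moreover have "(\<lambda>q. qpure G g q) \<in> hom rat_group (qtensor G)"
    by (rule homI) (use assms in \<open>simp_all add: qpure_closed qpure_add\<close>)
  from hom_int_pow[OF this, of q k]
  have "qpure G g (of_int k * q) = qpure G g q [^]\<^bsub>qtensor G\<^esub> k"
    by (simp add: int_pow_rat_group comm_group.axioms(2)[OF comm_group_qtensor]
        comm_group.axioms(2)[OF comm_group_rat_group])
  ultimately show ?thesis by simp
qed

lemma qpure_one: "qpure G \<one> q = \<one>\<^bsub>qtensor G\<^esub>"
proof -
  interpret T: comm_group "qtensor G" by (rule comm_group_qtensor)
  show ?thesis using qpure_mult[of \<one> \<one> q] qpure_closed[of \<one> q] by (simp add: T.l_cancel_one)
qed

lemma qpure_zero: "g \<in> carrier G \<Longrightarrow> qpure G g 0 = \<one>\<^bsub>qtensor G\<^esub>"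
  using qpure_int_pow[of g 0 0] by (simp add: qpure_one)

text \<open>Numerators are absorbed into the group elements by \<open>qpure_int_pow\<close>. Once
  the rational slots agree, \<open>qpure_mult\<close> combines the two tensors into one.\<close>

lemma qpure_common_denom:
  assumes "g \<in> carrier G" "h \<in> carrier G"
  obtains n g' h' where "n > (0::int)" "g' \<in> carrier G" "h' \<in> carrier G"
    "qpure G g q = qpure G g' (1 / of_int n)" "qpure G h r = qpure G h' (1 / of_int n)"
  by (metis assms int_pow_closed rat_common_denom[of q r] qpure_int_pow)

lemma qpure_inv:
  assumes "g \<in> carrier G"
  shows "qpure G (inv g) q = inv\<^bsub>qtensor G\<^esub> (qpure G g q)"
proof -
  interpret T: comm_group "qtensor G" by (rule comm_group_qtensor)
  show ?thesis
    by (rule T.inv_equality[symmetric])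
      (use assms in \<open>simp_all add: qpure_closed qpure_mult[symmetric] qpure_one\<close>)
qed

lemma qpure_uminus:
  assumes "g \<in> carrier G"
  shows "qpure G g (- q) = inv\<^bsub>qtensor G\<^esub> (qpure G g q)"
  using qpure_int_pow[OF assms, of "-1" q] qpure_inv[OF assms]
  by (simp add: int_pow_neg assms)

text \<open>The induction for free abelian groups builds everything from 0, generators and
  differences. A difference of two pure tensors is pure again once both have the same 1/n in the
  rational slot.\<close>

lemma qtensorE:
  assumes "u \<in> carrier (qtensor G)"
  obtains g q where "g \<in> carrier G" "u = qpure G g q"
proof -
  interpret T: comm_group "qtensor G" by (rule comm_group_qtensor)
  let ?c = "\<lambda>x. tensor_relations G rat_group #>\<^bsub>free_Abelian_group (carrier G \<times> UNIV)\<^esub> x"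
  obtain x where x: "Poly_Mapping.keys x \<subseteq> carrier G \<times> UNIV" "u = ?c x"
    using assms by (auto simp: tensor_group_def FactGroup_def RCOSETS_def)
  have c_closed: "?c x \<in> carrier (qtensor G)" if "Poly_Mapping.keys x \<subseteq> carrier G \<times> UNIV" for x
    using that by (auto simp: tensor_group_def FactGroup_def RCOSETS_def)
  have "\<exists>g \<in> carrier G. \<exists>q. ?c x = qpure G g q"
    using x(1)
  proof (rule free_Abelian_group_induct)
    have "?c 0 = \<one>\<^bsub>qtensor G\<^esub>"
      using qtensor_mult_coset[of 0 0] c_closed[of 0] by (simp add: T.l_cancel_one)
    then show "\<exists>g \<in> carrier G. \<exists>q. ?c 0 = qpure G g q" using qpure_one by (metis one_closed)
  next
    fix x y
    assume keys: "Poly_Mapping.keys x \<subseteq> carrier G \<times> UNIV" "Poly_Mapping.keys y \<subseteq> carrier G \<times> UNIV"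
      and pure: "\<exists>g \<in> carrier G. \<exists>q. ?c x = qpure G g q" "\<exists>g \<in> carrier G. \<exists>q. ?c y = qpure G g q"
    from pure obtain g q h r
      where gh: "g \<in> carrier G" "h \<in> carrier G" "?c x = qpure G g q" "?c y = qpure G h r"
      by blast
    obtain n g' h' where n: "n > (0::int)" "g' \<in> carrier G" "h' \<in> carrier G"
      "?c x = qpure G g' (1 / of_int n)" "?c y = qpure G h' (1 / of_int n)"
      using qpure_common_denom[OF gh(1,2)] gh(3,4) by metis
    have "Poly_Mapping.keys (x - y) \<subseteq> carrier G \<times> UNIV"
      using keys by (meson keys_diff Un_least dual_order.trans)
    \<comment> \<open>The coset map is so far known to respect sums only, so the coset of
      \<open>x - y\<close> is solved from (x - y) + y = x.\<close>
    then have "?c (x - y) \<otimes>\<^bsub>qtensor G\<^esub> ?c y = ?c x" "?c (x - y) \<in> carrier (qtensor G)"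
      using qtensor_mult_coset[of "x - y" y] keys c_closed by simp_all
    then have "?c (x - y) = ?c x \<otimes>\<^bsub>qtensor G\<^esub> inv\<^bsub>qtensor G\<^esub> ?c y"
      using T.inv_solve_right c_closed keys by metis
    also have "\<dots> = qpure G (g' \<otimes> inv h') (1 / of_int n)"
      using n by (simp add: qpure_mult qpure_inv)
    finally show "\<exists>g \<in> carrier G. \<exists>q. ?c (x - y) = qpure G g q" using n by blast
  next
    fix a :: "'a \<times> rat" assume "a \<in> carrier G \<times> UNIV"
    then show "\<exists>g \<in> carrier G. \<exists>q. ?c (frag_of a) = qpure G g q" by (auto simp: pure_tensor_def)
  qed
  with x that show thesis by auto
qed

lemma qtensor_common_denom:
  assumes "u \<in> carrier (qtensor G)" "v \<in> carrier (qtensor G)"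
  obtains n g h where "n > (0::int)" "g \<in> carrier G" "h \<in> carrier G"
    "u = qpure G g (1 / of_int n)" "v = qpure G h (1 / of_int n)"
  by (metis assms qtensorE qpure_common_denom)

text \<open>The forward direction evaluates formal sums after multiplication by an integer that clears
  all denominators; this is a homomorphism for every such integer, and it kills the bilinearity
  relations as soon as the integer is divisible enough.\<close>

lemma qpure_eq_iff:
  assumes "g \<in> carrier G" "h \<in> carrier G"
  shows "qpure G g q = qpure G h r \<longleftrightarrow>
    (\<exists>n a b :: int. n > 0 \<and> of_int n * q = of_int a \<and> of_int n * r = of_int b \<and> g [^] a = h [^] b)"
    (is "?lhs \<longleftrightarrow> ?rhs")
proof
  assume ?rhs
  then obtain n a b :: int where n: "n > 0" "of_int n * q = of_int a" "of_int n * r = of_int b"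
    "g [^] a = h [^] b" by blast
  have "q = of_int a * (1 / of_int n)" "r = of_int b * (1 / of_int n)"
    using n by (simp_all add: field_simps)
  with assms n(4) show ?lhs by (metis qpure_int_pow)
next
  let ?F = "free_Abelian_group (carrier G \<times> (UNIV :: rat set))"
  \<comment> \<open>The value on g (x) q is meant to be g^(k q). The floor makes the exponent an
    integer for every pair; it is exact as soon as \<open>k\<close> clears the denominator of
    \<open>q\<close>, and additivity in \<open>q\<close> is claimed only there.\<close>
  define f where "f = (\<lambda>k::int. \<lambda>(g, q). g [^] \<lfloor>of_int k * q :: rat\<rfloor>)"
  have "\<exists>e. e \<in> hom ?F G \<and> (\<forall>x \<in> carrier G \<times> UNIV. e (frag_of x) = f k x)" for k
  proof -
    have "f k ` (carrier G \<times> UNIV) \<subseteq> carrier G" by (auto simp: f_def)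
    from free_Abelian_group_universal[OF this] show ?thesis by metis
  qed
  then obtain e where e: "\<And>k. e k \<in> hom ?F G"
    and e_frag: "\<And>k x. x \<in> carrier G \<times> UNIV \<Longrightarrow> e k (frag_of x) = f k x"
    by metis
  interpret F: comm_group ?F by (rule abelian_free_Abelian_group)
  interpret e: group_hom ?F G "e k" for k
    by unfold_locales (rule e)
  have e_diff: "e k (x - y) = e k x \<otimes> inv (e k y)"
    if "Poly_Mapping.keys x \<subseteq> carrier G \<times> UNIV" "Poly_Mapping.keys y \<subseteq> carrier G \<times> UNIV" for k x y
    using e.hom_mult[of x "-y" k] e.hom_inv[of y k] that by simp
  have e_relation: "e k (x - y - z) = \<one>"
    if "Poly_Mapping.keys x \<subseteq> carrier G \<times> UNIV" "Poly_Mapping.keys y \<subseteq> carrier G \<times> UNIV"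
      "Poly_Mapping.keys z \<subseteq> carrier G \<times> UNIV" "e k x = e k y \<otimes> e k z" for k x y z
  proof -
    have closed: "e k y \<in> carrier G" "e k z \<in> carrier G" using that by auto
    have "Poly_Mapping.keys (x - y) \<subseteq> carrier G \<times> UNIV"
      using that by (meson keys_diff Un_least dual_order.trans)
    then have "e k (x - y - z) = e k z \<otimes> e k y \<otimes> inv (e k y) \<otimes> inv (e k z)"
      using that closed by (simp add: e_diff m_comm)
    also have "\<dots> = \<one>" using closed by (simp add: inv_solve_right')
    finally show ?thesis .
  qed
  let ?gens = "{frag_of (a \<otimes> a', b) - frag_of (a, b) - frag_of (a', b) | a a' b.
        a \<in> carrier G \<and> a' \<in> carrier G \<and> b \<in> carrier rat_group} \<union>
     {frag_of (a, b \<otimes>\<^bsub>rat_group\<^esub> b') - frag_of (a, b) - frag_of (a, b') | a b b'.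
        a \<in> carrier G \<and> b \<in> carrier rat_group \<and> b' \<in> carrier rat_group}"
  have gens_closed: "x \<in> carrier ?F" if "x \<in> ?gens" for x
    using that by (auto dest!: set_mp[OF keys_diff])
  \<comment> \<open>Additivity in the group slot holds for every \<open>k\<close>, so m = 1 serves;
    in the rational slot a common denominator of the two rationals serves.\<close>
  have gens_kills: "\<exists>m>0. \<forall>k. m dvd k \<longrightarrow> e k x = \<one>" if "x \<in> ?gens" for x
  proof -
    from that consider g h q where "x = frag_of (g \<otimes> h, q) - frag_of (g, q) - frag_of (h, q)"
          "g \<in> carrier G" "h \<in> carrier G"
        | g q r where "x = frag_of (g, q + r) - frag_of (g, q) - frag_of (g, r)" "g \<in> carrier G"
      by auto
    then show ?thesis
    proof cases
      case 1
      then have "e k x = \<one>" for k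
        unfolding 1(1) by (intro e_relation) (simp_all add: e_frag f_def int_pow_distrib)
      then show ?thesis by (auto intro: exI[of _ 1])
    next
      case 2
      obtain n a b :: int where n: "n > 0" "q = of_int a * (1 / of_int n)" "r = of_int b * (1 / of_int n)"
        by (rule rat_common_denom)
      have "e k x = \<one>" if "n dvd k" for k
      proof -
        obtain l where "k = n * l" using \<open>n dvd k\<close> by (rule dvdE)
        then have floors: "of_int k * q = of_int (l * a)" "of_int k * r = of_int (l * b)"
          "of_int k * (q + r) = of_int (l * a + l * b)"
          using n by (simp_all add: field_simps)
        show ?thesis
          unfolding 2(1)
        proof (rule e_relation)
          show "e k (frag_of (g, q + r)) = e k (frag_of (g, q)) \<otimes> e k (frag_of (g, r))"
            using 2(2) by (simp only: e_frag f_def prod.case floors floor_of_int int_pow_mult mem_Times_iff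
                fst_conv snd_conv UNIV_I simp_thms)
        qed (use 2(2) in auto)
      qed
      then show ?thesis using \<open>n > 0\<close> by blast
    qed
  qed
  \<comment> \<open>Each relation involves finitely many generators, and the moduli that serve two
    factors multiply to one that serves their product.\<close>
  have kills: "\<exists>m>0. \<forall>k. m dvd k \<longrightarrow> e k x = \<one>" if "x \<in> tensor_relations G rat_group" for x
  proof -
    have "x \<in> carrier ?F \<and> (\<exists>m>0. \<forall>k. m dvd k \<longrightarrow> e k x = \<one>)"
      using that unfolding tensor_relations_def
    proof (induction rule: generate.induct)
      case one
      then show ?case by (auto intro: exI[of _ 1] simp: e.hom_one[simplified])
    next
      case (incl x)
      then show ?case using gens_closed gens_kills by blast
    next
      case (inv x)
      then obtain m where m: "m > 0" "\<forall>k. m dvd k \<longrightarrow> e k x = \<one>" using gens_kills by blast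
      have "x \<in> carrier ?F" using inv gens_closed by blast
      with m show ?case by (simp del: carrier_free_Abelian_group_iff) (metis e.hom_inv inv_one)
    next
      case (eng x y)
      then obtain m n where m: "m > 0" "\<forall>k. m dvd k \<longrightarrow> e k x = \<one>"
        and n: "n > 0" "\<forall>k. n dvd k \<longrightarrow> e k y = \<one>" by blast
      have closed: "x \<in> carrier ?F" "y \<in> carrier ?F" using eng by auto
      then have "\<forall>k. m * n dvd k \<longrightarrow> e k (x \<otimes>\<^bsub>?F\<^esub> y) = \<one>"
        using m n by (metis dvd_mult_left dvd_mult_right e.hom_mult one_closed r_one)
      then show ?case using m(1) n(1) closed F.m_closed
        by (metis mult_pos_pos rat_group_simps(1))
    qed
    then show ?thesis ..
  qed
  assume ?lhs
  then have "frag_of (g, q) - frag_of (h, r) \<in> tensor_relations G rat_group"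
    using assms group.rcos_eq_iff[OF group_free_Abelian_group tensor_relations_subgroup]
    by (simp add: pure_tensor_def)
  from kills[OF this] obtain m where m: "m > 0"
    "\<And>k. m dvd k \<Longrightarrow> e k (frag_of (g, q) - frag_of (h, r)) = \<one>" by blast
  obtain n a b :: int where n: "n > 0" "q = of_int a * (1 / of_int n)" "r = of_int b * (1 / of_int n)"
    by (rule rat_common_denom)
  \<comment> \<open>One integer does two jobs: as a multiple of \<open>m\<close> it kills the
    relation, as a multiple of \<open>n\<close> it makes both floors exact.\<close>
  have q: "of_int (m * n) * q = of_int (m * a)" and r: "of_int (m * n) * r = of_int (m * b)"
    using n by simp_all
  have "f (m * n) (g, q) \<otimes> inv (f (m * n) (h, r)) = \<one>"
    using m(2)[of "m * n"] assms by (simp add: e_diff e_frag)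
  then have "g [^] (m * a) \<otimes> inv (h [^] (m * b)) = \<one>"
    unfolding f_def prod.case q r floor_of_int .
  then have "g [^] (m * a) = h [^] (m * b)"
    using assms by (metis int_pow_closed inv_closed inv_equality inv_inv)
  with q r m(1) n(1) show ?rhs by (meson mult_pos_pos)
qed

end

section \<open>Rational scalars, their orbits, and the hypergroup of orbits\<close>

context comm_group
begin

text \<open>If q = c/d, the witness \<open>n\<close> of the first equality becomes n d, and the
  exponents \<open>a\<close>, \<open>b\<close> become c a and c b. This is the uniqueness behind the
  definite description in \<open>rscale\<close>.\<close>

lemma qpure_eq_scale:
  assumes "g \<in> carrier G" "h \<in> carrier G" "qpure G g r = qpure G h s"
  shows "qpure G g (q * r) = qpure G h (q * s)"
proof -
  obtain n a b :: int where n: "n > 0" "of_int n * r = of_int a" "of_int n * s = of_int b"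
    "g [^] a = h [^] b"
    using assms qpure_eq_iff by blast
  obtain c d where cd: "q = of_int c / of_int d" "d > (0::int)"
    by (metis quotient_of_denom_pos quotient_of_div surj_pair)
  have "of_int (n * d) * (q * t) = of_int c * (of_int n * t)" for t
    using cd by simp
  then have "of_int (n * d) * (q * r) = of_int (c * a)" "of_int (n * d) * (q * s) = of_int (c * b)"
    by (simp_all only: n of_int_mult)
  moreover have "g [^] (c * a) = h [^] (c * b)"
    using n(4) assms by (metis int_pow_pow mult.commute)
  ultimately show ?thesis
    using qpure_eq_iff[OF assms(1,2)] n(1) cd(2) by (meson mult_pos_pos)
qed

lemma rscale_qpure:
  assumes "g \<in> carrier G"
  shows "rscale G q (qpure G g r) = qpure G g (q * r)"
  unfolding rscale_def rat_group_def[symmetric]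
proof (rule the_equality)
  show "\<exists>m\<in>carrier G. \<exists>s. qpure G g r = qpure G m s \<and> qpure G g (q * r) = qpure G m (q * s)"
    using assms by blast
next
  fix w assume "\<exists>m\<in>carrier G. \<exists>s. qpure G g r = qpure G m s \<and> w = qpure G m (q * s)"
  then obtain m s where "m \<in> carrier G" "qpure G g r = qpure G m s" "w = qpure G m (q * s)"
    by blast
  then show "w = qpure G g (q * r)" using qpure_eq_scale[OF assms] by simp
qed

lemma rscale_closed: "v \<in> carrier (qtensor G) \<Longrightarrow> rscale G q v \<in> carrier (qtensor G)"
  by (metis qpure_closed qtensorE rscale_qpure)

lemma rscale_mult:
  assumes "u \<in> carrier (qtensor G)" "v \<in> carrier (qtensor G)"
  shows "rscale G q (u \<otimes>\<^bsub>qtensor G\<^esub> v) = rscale G q u \<otimes>\<^bsub>qtensor G\<^esub> rscale G q v"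
  using assms
  by (rule qtensor_common_denom) (simp add: rscale_qpure qpure_mult[symmetric])

lemma rscale_rscale: "v \<in> carrier (qtensor G) \<Longrightarrow> rscale G q (rscale G r v) = rscale G (q * r) v"
  by (metis qtensorE rscale_qpure mult.assoc)

lemma rscale_1: "v \<in> carrier (qtensor G) \<Longrightarrow> rscale G 1 v = v"
  by (metis qtensorE rscale_qpure mult_1)

lemma rscale_minus_1: "v \<in> carrier (qtensor G) \<Longrightarrow> rscale G (-1) v = inv\<^bsub>qtensor G\<^esub> v"
  by (metis qtensorE rscale_qpure mult_minus1 qpure_uminus)

lemma rscale_one: "rscale G q \<one>\<^bsub>qtensor G\<^esub> = \<one>\<^bsub>qtensor G\<^esub>"
  by (metis one_closed qpure_one rscale_qpure)

lemma rscale_inv: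
  "v \<in> carrier (qtensor G) \<Longrightarrow> rscale G q (inv\<^bsub>qtensor G\<^esub> v) = rscale G (- q) v"
  by (simp add: rscale_minus_1[symmetric] rscale_rscale)

lemma mem_rorbit: "v \<in> carrier (qtensor G) \<Longrightarrow> w \<in> rorbit G v \<longleftrightarrow> (\<exists>q. q \<noteq> 0 \<and> w = rscale G q v)"
  by (auto simp: rorbit_def)

lemma rorbit_rscale:
  assumes "v \<in> carrier (qtensor G)" "q \<noteq> 0"
  shows "rorbit G (rscale G q v) = rorbit G v"
proof -
  have "\<exists>s. rscale G r v = rscale G (s * q) v \<and> s \<noteq> 0" if "r \<noteq> 0" for r
    using that assms by (intro exI[of _ "r / q"]) simp
  then show ?thesis
    using assms by (auto simp: rorbit_def rscale_rscale)
qed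

lemma rorbit_self: "v \<in> carrier (qtensor G) \<Longrightarrow> v \<in> rorbit G v"
  using mem_rorbit[of v v] rscale_1[of v] by (metis zero_neq_one)

lemma rorbit_eq_iff:
  assumes "u \<in> carrier (qtensor G)" "v \<in> carrier (qtensor G)"
  shows "rorbit G u = rorbit G v \<longleftrightarrow> (\<exists>q. q \<noteq> 0 \<and> u = rscale G q v)"
proof
  assume "rorbit G u = rorbit G v"
  then have "u \<in> rorbit G v" using rorbit_self[OF assms(1)] by simp
  then show "\<exists>q. q \<noteq> 0 \<and> u = rscale G q v" unfolding mem_rorbit[OF assms(2)] .
next
  assume "\<exists>q. q \<noteq> 0 \<and> u = rscale G q v"
  then show "rorbit G u = rorbit G v" using rorbit_rscale[OF assms(2)] by auto
qed

text \<open>Every scalar fixes the zero vector. As the zero class is a singleton, equality with it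
  is an equation between vectors.\<close>

lemma rorbit_one: "rorbit G \<one>\<^bsub>qtensor G\<^esub> = {\<one>\<^bsub>qtensor G\<^esub>}"
proof -
  have "\<exists>q :: rat. q \<noteq> 0" by (rule exI[of _ 1]) simp
  then show ?thesis by (simp add: rorbit_def rscale_one)
qed

lemma rquotient_simps:
  "carrier (rquotient G) = rorbit G ` carrier (qtensor G)"
  "hzero (rquotient G) = rorbit G \<one>\<^bsub>qtensor G\<^esub>"
  by (simp_all add: rquotient_def rat_group_def)

lemma rquotient_hadd:
  assumes "u \<in> carrier (qtensor G)" "v \<in> carrier (qtensor G)"
  shows "rorbit G u \<boxplus>\<^bsub>rquotient G\<^esub> rorbit G v =
    {rorbit G (rscale G q u \<otimes>\<^bsub>qtensor G\<^esub> rscale G r v) | q r. q \<noteq> 0 \<and> r \<noteq> 0}"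
proof -
  have "rorbit G u \<boxplus>\<^bsub>rquotient G\<^esub> rorbit G v =
      {rorbit G (a \<otimes>\<^bsub>qtensor G\<^esub> b) | a b. a \<in> rorbit G u \<and> b \<in> rorbit G v}"
    by (simp add: rquotient_def[folded rat_group_def])
  also have "\<dots> = {rorbit G (rscale G q u \<otimes>\<^bsub>qtensor G\<^esub> rscale G r v) | q r. q \<noteq> 0 \<and> r \<noteq> 0}"
    (is "?A = ?B")
  proof
    show "?A \<subseteq> ?B"
    proof
      fix x assume "x \<in> ?A"
      then obtain a b where "x = rorbit G (a \<otimes>\<^bsub>qtensor G\<^esub> b)" "a \<in> rorbit G u" "b \<in> rorbit G v"
        by blast
      then show "x \<in> ?B" using mem_rorbit[OF assms(1)] mem_rorbit[OF assms(2)] by auto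
    qed
    show "?B \<subseteq> ?A"
    proof
      fix x assume "x \<in> ?B"
      then obtain q r where "x = rorbit G (rscale G q u \<otimes>\<^bsub>qtensor G\<^esub> rscale G r v)" "q \<noteq> 0" "r \<noteq> 0"
        by blast
      moreover from this have "rscale G q u \<in> rorbit G u" "rscale G r v \<in> rorbit G v"
        using mem_rorbit[OF assms(1)] mem_rorbit[OF assms(2)] by auto
      ultimately show "x \<in> ?A" by blast
    qed
  qed
  finally show ?thesis .
qed

text \<open>An orbit ignores a common nonzero factor, so the scalar of the first summand can be
  divided out and only the ratio r / q remains. The hypergroup axioms and distributivity are checked
  in this form.\<close>

lemma rquotient_hadd_right:
  assumes "u \<in> carrier (qtensor G)" "v \<in> carrier (qtensor G)"
  shows "rorbit G u \<boxplus>\<^bsub>rquotient G\<^esub> rorbit G v =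
    (\<lambda>r. rorbit G (u \<otimes>\<^bsub>qtensor G\<^esub> rscale G r v)) ` (- {0})"
proof (unfold rquotient_hadd[OF assms], safe)
  interpret T: comm_group "qtensor G" by (rule comm_group_qtensor)
  fix q r :: rat assume "q \<noteq> 0" "r \<noteq> 0"
  have "rscale G q u \<otimes>\<^bsub>qtensor G\<^esub> rscale G r v =
      rscale G q (u \<otimes>\<^bsub>qtensor G\<^esub> rscale G (r / q) v)"
    using assms \<open>q \<noteq> 0\<close> by (simp add: rscale_mult rscale_rscale rscale_closed)
  then have "rorbit G (rscale G q u \<otimes>\<^bsub>qtensor G\<^esub> rscale G r v) =
      rorbit G (u \<otimes>\<^bsub>qtensor G\<^esub> rscale G (r / q) v)"
    using assms \<open>q \<noteq> 0\<close> by (simp add: rorbit_rscale rscale_closed)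
  then show "rorbit G (rscale G q u \<otimes>\<^bsub>qtensor G\<^esub> rscale G r v) \<in>
      (\<lambda>r. rorbit G (u \<otimes>\<^bsub>qtensor G\<^esub> rscale G r v)) ` (- {0})"
    using \<open>q \<noteq> 0\<close> \<open>r \<noteq> 0\<close> by auto
next
  fix r :: rat assume "r \<noteq> 0"
  then show "\<exists>q r'. rorbit G (u \<otimes>\<^bsub>qtensor G\<^esub> rscale G r v) =
      rorbit G (rscale G q u \<otimes>\<^bsub>qtensor G\<^esub> rscale G r' v) \<and> q \<noteq> 0 \<and> r' \<noteq> 0"
    by (intro exI[of _ 1] exI[of _ r]) (simp add: rscale_1 assms)
qed

text \<open>The negative of a vector lies in its own orbit, because -1 is an admissible scalar;
  hence each class is its own, and only, negative.\<close>

lemma rquotient_zero_mem_hadd: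
  assumes "u \<in> carrier (qtensor G)" "v \<in> carrier (qtensor G)"
  shows "rorbit G \<one>\<^bsub>qtensor G\<^esub> \<in> rorbit G u \<boxplus>\<^bsub>rquotient G\<^esub> rorbit G v \<longleftrightarrow> rorbit G u = rorbit G v"
proof -
  interpret T: comm_group "qtensor G" by (rule comm_group_qtensor)
  have "rorbit G \<one>\<^bsub>qtensor G\<^esub> = rorbit G (u \<otimes>\<^bsub>qtensor G\<^esub> rscale G r v) \<longleftrightarrow> u = rscale G (- r) v" for r
  proof -
    have rv: "rscale G r v \<in> carrier (qtensor G)" by (rule rscale_closed[OF assms(2)])
    have "rscale G (- r) v = inv\<^bsub>qtensor G\<^esub> rscale G r v"
      using rscale_minus_1[OF rv] rscale_rscale[OF assms(2), of "-1" r] by simp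
    moreover have "rorbit G \<one>\<^bsub>qtensor G\<^esub> = rorbit G (u \<otimes>\<^bsub>qtensor G\<^esub> rscale G r v) \<longleftrightarrow>
        u \<otimes>\<^bsub>qtensor G\<^esub> rscale G r v = \<one>\<^bsub>qtensor G\<^esub>"
      using rorbit_self[OF T.m_closed[OF assms(1) rv]] by (metis rorbit_one singletonD)
    moreover have "u \<otimes>\<^bsub>qtensor G\<^esub> rscale G r v = \<one>\<^bsub>qtensor G\<^esub> \<longleftrightarrow>
        u = inv\<^bsub>qtensor G\<^esub> rscale G r v"
      using assms(1) rv T.inv_equality T.l_inv by blast
    ultimately show ?thesis by (simp only:)
  qed
  then have "rorbit G \<one>\<^bsub>qtensor G\<^esub> \<in> rorbit G u \<boxplus>\<^bsub>rquotient G\<^esub> rorbit G v \<longleftrightarrow>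
      (\<exists>r. r \<noteq> 0 \<and> u = rscale G (- r) v)"
    unfolding rquotient_hadd_right[OF assms] image_iff by (simp add: Bex_def)
  also have "\<dots> \<longleftrightarrow> (\<exists>r. r \<noteq> 0 \<and> u = rscale G r v)"
    by (metis minus_minus neg_0_equal_iff_equal)
  finally show ?thesis using assms rorbit_eq_iff by simp
qed

text \<open>In additive notation both sides consist of the orbits of u + q v + r w with q and r
  nonzero.\<close>

lemma rquotient_hadd_assoc:
  assumes "u \<in> carrier (qtensor G)" "v \<in> carrier (qtensor G)" "w \<in> carrier (qtensor G)"
  shows "(\<Union>t \<in> rorbit G u \<boxplus>\<^bsub>rquotient G\<^esub> rorbit G v. t \<boxplus>\<^bsub>rquotient G\<^esub> rorbit G w) =
    (\<Union>t \<in> rorbit G v \<boxplus>\<^bsub>rquotient G\<^esub> rorbit G w. rorbit G u \<boxplus>\<^bsub>rquotient G\<^esub> t)"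
proof -
  interpret T: comm_group "qtensor G" by (rule comm_group_qtensor)
  define F where "F = (\<lambda>q r. rorbit G (u \<otimes>\<^bsub>qtensor G\<^esub> rscale G q v \<otimes>\<^bsub>qtensor G\<^esub> rscale G r w))"
  have left: "rorbit G (u \<otimes>\<^bsub>qtensor G\<^esub> rscale G q v) \<boxplus>\<^bsub>rquotient G\<^esub> rorbit G w = F q ` (- {0})" for q
    unfolding F_def using assms
    by (simp only: rquotient_hadd_right[of "u \<otimes>\<^bsub>qtensor G\<^esub> rscale G q v" w] T.m_closed rscale_closed)
  have right: "rorbit G u \<boxplus>\<^bsub>rquotient G\<^esub> rorbit G (v \<otimes>\<^bsub>qtensor G\<^esub> rscale G r w) =
      (\<lambda>q. F q (q * r)) ` (- {0})" for r
  proof -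
    have "u \<otimes>\<^bsub>qtensor G\<^esub> rscale G q (v \<otimes>\<^bsub>qtensor G\<^esub> rscale G r w) =
        u \<otimes>\<^bsub>qtensor G\<^esub> rscale G q v \<otimes>\<^bsub>qtensor G\<^esub> rscale G (q * r) w" for q
      using assms by (simp add: rscale_closed rscale_mult rscale_rscale T.m_assoc)
    then show ?thesis
      unfolding F_def using assms rquotient_hadd_right[of u "v \<otimes>\<^bsub>qtensor G\<^esub> rscale G r w"]
      by (simp add: rscale_closed)
  qed
  have "(\<Union>t \<in> rorbit G u \<boxplus>\<^bsub>rquotient G\<^esub> rorbit G v. t \<boxplus>\<^bsub>rquotient G\<^esub> rorbit G w) =
      (\<Union>q \<in> - {0}. F q ` (- {0}))"
    by (simp only: rquotient_hadd_right[OF assms(1,2)] image_image left)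
  \<comment> \<open>Scaling v + r w by q turns the last scalar into q r, so the pair (q, r) of the
    left side is the pair (q, r / q) of the right side.\<close>
  also have "\<dots> = (\<Union>r \<in> - {0}. (\<lambda>q. F q (q * r)) ` (- {0}))"
  proof (intro equalityI subsetI)
    fix x assume "x \<in> (\<Union>q \<in> - {0}. F q ` (- {0}))"
    then obtain q r where "q \<noteq> 0" "r \<noteq> 0" "x = F q r" by auto
    then show "x \<in> (\<Union>r \<in> - {0}. (\<lambda>q. F q (q * r)) ` (- {0}))"
      by (intro UN_I[of "r / q"] image_eqI[of _ _ q]) auto
  next
    fix x assume "x \<in> (\<Union>r \<in> - {0}. (\<lambda>q. F q (q * r)) ` (- {0}))"
    then obtain q r where "q \<noteq> 0" "r \<noteq> 0" "x = F q (q * r)" by auto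
    then show "x \<in> (\<Union>q \<in> - {0}. F q ` (- {0}))"
      by (intro UN_I[of q] image_eqI[of _ _ "q * r"]) auto
  qed
  also have "\<dots> = (\<Union>t \<in> rorbit G v \<boxplus>\<^bsub>rquotient G\<^esub> rorbit G w. rorbit G u \<boxplus>\<^bsub>rquotient G\<^esub> t)"
    by (simp only: rquotient_hadd_right[OF assms(2,3)] image_image right)
  finally show ?thesis .
qed

lemma hypergroup_rquotient: "hypergroup (rquotient G)"
proof -
  interpret T: comm_group "qtensor G" by (rule comm_group_qtensor)
  let ?V = "carrier (qtensor G)" and ?o = "rorbit G" and ?s = "rscale G"
  have comm: "?o u \<boxplus>\<^bsub>rquotient G\<^esub> ?o v \<subseteq> ?o v \<boxplus>\<^bsub>rquotient G\<^esub> ?o u" if "u \<in> ?V" "v \<in> ?V" for u v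
  proof -
    have "?s q u \<otimes>\<^bsub>qtensor G\<^esub> ?s r v = ?s r v \<otimes>\<^bsub>qtensor G\<^esub> ?s q u" for q r
      using that by (intro T.m_comm rscale_closed)
    then show ?thesis unfolding rquotient_hadd[OF that] rquotient_hadd[OF that(2,1)] by fastforce
  qed
  have nonzero_exists: "- {0 :: rat} \<noteq> {}"
  proof -
    have "1 \<in> - {0 :: rat}" by simp
    then show ?thesis by (rule ex_in_conv[THEN iffD1, OF exI])
  qed
  show ?thesis
  proof (unfold_locales, unfold rquotient_simps)
    fix x y assume "x \<in> ?o ` ?V" "y \<in> ?o ` ?V"
    then obtain u v where u: "x = ?o u" "u \<in> ?V" and v: "y = ?o v" "v \<in> ?V" by auto
    show "x \<boxplus>\<^bsub>rquotient G\<^esub> y \<subseteq> ?o ` ?V"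
      using u v by (auto simp: rquotient_hadd_right rscale_closed)
    show "x \<boxplus>\<^bsub>rquotient G\<^esub> y \<noteq> {}"
      using u v nonzero_exists by (simp add: rquotient_hadd_right)
    show "x \<boxplus>\<^bsub>rquotient G\<^esub> y = y \<boxplus>\<^bsub>rquotient G\<^esub> x"
      unfolding u(1) v(1) by (intro equalityI comm u(2) v(2))
  next
    fix x y z assume "x \<in> ?o ` ?V" "y \<in> ?o ` ?V" "z \<in> ?o ` ?V"
    then obtain u v w where "x = ?o u" "u \<in> ?V" "y = ?o v" "v \<in> ?V" "z = ?o w" "w \<in> ?V"
      by auto
    then show "(\<Union>t \<in> x \<boxplus>\<^bsub>rquotient G\<^esub> y. t \<boxplus>\<^bsub>rquotient G\<^esub> z) =
        (\<Union>t \<in> y \<boxplus>\<^bsub>rquotient G\<^esub> z. x \<boxplus>\<^bsub>rquotient G\<^esub> t)"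
      using rquotient_hadd_assoc[of u v w] by (simp only:)
  next
    show "?o \<one>\<^bsub>qtensor G\<^esub> \<in> ?o ` ?V" by simp
  next
    fix x assume "x \<in> ?o ` ?V"
    then obtain u where u: "x = ?o u" "u \<in> ?V" by auto
    show "x \<boxplus>\<^bsub>rquotient G\<^esub> ?o \<one>\<^bsub>qtensor G\<^esub> = {x}"
      using u by (auto simp: rquotient_hadd_right rscale_one intro!: image_eqI[of _ _ 1])
    show "\<exists>!y. y \<in> ?o ` ?V \<and> ?o \<one>\<^bsub>qtensor G\<^esub> \<in> x \<boxplus>\<^bsub>rquotient G\<^esub> y"
      using u rquotient_zero_mem_hadd by (intro ex1I[of _ x]) auto
  next
    fix x y z z'
    assume "x \<in> ?o ` ?V" "y \<in> ?o ` ?V" "z \<in> ?o ` ?V" "z' \<in> ?o ` ?V"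
      and mem: "x \<in> y \<boxplus>\<^bsub>rquotient G\<^esub> z" "?o \<one>\<^bsub>qtensor G\<^esub> \<in> z \<boxplus>\<^bsub>rquotient G\<^esub> z'"
    then obtain v w w' where v: "y = ?o v" "v \<in> ?V" and w: "z = ?o w" "w \<in> ?V"
      and w': "z' = ?o w'" "w' \<in> ?V" by blast
    \<comment> \<open>Classes are their own negatives, so \<open>z'\<close> can only be
      \<open>z\<close>; \<open>y\<close> is then recovered from \<open>x\<close> by adding the
      multiple -q of \<open>w\<close>.\<close>
    then have "z = z'"
      using mem(2) rquotient_zero_mem_hadd[OF w(2) w'(2)] by (simp only:)
    obtain q where q: "q \<noteq> 0" "x = ?o (v \<otimes>\<^bsub>qtensor G\<^esub> ?s q w)"
      using mem(1) v w by (auto simp: rquotient_hadd_right)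
    have "v = (v \<otimes>\<^bsub>qtensor G\<^esub> ?s q w) \<otimes>\<^bsub>qtensor G\<^esub> ?s (- q) w"
      using v w by (simp add: T.m_assoc rscale_closed rscale_inv[symmetric] rscale_mult[symmetric] rscale_one)
    then have "?o v = ?o ((v \<otimes>\<^bsub>qtensor G\<^esub> ?s q w) \<otimes>\<^bsub>qtensor G\<^esub> ?s (- q) w)" by simp
    also have "\<dots> \<in> ?o (v \<otimes>\<^bsub>qtensor G\<^esub> ?s q w) \<boxplus>\<^bsub>rquotient G\<^esub> ?o w"
      using v w q(1) by (auto simp: rquotient_hadd_right rscale_closed)
    finally show "y \<in> x \<boxplus>\<^bsub>rquotient G\<^esub> z'"
      using q v w \<open>z = z'\<close> by simp
  qed
qed

end

section \<open>Extension of biadditive maps\<close>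

text \<open>Three groups are allowed so that the product of a ring, the action of a ring on a group,
  and the composition of homomorphisms are all instances.\<close>

locale biadditive = G: comm_group G + H: comm_group H + K: comm_group K
  for G (structure) and H (structure) and K (structure) +
  fixes f
  assumes closed: "\<lbrakk>a \<in> carrier G; b \<in> carrier H\<rbrakk> \<Longrightarrow> f a b \<in> carrier K"
    and mult_left: "\<lbrakk>a \<in> carrier G; a' \<in> carrier G; b \<in> carrier H\<rbrakk> \<Longrightarrow>
      f (a \<otimes>\<^bsub>G\<^esub> a') b = f a b \<otimes>\<^bsub>K\<^esub> f a' b"
    and mult_right: "\<lbrakk>a \<in> carrier G; b \<in> carrier H; b' \<in> carrier H\<rbrakk> \<Longrightarrow>
      f a (b \<otimes>\<^bsub>H\<^esub> b') = f a b \<otimes>\<^bsub>K\<^esub> f a b'"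
begin

lemma int_pow_left:
  assumes "a \<in> carrier G" "b \<in> carrier H"
  shows "f (a [^]\<^bsub>G\<^esub> (k::int)) b = f a b [^]\<^bsub>K\<^esub> k"
proof -
  have "(\<lambda>a. f a b) \<in> hom G K" by (rule homI) (simp_all add: assms closed mult_left)
  then show ?thesis using assms hom_int_pow G.is_group K.is_group by metis
qed

lemma int_pow_right:
  assumes "a \<in> carrier G" "b \<in> carrier H"
  shows "f a (b [^]\<^bsub>H\<^esub> (k::int)) = f a b [^]\<^bsub>K\<^esub> k"
proof -
  have "(\<lambda>b. f a b) \<in> hom H K" by (rule homI) (simp_all add: assms closed mult_right)
  then show ?thesis using assms hom_int_pow H.is_group K.is_group by metis
qed

lemma one_left: "b \<in> carrier H \<Longrightarrow> f \<one>\<^bsub>G\<^esub> b = \<one>\<^bsub>K\<^esub>"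
  using int_pow_left[of "\<one>\<^bsub>G\<^esub>" b 0] by simp

lemma one_right: "a \<in> carrier G \<Longrightarrow> f a \<one>\<^bsub>H\<^esub> = \<one>\<^bsub>K\<^esub>"
  using int_pow_right[of a "\<one>\<^bsub>H\<^esub>" 0] by simp

text \<open>The witnesses of the two given equalities multiply: n m clears both products, and by
  biadditivity the exponents k i and l j come out of \<open>f\<close>. This makes the description in
  \<open>rat_extend\<close> unique.\<close>

lemma qpure_eq:
  assumes "a \<in> carrier G" "a' \<in> carrier G" "b \<in> carrier H" "b' \<in> carrier H"
    and "qpure G a q = qpure G a' q'" "qpure H b r = qpure H b' r'"
  shows "qpure K (f a b) (q * r) = qpure K (f a' b') (q' * r')"
proof -
  obtain n k l :: int where n: "n > 0" "of_int n * q = of_int k" "of_int n * q' = of_int l"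
    "a [^]\<^bsub>G\<^esub> k = a' [^]\<^bsub>G\<^esub> l"
    using assms G.qpure_eq_iff by blast
  obtain m i j :: int where m: "m > 0" "of_int m * r = of_int i" "of_int m * r' = of_int j"
    "b [^]\<^bsub>H\<^esub> i = b' [^]\<^bsub>H\<^esub> j"
    using assms H.qpure_eq_iff by blast
  have "of_int (n * m) * (x * y) = (of_int n * x) * (of_int m * y)" for x y :: rat by simp
  then have "of_int (n * m) * (q * r) = of_int (k * i)" "of_int (n * m) * (q' * r') = of_int (l * j)"
    by (simp_all only: n m of_int_mult)
  moreover have "f a b [^]\<^bsub>K\<^esub> (k * i) = f a' b' [^]\<^bsub>K\<^esub> (l * j)"
    using n(4) m(4) assms closed
    by (metis int_pow_left int_pow_right K.int_pow_pow G.int_pow_closed)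
  ultimately show ?thesis
    using K.qpure_eq_iff[OF closed closed] assms n(1) m(1) by (meson mult_pos_pos)
qed

abbreviation ext where "ext \<equiv> rat_extend G H K f"

lemma ext_qpure:
  assumes "a \<in> carrier G" "b \<in> carrier H"
  shows "ext (qpure G a q) (qpure H b r) = qpure K (f a b) (q * r)"
  unfolding rat_extend_def rat_group_def[symmetric]
proof (rule the_equality)
  show "\<exists>a'\<in>carrier G. \<exists>b'\<in>carrier H. \<exists>q' r'. qpure G a q = qpure G a' q' \<and>
      qpure H b r = qpure H b' r' \<and> qpure K (f a b) (q * r) = qpure K (f a' b') (q' * r')"
    using assms by blast
next
  fix z
  assume "\<exists>a'\<in>carrier G. \<exists>b'\<in>carrier H. \<exists>q' r'. qpure G a q = qpure G a' q' \<and>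
      qpure H b r = qpure H b' r' \<and> z = qpure K (f a' b') (q' * r')"
  then obtain a' b' q' r' where z: "a' \<in> carrier G" "b' \<in> carrier H"
    "qpure G a q = qpure G a' q'" "qpure H b r = qpure H b' r'" "z = qpure K (f a' b') (q' * r')"
    by blast
  show "z = qpure K (f a b) (q * r)"
    unfolding z(5) by (rule qpure_eq[symmetric, OF assms(1) z(1) assms(2) z(2-4)])
qed

lemma ext_closed:
  "\<lbrakk>u \<in> carrier (qtensor G); v \<in> carrier (qtensor H)\<rbrakk> \<Longrightarrow> ext u v \<in> carrier (qtensor K)"
  by (elim G.qtensorE H.qtensorE) (simp add: ext_qpure K.qpure_closed closed)

lemma ext_mult_left:
  assumes "u \<in> carrier (qtensor G)" "u' \<in> carrier (qtensor G)" "v \<in> carrier (qtensor H)"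
  shows "ext (u \<otimes>\<^bsub>qtensor G\<^esub> u') v = ext u v \<otimes>\<^bsub>qtensor K\<^esub> ext u' v"
proof -
  obtain b r where bv: "b \<in> carrier H" "v = qpure H b r" using assms H.qtensorE by metis
  show ?thesis
    by (rule G.qtensor_common_denom[OF assms(1,2)])
      (simp add: bv ext_qpure G.qpure_mult[symmetric] K.qpure_mult[symmetric] mult_left closed)
qed

lemma ext_mult_right:
  assumes "u \<in> carrier (qtensor G)" "v \<in> carrier (qtensor H)" "v' \<in> carrier (qtensor H)"
  shows "ext u (v \<otimes>\<^bsub>qtensor H\<^esub> v') = ext u v \<otimes>\<^bsub>qtensor K\<^esub> ext u v'"
proof -
  obtain a q where au: "a \<in> carrier G" "u = qpure G a q" using assms G.qtensorE by metis
  show ?thesis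
    by (rule H.qtensor_common_denom[OF assms(2,3)])
      (simp add: au ext_qpure H.qpure_mult[symmetric] K.qpure_mult[symmetric] mult_right closed)
qed

lemma ext_rscale:
  assumes "u \<in> carrier (qtensor G)" "v \<in> carrier (qtensor H)"
  shows "ext (rscale G q u) (rscale H r v) = rscale K (q * r) (ext u v)"
proof -
  obtain a s b t where "a \<in> carrier G" "u = qpure G a s" "b \<in> carrier H" "v = qpure H b t"
    using assms by (elim G.qtensorE H.qtensorE)
  then show ?thesis
    by (simp add: ext_qpure G.rscale_qpure H.rscale_qpure K.rscale_qpure closed mult_ac)
qed

lemma ext_one_left: "v \<in> carrier (qtensor H) \<Longrightarrow> ext \<one>\<^bsub>qtensor G\<^esub> v = \<one>\<^bsub>qtensor K\<^esub>"
  using ext_qpure[OF G.one_closed] by (elim H.qtensorE) (simp add: G.qpure_one K.qpure_one one_left)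

lemma ext_one_right: "u \<in> carrier (qtensor G) \<Longrightarrow> ext u \<one>\<^bsub>qtensor H\<^esub> = \<one>\<^bsub>qtensor K\<^esub>"
  using ext_qpure[OF _ H.one_closed] by (elim G.qtensorE) (simp add: H.qpure_one K.qpure_one one_right)

text \<open>Scalars leave both arguments as a product q r, and taking r = 1 already reaches every
  nonzero rational. Thus the elementwise products of two orbits form exactly one orbit.\<close>

lemma rorbit_ext:
  assumes "u \<in> carrier (qtensor G)" "v \<in> carrier (qtensor H)"
  shows "{ext a b | a b. a \<in> rorbit G u \<and> b \<in> rorbit H v} = rorbit K (ext u v)"
proof -
  have scale: "ext (rscale G q u) (rscale H r v) = rscale K (q * r) (ext u v)" for q r
    by (rule ext_rscale[OF assms])
  show ?thesis
  proof (intro equalityI subsetI)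
    fix x assume "x \<in> {ext a b | a b. a \<in> rorbit G u \<and> b \<in> rorbit H v}"
    then obtain q r where "q \<noteq> 0" "r \<noteq> 0" "x = ext (rscale G q u) (rscale H r v)"
      by (auto simp: rorbit_def)
    then show "x \<in> rorbit K (ext u v)"
      unfolding scale K.mem_rorbit[OF ext_closed[OF assms]] by (metis no_zero_divisors)
  next
    fix x assume "x \<in> rorbit K (ext u v)"
    then obtain q where "q \<noteq> 0" "x = rscale K q (ext u v)" by (auto simp: rorbit_def)
    then have "x = ext (rscale G q u) (rscale H 1 v)" by (simp add: scale)
    moreover have "rscale G q u \<in> rorbit G u" "rscale H 1 v \<in> rorbit H v"
      using \<open>q \<noteq> 0\<close> by (auto simp: rorbit_def)
    ultimately show "x \<in> {ext a b | a b. a \<in> rorbit G u \<and> b \<in> rorbit H v}" by blast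
  qed
qed

end

context biadditive
begin

text \<open>This set formula is both the product in \<open>rquotient_hyperring\<close> and the
  action \<open>rquotient_act\<close>; a name of its own keeps it folded during rewriting.\<close>

definition ext_orbit where "ext_orbit c d = {ext a b | a b. a \<in> c \<and> b \<in> d}"

lemma ext_orbit_rorbit:
  assumes "u \<in> carrier (qtensor G)" "v \<in> carrier (qtensor H)"
  shows "ext_orbit (rorbit G u) (rorbit H v) = rorbit K (ext u v)"
  unfolding ext_orbit_def by (rule rorbit_ext[OF assms])

lemma ext_rscale_left:
  assumes "u \<in> carrier (qtensor G)" "v \<in> carrier (qtensor H)"
  shows "ext (rscale G q u) v = rscale K q (ext u v)"
  using ext_rscale[OF assms, of q 1] H.rscale_1[OF assms(2)] by simp

lemma ext_rscale_right:
  assumes "u \<in> carrier (qtensor G)" "v \<in> carrier (qtensor H)"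
  shows "ext u (rscale H q v) = rscale K q (ext u v)"
  using ext_rscale[OF assms, of 1 q] G.rscale_1[OF assms(1)] by simp

text \<open>In the one-parameter form of the sum, \<open>ext u\<close> sends v + r w to ext u v + r
  ext u w with the same r, so both sides run over the same index set and no inclusion is
  lost.\<close>

lemma ext_orbit_hadd_right:
  assumes "u \<in> carrier (qtensor G)" "v \<in> carrier (qtensor H)" "w \<in> carrier (qtensor H)"
  shows "ext_orbit (rorbit G u) ` (rorbit H v \<boxplus>\<^bsub>rquotient H\<^esub> rorbit H w) =
    ext_orbit (rorbit G u) (rorbit H v) \<boxplus>\<^bsub>rquotient K\<^esub> ext_orbit (rorbit G u) (rorbit H w)"
proof -
  interpret TH: comm_group "qtensor H" by (rule H.comm_group_qtensor)
  have "ext_orbit (rorbit G u) (rorbit H (v \<otimes>\<^bsub>qtensor H\<^esub> rscale H r w)) =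
      rorbit K (ext u v \<otimes>\<^bsub>qtensor K\<^esub> rscale K r (ext u w))" for r
    using assms
    by (simp add: ext_orbit_rorbit H.rscale_closed ext_mult_right ext_rscale_right)
  then show ?thesis
    by (simp only: H.rquotient_hadd_right[OF assms(2,3)] image_image
        ext_orbit_rorbit[OF assms(1,2)] ext_orbit_rorbit[OF assms(1,3)]
        K.rquotient_hadd_right[OF ext_closed[OF assms(1,2)] ext_closed[OF assms(1,3)]])
qed

lemma ext_orbit_hadd_left:
  assumes "u \<in> carrier (qtensor G)" "v \<in> carrier (qtensor G)" "w \<in> carrier (qtensor H)"
  shows "(\<lambda>c. ext_orbit c (rorbit H w)) ` (rorbit G u \<boxplus>\<^bsub>rquotient G\<^esub> rorbit G v) =
    ext_orbit (rorbit G u) (rorbit H w) \<boxplus>\<^bsub>rquotient K\<^esub> ext_orbit (rorbit G v) (rorbit H w)"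
proof -
  interpret TG: comm_group "qtensor G" by (rule G.comm_group_qtensor)
  have "ext_orbit (rorbit G (u \<otimes>\<^bsub>qtensor G\<^esub> rscale G r v)) (rorbit H w) =
      rorbit K (ext u w \<otimes>\<^bsub>qtensor K\<^esub> rscale K r (ext v w))" for r
    using assms
    by (simp add: ext_orbit_rorbit G.rscale_closed ext_mult_left ext_rscale_left)
  then show ?thesis
    by (simp only: G.rquotient_hadd_right[OF assms(1,2)] image_image
        ext_orbit_rorbit[OF assms(1,3)] ext_orbit_rorbit[OF assms(2,3)]
        K.rquotient_hadd_right[OF ext_closed[OF assms(1,3)] ext_closed[OF assms(2,3)]])
qed

end

section \<open>Quotient hyperrings and their modules\<close>

lemma hypergroup_cong:
  assumes "hypergroup H" "carrier H' = carrier H" "hadd H' = hadd H" "hzero H' = hzero H"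
  shows "hypergroup H'"
  using assms(1) unfolding hypergroup_def assms(2-4) .

text \<open>The module on orbits from which \<open>X_module\<close> gets its structure by transport
  along \<open>X_embed\<close>.\<close>

definition rquotient_hypermodule ::
  "('r, 'k) ring_scheme \<Rightarrow> ('a, 'm) monoid_scheme \<Rightarrow> ('r \<Rightarrow> 'a \<Rightarrow> 'a) \<Rightarrow>
    (('r \<times> rat \<Rightarrow>\<^sub>0 int) set set, ('a \<times> rat \<Rightarrow>\<^sub>0 int) set set) hypermodule"
  where "rquotient_hypermodule R G f =
    \<lparr>carrier = carrier (rquotient G), hadd = hadd (rquotient G), hzero = hzero (rquotient G),
     hact = rquotient_act R G f\<rparr>"

text \<open>The additive group is a parameter \<open>A\<close> tied to \<open>R\<close> by an
  equation, so that it stays an atomic term inside the tensor products, for the same reason as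
  \<open>rat_group\<close>.\<close>

locale scalar_action = ring R for R :: "('r, 'k) ring_scheme" (structure) +
  fixes A :: "('r, 'k) monoid_scheme" and Y :: "('a, 'm) monoid_scheme" and f
  assumes additive: "A = add_monoid R"
    and biadditive: "biadditive A Y Y f"
    and f_mult: "\<lbrakk>r \<in> carrier R; s \<in> carrier R; x \<in> carrier Y\<rbrakk> \<Longrightarrow> f (r \<otimes> s) x = f r (f s x)"
    and f_one: "x \<in> carrier Y \<Longrightarrow> f \<one> x = x"
begin

sublocale biadditive A Y Y f by (rule biadditive)

lemma carrier_additive: "carrier A = carrier R"
  by (simp add: additive)

lemma biadditive_mult: "biadditive A A A (monoid.mult R)"
  by unfold_locales (simp_all add: additive l_distr r_distr)

sublocale M: biadditive A A A "monoid.mult R" by (rule biadditive_mult)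

lemma ext_assoc:
  assumes "u \<in> carrier (qtensor A)" "v \<in> carrier (qtensor A)" "w \<in> carrier (qtensor Y)"
  shows "ext (M.ext u v) w = ext u (ext v w)"
  using assms
  by (elim G.qtensorE H.qtensorE)
    (simp add: ext_qpure M.ext_qpure closed M.closed f_mult carrier_additive mult_ac)

lemma ext_unit: "v \<in> carrier (qtensor Y) \<Longrightarrow> ext (qpure A \<one> 1) v = v"
  by (elim H.qtensorE) (simp add: ext_qpure f_one carrier_additive)

lemma unit_closed: "qpure A \<one> 1 \<in> carrier (qtensor A)"
  by (simp add: G.qpure_closed carrier_additive)

lemma rquotient_hyperring_simps:
  "carrier (rquotient_hyperring R) = rorbit A ` carrier (qtensor A)"
  "hadd (rquotient_hyperring R) = hadd (rquotient A)"
  "hzero (rquotient_hyperring R) = rorbit A \<one>\<^bsub>qtensor A\<^esub>"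
  "hmult (rquotient_hyperring R) = M.ext_orbit"
  "hone (rquotient_hyperring R) = rorbit A (qpure A \<one> 1)"
  unfolding rquotient_hyperring_def additive[symmetric] rat_ring_tensor_def rat_group_def[symmetric]
  by (simp_all add: Let_def G.rquotient_simps M.ext_orbit_def fun_eq_iff)

lemma rquotient_hypermodule_simps:
  "carrier (rquotient_hypermodule R Y f) = rorbit Y ` carrier (qtensor Y)"
  "hadd (rquotient_hypermodule R Y f) = hadd (rquotient Y)"
  "hzero (rquotient_hypermodule R Y f) = rorbit Y \<one>\<^bsub>qtensor Y\<^esub>"
  "hact (rquotient_hypermodule R Y f) = ext_orbit"
  by (simp_all add: rquotient_hypermodule_def H.rquotient_simps rquotient_act_def
      ext_orbit_def fun_eq_iff flip: additive)

text \<open>The assumption excludes a unit that is torsion: there 1 (x) 1 vanishes and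
  \<open>hone\<close> would equal \<open>hzero\<close>. The remaining laws descend from the ring
  through \<open>M.ext\<close>.\<close>

lemma hyperring_rquotient:
  assumes "qpure A \<one> 1 \<noteq> \<one>\<^bsub>qtensor A\<^esub>"
  shows "hyperring (rquotient_hyperring R)"
proof -
  \<comment> \<open>The ring acts on itself by multiplication, so associativity and the left unit of
    the product are instances of the laws of an action.\<close>
  interpret mult: scalar_action R A A "monoid.mult R"
    by unfold_locales (simp_all add: additive biadditive_mult[unfolded additive] m_assoc)
  have mult_one: "M.ext u (qpure A \<one> 1) = u" if "u \<in> carrier (qtensor A)" for u
    using that by (elim G.qtensorE) (simp add: M.ext_qpure carrier_additive)
  interpret VA: comm_group "qtensor A" by (rule G.comm_group_qtensor)
  interpret hypergroup "rquotient_hyperring R"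
    by (rule hypergroup_cong[OF G.hypergroup_rquotient])
      (simp_all add: rquotient_hyperring_simps G.rquotient_simps)
  show ?thesis
  proof unfold_locales
    show "hone (rquotient_hyperring R) \<noteq> hzero (rquotient_hyperring R)"
      using assms G.rorbit_self[OF unit_closed]
      by (metis rquotient_hyperring_simps(3,5) G.rorbit_one singletonD)
  qed (simp only: rquotient_hyperring_simps; (elim imageE)?;
      simp add: M.ext_orbit_rorbit M.ext_closed mult.ext_assoc
        mult.ext_unit mult_one unit_closed M.ext_one_left M.ext_one_right
        M.ext_orbit_hadd_left M.ext_orbit_hadd_right)+
qed

lemma hypermodule_rquotient:
  assumes "qpure A \<one> 1 \<noteq> \<one>\<^bsub>qtensor A\<^esub>"
  shows "hypermodule (rquotient_hyperring R) (rquotient_hypermodule R Y f)"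
proof -
  interpret hyperring "rquotient_hyperring R" by (rule hyperring_rquotient[OF assms])
  interpret VA: comm_group "qtensor A" by (rule G.comm_group_qtensor)
  interpret VY: comm_group "qtensor Y" by (rule H.comm_group_qtensor)
  interpret Q: hypergroup "rquotient_hypermodule R Y f"
    by (rule hypergroup_cong[OF H.hypergroup_rquotient])
      (simp_all add: rquotient_hypermodule_simps H.rquotient_simps)
  show ?thesis
    by unfold_locales (simp only: rquotient_hyperring_simps rquotient_hypermodule_simps;
      (elim imageE)?;
      simp add: ext_orbit_rorbit M.ext_orbit_rorbit ext_closed M.ext_closed ext_assoc ext_unit
        unit_closed ext_one_left ext_one_right ext_orbit_hadd_left ext_orbit_hadd_right)+
qed

text \<open>The additive bijection r -> f r g respects integer powers, and these alone decide
  equality of pure tensors; it therefore stays bijective after tensoring with Q and, being Q-linear,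
  on orbits.\<close>

lemma hact_unit_bij_betw:
  assumes "g \<in> carrier Y" "bij_betw (\<lambda>r. f r g) (carrier R) (carrier Y)"
  shows "bij_betw (\<lambda>c. hact (rquotient_hypermodule R Y f) c (rorbit Y (qpure Y g 1)))
    (carrier (rquotient_hyperring R)) (carrier (rquotient_hypermodule R Y f))"
proof -
  let ?g = "qpure Y g 1"
  have g: "?g \<in> carrier (qtensor Y)" by (rule H.qpure_closed[OF assms(1)])
  have f_closed: "f a g \<in> carrier Y" if "a \<in> carrier A" for a
    by (rule closed[OF that assms(1)])
  have f_int_pow: "f a g [^]\<^bsub>Y\<^esub> k = f (a [^]\<^bsub>A\<^esub> k) g" if "a \<in> carrier A" for a and k :: int
    by (rule int_pow_left[symmetric, OF that assms(1)])
  have inj: "u = v" if uv: "u \<in> carrier (qtensor A)" "v \<in> carrier (qtensor A)"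
    and eq: "ext u ?g = ext v ?g" for u v
  proof -
    obtain n a b where ab: "n > (0::int)" "a \<in> carrier A" "b \<in> carrier A"
      "u = qpure A a (1 / of_int n)" "v = qpure A b (1 / of_int n)"
      using G.qtensor_common_denom[OF uv] by metis
    have "qpure Y (f a g) (1 / of_int n) = qpure Y (f b g) (1 / of_int n)"
      using eq ab assms(1) by (simp add: ext_qpure)
    then obtain m k l where m: "of_int m * (1 / of_int n :: rat) = of_int k"
      "of_int m * (1 / of_int n :: rat) = of_int l" "m > 0" "f a g [^]\<^bsub>Y\<^esub> k = f b g [^]\<^bsub>Y\<^esub> l"
      using H.qpure_eq_iff[OF f_closed[OF ab(2)] f_closed[OF ab(3)]] by metis
    then have "f (a [^]\<^bsub>A\<^esub> k) g = f (b [^]\<^bsub>A\<^esub> l) g"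
      using ab f_int_pow by metis
    moreover have "a [^]\<^bsub>A\<^esub> k \<in> carrier R" "b [^]\<^bsub>A\<^esub> l \<in> carrier R"
      using G.int_pow_closed ab(2,3) carrier_additive by blast+
    ultimately have "a [^]\<^bsub>A\<^esub> k = b [^]\<^bsub>A\<^esub> l"
      using assms(2) by (metis bij_betw_imp_inj_on inj_onD)
    then show ?thesis
      unfolding ab(4,5) using G.qpure_eq_iff[OF ab(2,3)] m(1-3) by blast
  qed
  have surj: "\<exists>u \<in> carrier (qtensor A). ext u ?g = v" if v: "v \<in> carrier (qtensor Y)" for v
  proof -
    obtain x q where x: "x \<in> carrier Y" "v = qpure Y x q"
      using H.qtensorE[OF v] by metis
    obtain a where "a \<in> carrier A" "x = f a g"
      using assms(2) x(1) carrier_additive by (auto simp: bij_betw_def)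
    then have "ext (qpure A a q) ?g = v" "qpure A a q \<in> carrier (qtensor A)"
      using x assms(1) by (simp_all add: ext_qpure G.qpure_closed)
    then show ?thesis by blast
  qed
  show ?thesis
    unfolding bij_betw_def rquotient_hyperring_simps rquotient_hypermodule_simps
  proof
    show "inj_on (\<lambda>c. ext_orbit c (rorbit Y ?g)) (rorbit A ` carrier (qtensor A))"
    proof (rule inj_onI)
      fix c d assume "c \<in> rorbit A ` carrier (qtensor A)" "d \<in> rorbit A ` carrier (qtensor A)"
        and eq: "ext_orbit c (rorbit Y ?g) = ext_orbit d (rorbit Y ?g)"
      then obtain u v where u: "c = rorbit A u" "u \<in> carrier (qtensor A)"
        and v: "d = rorbit A v" "v \<in> carrier (qtensor A)" by auto
      have "rorbit Y (ext u ?g) = rorbit Y (ext v ?g)"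
        using eq u v g by (simp add: ext_orbit_rorbit)
      \<comment> \<open>Equal orbits mean equal vectors up to a scalar; linearity moves that scalar
        onto \<open>v\<close>, where \<open>inj\<close> applies.\<close>
      then obtain q where "q \<noteq> 0" "ext u ?g = rscale Y q (ext v ?g)"
        using H.rorbit_eq_iff[OF ext_closed[OF u(2) g] ext_closed[OF v(2) g]] by blast
      then have "u = rscale A q v"
        using inj[OF u(2) G.rscale_closed[OF v(2)]] ext_rscale_left[OF v(2) g] by simp
      then show "c = d"
        using u v G.rorbit_rscale[OF v(2) \<open>q \<noteq> 0\<close>] by simp
    qed
    show "(\<lambda>c. ext_orbit c (rorbit Y ?g)) ` rorbit A ` carrier (qtensor A) =
        rorbit Y ` carrier (qtensor Y)"
    proof -
      have "(\<lambda>c. ext_orbit c (rorbit Y ?g)) ` rorbit A ` carrier (qtensor A) =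
          rorbit Y ` (\<lambda>u. ext u ?g) ` carrier (qtensor A)"
        using g by (simp add: image_image ext_orbit_rorbit cong: image_cong)
      also have "(\<lambda>u. ext u ?g) ` carrier (qtensor A) = carrier (qtensor Y)"
      proof (intro equalityI subsetI)
        fix v assume "v \<in> carrier (qtensor Y)"
        from surj[OF this] show "v \<in> (\<lambda>u. ext u ?g) ` carrier (qtensor A)" by auto
      qed (use ext_closed g in auto)
      finally show ?thesis .
    qed
  qed
qed

end

text \<open>The operations of \<open>N\<close> are pullbacks along \<open>\<phi>\<close>, so each
  axiom is checked after applying \<open>\<phi>\<close>. The second conclusion is what makes the
  transported action, given through \<open>inv_into\<close>, computable.\<close>

lemma hypermodule_transport:
  fixes R :: "('r, 'k) hyperring_scheme" and M :: "('r, 'a, 'm) hypermodule_scheme"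
    and N :: "('r, 'b, 'n) hypermodule_scheme"
  assumes "hypermodule R M" and bij: "bij_betw \<phi> (carrier N) (carrier M)"
    and hadd: "\<And>c d. \<lbrakk>c \<in> carrier N; d \<in> carrier N\<rbrakk> \<Longrightarrow>
      c \<boxplus>\<^bsub>N\<^esub> d = {e \<in> carrier N. \<phi> e \<in> \<phi> c \<boxplus>\<^bsub>M\<^esub> \<phi> d}"
    and zero: "hzero N \<in> carrier N" "\<phi> (hzero N) = hzero M"
    and act: "\<And>r c. \<lbrakk>r \<in> carrier R; c \<in> carrier N\<rbrakk> \<Longrightarrow>
      hact N r c = inv_into (carrier N) \<phi> (hact M r (\<phi> c))"
  shows "hypermodule R N"
    and "\<lbrakk>r \<in> carrier R; c \<in> carrier N\<rbrakk> \<Longrightarrow> hact N r c \<in> carrier N \<and> \<phi> (hact N r c) = hact M r (\<phi> c)"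
proof -
  interpret M: hypermodule R M by fact
  have \<phi>_mem: "\<phi> c \<in> carrier M" if "c \<in> carrier N" for c
    using bij that bij_betwE by blast
  have \<phi>_eq: "\<phi> c = \<phi> d \<longleftrightarrow> c = d" if "c \<in> carrier N" "d \<in> carrier N" for c d
    using bij that by (auto simp: bij_betw_def inj_on_eq_iff)
  have \<phi>_surj: "\<exists>c \<in> carrier N. \<phi> c = x" if "x \<in> carrier M" for x
    using bij that by (metis bij_betw_def imageE)
  \<comment> \<open>Most axioms are equalities of subsets of \<open>carrier N\<close>, and an
    injective map reflects these.\<close>
  have sub_eq: "S = T" if "S \<subseteq> carrier N" "T \<subseteq> carrier N" "\<phi> ` S = \<phi> ` T" for S T
    using bij that by (metis bij_betw_def inj_on_image_eq_iff)
  have hadd_sub: "c \<boxplus>\<^bsub>N\<^esub> d \<subseteq> carrier N" if "c \<in> carrier N" "d \<in> carrier N" for c d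
    using hadd[OF that] by simp
  \<comment> \<open>By definition a sum in \<open>N\<close> is a preimage; that its image is the
    whole sum in \<open>M\<close> uses surjectivity of \<open>\<phi>\<close> and closure of sums in
    \<open>M\<close>.\<close>
  have image_hadd: "\<phi> ` (c \<boxplus>\<^bsub>N\<^esub> d) = \<phi> c \<boxplus>\<^bsub>M\<^esub> \<phi> d" if "c \<in> carrier N" "d \<in> carrier N" for c d
  proof
    show "\<phi> ` (c \<boxplus>\<^bsub>N\<^esub> d) \<subseteq> \<phi> c \<boxplus>\<^bsub>M\<^esub> \<phi> d" by (auto simp: hadd[OF that])
    show "\<phi> c \<boxplus>\<^bsub>M\<^esub> \<phi> d \<subseteq> \<phi> ` (c \<boxplus>\<^bsub>N\<^esub> d)"
    proof
      fix x assume x: "x \<in> \<phi> c \<boxplus>\<^bsub>M\<^esub> \<phi> d"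
      then have "x \<in> carrier M" using M.M.hadd_closed[OF \<phi>_mem[OF that(1)] \<phi>_mem[OF that(2)]] by auto
      then obtain e where "e \<in> carrier N" "\<phi> e = x" using \<phi>_surj by auto
      with x show "x \<in> \<phi> ` (c \<boxplus>\<^bsub>N\<^esub> d)" by (auto simp: hadd[OF that])
    qed
  qed
  show A: "hact N r c \<in> carrier N \<and> \<phi> (hact N r c) = hact M r (\<phi> c)"
    if "r \<in> carrier R" "c \<in> carrier N" for r c
  proof -
    have "hact M r (\<phi> c) \<in> \<phi> ` carrier N"
      using M.hact_closed[OF that(1) \<phi>_mem[OF that(2)]] bij by (simp add: bij_betw_def)
    then show ?thesis
      unfolding act[OF that] using inv_into_into f_inv_into_f by metis
  qed
  have A_closed: "hact N r c \<in> carrier N" and A_image: "\<phi> (hact N r c) = hact M r (\<phi> c)"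
    if "r \<in> carrier R" "c \<in> carrier N" for r c
    using A[OF that] by blast+
  have mem_hadd: "e \<in> c \<boxplus>\<^bsub>N\<^esub> d \<longleftrightarrow> \<phi> e \<in> \<phi> c \<boxplus>\<^bsub>M\<^esub> \<phi> d"
    if "c \<in> carrier N" "d \<in> carrier N" "e \<in> carrier N" for c d e
    using that by (simp add: hadd)
  interpret N: hypergroup N
  proof
    fix x y assume xy: "x \<in> carrier N" "y \<in> carrier N"
    show "x \<boxplus>\<^bsub>N\<^esub> y \<subseteq> carrier N" by (rule hadd_sub[OF xy])
    show "x \<boxplus>\<^bsub>N\<^esub> y \<noteq> {}"
      using image_hadd[OF xy] M.M.hadd_nonempty[OF \<phi>_mem[OF xy(1)] \<phi>_mem[OF xy(2)]] by auto
    show "x \<boxplus>\<^bsub>N\<^esub> y = y \<boxplus>\<^bsub>N\<^esub> x"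
      unfolding hadd[OF xy] hadd[OF xy(2,1)]
      using M.M.hadd_comm[OF \<phi>_mem[OF xy(1)] \<phi>_mem[OF xy(2)]] by simp
    fix z assume z: "z \<in> carrier N"
    show "(\<Union>u \<in> x \<boxplus>\<^bsub>N\<^esub> y. u \<boxplus>\<^bsub>N\<^esub> z) = (\<Union>w \<in> y \<boxplus>\<^bsub>N\<^esub> z. x \<boxplus>\<^bsub>N\<^esub> w)"
    proof (rule sub_eq)
      have "\<phi> ` (\<Union>u \<in> x \<boxplus>\<^bsub>N\<^esub> y. u \<boxplus>\<^bsub>N\<^esub> z) = (\<Union>u \<in> x \<boxplus>\<^bsub>N\<^esub> y. \<phi> u \<boxplus>\<^bsub>M\<^esub> \<phi> z)"
        unfolding image_UN using hadd_sub[OF xy] z by (intro SUP_cong refl image_hadd) auto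
      also have "\<dots> = (\<Union>u \<in> \<phi> x \<boxplus>\<^bsub>M\<^esub> \<phi> y. u \<boxplus>\<^bsub>M\<^esub> \<phi> z)"
        by (simp only: image_hadd[OF xy, symmetric] image_image)
      also have "\<dots> = (\<Union>w \<in> \<phi> y \<boxplus>\<^bsub>M\<^esub> \<phi> z. \<phi> x \<boxplus>\<^bsub>M\<^esub> w)"
        by (rule M.M.hadd_assoc) (use xy z \<phi>_mem in auto)
      also have "\<dots> = (\<Union>w \<in> y \<boxplus>\<^bsub>N\<^esub> z. \<phi> x \<boxplus>\<^bsub>M\<^esub> \<phi> w)"
        by (simp only: image_hadd[OF xy(2) z, symmetric] image_image)
      also have "\<dots> = \<phi> ` (\<Union>w \<in> y \<boxplus>\<^bsub>N\<^esub> z. x \<boxplus>\<^bsub>N\<^esub> w)"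
        unfolding image_UN using hadd_sub[OF xy(2) z] xy by (intro SUP_cong refl image_hadd[symmetric]) auto
      finally show "\<phi> ` (\<Union>u \<in> x \<boxplus>\<^bsub>N\<^esub> y. u \<boxplus>\<^bsub>N\<^esub> z) = \<phi> ` (\<Union>w \<in> y \<boxplus>\<^bsub>N\<^esub> z. x \<boxplus>\<^bsub>N\<^esub> w)" .
    qed (use hadd_sub xy z in blast)+
    fix z' assume z': "z' \<in> carrier N" and mem: "x \<in> y \<boxplus>\<^bsub>N\<^esub> z" "hzero N \<in> z \<boxplus>\<^bsub>N\<^esub> z'"
    have "\<phi> y \<in> \<phi> x \<boxplus>\<^bsub>M\<^esub> \<phi> z'"
      using mem xy z z' zero M.M.hadd_reversible[OF \<phi>_mem[OF xy(1)] \<phi>_mem[OF xy(2)] \<phi>_mem[OF z] \<phi>_mem[OF z']]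
      by (simp add: mem_hadd)
    then show "y \<in> x \<boxplus>\<^bsub>N\<^esub> z'" using xy z' by (simp add: mem_hadd)
  next
    show "hzero N \<in> carrier N" by (rule zero(1))
  next
    fix x assume x: "x \<in> carrier N"
    have "\<phi> x \<boxplus>\<^bsub>M\<^esub> \<phi> (hzero N) = {\<phi> x}" using M.M.hadd_zero[OF \<phi>_mem[OF x]] zero by simp
    then show "x \<boxplus>\<^bsub>N\<^esub> hzero N = {x}" using x \<phi>_eq by (auto simp: hadd[OF x zero(1)])
    obtain y where y: "y \<in> carrier M" "hzero M \<in> \<phi> x \<boxplus>\<^bsub>M\<^esub> y"
      and uniq: "\<And>y'. y' \<in> carrier M \<Longrightarrow> hzero M \<in> \<phi> x \<boxplus>\<^bsub>M\<^esub> y' \<Longrightarrow> y' = y"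
      using M.M.hneg_ex1[OF \<phi>_mem[OF x]] by blast
    obtain e where e: "e \<in> carrier N" "\<phi> e = y" using \<phi>_surj[OF y(1)] by blast
    show "\<exists>!y. y \<in> carrier N \<and> hzero N \<in> x \<boxplus>\<^bsub>N\<^esub> y"
    proof (rule ex1I[of _ e])
      show "e \<in> carrier N \<and> hzero N \<in> x \<boxplus>\<^bsub>N\<^esub> e" using e y x zero by (simp add: mem_hadd)
      fix e' assume "e' \<in> carrier N \<and> hzero N \<in> x \<boxplus>\<^bsub>N\<^esub> e'"
      then have e': "e' \<in> carrier N" and "hzero N \<in> x \<boxplus>\<^bsub>N\<^esub> e'" by auto
      then have "hzero M \<in> \<phi> x \<boxplus>\<^bsub>M\<^esub> \<phi> e'" using x zero mem_hadd by metis
      then have "\<phi> e' = \<phi> e" using uniq[OF \<phi>_mem[OF e']] e by simp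
      then show "e' = e" using \<phi>_eq[OF e' e(1)] by simp
    qed
  qed
  show "hypermodule R N"
  proof
    fix r x assume r: "r \<in> carrier R" and x: "x \<in> carrier N"
    show "hact N r x \<in> carrier N" by (rule A_closed[OF r x])
    fix y assume y: "y \<in> carrier N"
    show "hact N r ` (x \<boxplus>\<^bsub>N\<^esub> y) = hact N r x \<boxplus>\<^bsub>N\<^esub> hact N r y"
    proof (rule sub_eq)
      have "\<phi> ` hact N r ` (x \<boxplus>\<^bsub>N\<^esub> y) = hact M r ` \<phi> ` (x \<boxplus>\<^bsub>N\<^esub> y)"
        unfolding image_image using hadd_sub[OF x y] r by (intro image_cong refl A_image) auto
      then show "\<phi> ` hact N r ` (x \<boxplus>\<^bsub>N\<^esub> y) = \<phi> ` (hact N r x \<boxplus>\<^bsub>N\<^esub> hact N r y)"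
        using M.hact_distrib_left[OF r \<phi>_mem[OF x] \<phi>_mem[OF y]]
        by (simp only: image_hadd[OF x y] image_hadd[OF A_closed[OF r x] A_closed[OF r y]]
            A_image[OF r x] A_image[OF r y])
    qed (use hadd_sub[OF x y] hadd_sub[OF A_closed[OF r x] A_closed[OF r y]] A_closed[OF r] in auto)
  next
    fix r s x assume r: "r \<in> carrier R" "s \<in> carrier R" and x: "x \<in> carrier N"
    have "\<phi> (hact N (r \<boxdot>\<^bsub>R\<^esub> s) x) = \<phi> (hact N r (hact N s x))"
      by (simp only: A_image[OF M.hmult_closed[OF r] x] A_image[OF r(1) A_closed[OF r(2) x]]
          A_image[OF r(2) x] M.hact_assoc[OF r \<phi>_mem[OF x]])
    then show "hact N (r \<boxdot>\<^bsub>R\<^esub> s) x = hact N r (hact N s x)"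
      using \<phi>_eq A_closed M.hmult_closed r x by blast
    show "(\<lambda>t. hact N t x) ` (r \<boxplus>\<^bsub>R\<^esub> s) = hact N r x \<boxplus>\<^bsub>N\<^esub> hact N s x"
    proof (rule sub_eq)
      have sub: "r \<boxplus>\<^bsub>R\<^esub> s \<subseteq> carrier R" by (rule M.R.hadd_closed[OF r])
      have "\<phi> ` (\<lambda>t. hact N t x) ` (r \<boxplus>\<^bsub>R\<^esub> s) = (\<lambda>t. hact M t (\<phi> x)) ` (r \<boxplus>\<^bsub>R\<^esub> s)"
        unfolding image_image using sub x by (intro image_cong refl A_image) auto
      then show "\<phi> ` (\<lambda>t. hact N t x) ` (r \<boxplus>\<^bsub>R\<^esub> s) = \<phi> ` (hact N r x \<boxplus>\<^bsub>N\<^esub> hact N s x)"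
        by (simp only: M.hact_distrib_right[OF r \<phi>_mem[OF x]]
            image_hadd[OF A_closed[OF r(1) x] A_closed[OF r(2) x]] A_image[OF r(1) x] A_image[OF r(2) x])
      show "(\<lambda>t. hact N t x) ` (r \<boxplus>\<^bsub>R\<^esub> s) \<subseteq> carrier N"
        using sub A_closed x by auto
      show "hact N r x \<boxplus>\<^bsub>N\<^esub> hact N s x \<subseteq> carrier N"
        by (rule hadd_sub[OF A_closed[OF r(1) x] A_closed[OF r(2) x]])
    qed
  next
    fix x assume x: "x \<in> carrier N"
    have "\<phi> (hact N (hone R) x) = \<phi> x"
      using A_image[OF M.hone_closed x] M.hact_one[OF \<phi>_mem[OF x]] by simp
    then show "hact N (hone R) x = x" using \<phi>_eq[OF A_closed[OF M.hone_closed x] x] by simp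
    have "\<phi> (hact N (hzero R) x) = \<phi> (hzero N)"
      using A_image[OF M.R.hzero_closed x] M.hact_zero_left[OF \<phi>_mem[OF x]] zero by simp
    then show "hact N (hzero R) x = hzero N"
      using \<phi>_eq[OF A_closed[OF M.R.hzero_closed x] zero(1)] by simp
  next
    fix r assume r: "r \<in> carrier R"
    have "\<phi> (hact N r (hzero N)) = \<phi> (hzero N)"
      using A_image[OF r zero(1)] M.hact_zero_right[OF r] zero by simp
    then show "hact N r (hzero N) = hzero N"
      using \<phi>_eq[OF A_closed[OF r zero(1)] zero(1)] by simp
  qed
qed

text \<open>Bijectivity is the only condition left: additivity in the scalar is
  \<open>hact_distrib_right\<close> at \<open>g\<close>, and compatibility with the action is
  \<open>hact_assoc\<close>.\<close>

lemma free_of_rank_oneI: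
  assumes "hypermodule R M" "g \<in> carrier M"
    and bij: "bij_betw (\<lambda>r. hact M r g) (carrier R) (carrier M)"
  shows "free_of_rank_one R M"
proof -
  interpret hypermodule R M by fact
  have "(\<lambda>r. hact M r g) \<in> hypermodule_iso R (regular_hypermodule R) M"
    unfolding hypermodule_iso_def regular_hypermodule_def
    using bij hact_zero_left hact_distrib_right hact_assoc assms(2) by simp
  then show ?thesis
    using assms unfolding free_of_rank_one_def by blast
qed

section \<open>Groups of homomorphisms\<close>

text \<open>For G = QZ this is the additive group of \<open>zhat\<close> when H = QZ, and
  \<open>E_group A\<close> when \<open>H\<close> is \<open>units_of A\<close>. Extensionality makes
  functions equal as soon as they agree on the carrier.\<close>

definition hom_group :: "('a, 'm) monoid_scheme \<Rightarrow> ('b, 'n) monoid_scheme \<Rightarrow> ('a \<Rightarrow> 'b) monoid"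
  where "hom_group G H =
    \<lparr>carrier = hom G H \<inter> extensional (carrier G),
     monoid.mult = (\<lambda>\<xi> \<eta>. \<lambda>\<gamma> \<in> carrier G. \<xi> \<gamma> \<otimes>\<^bsub>H\<^esub> \<eta> \<gamma>),
     one = (\<lambda>\<gamma> \<in> carrier G. \<one>\<^bsub>H\<^esub>)\<rparr>"

lemma hom_group_simps:
  "\<xi> \<in> carrier (hom_group G H) \<longleftrightarrow> \<xi> \<in> hom G H \<and> \<xi> \<in> extensional (carrier G)"
  "\<xi> \<otimes>\<^bsub>hom_group G H\<^esub> \<eta> = (\<lambda>\<gamma> \<in> carrier G. \<xi> \<gamma> \<otimes>\<^bsub>H\<^esub> \<eta> \<gamma>)"
  "\<one>\<^bsub>hom_group G H\<^esub> = (\<lambda>\<gamma> \<in> carrier G. \<one>\<^bsub>H\<^esub>)"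
  by (simp_all add: hom_group_def)

lemma hom_group_eqI:
  assumes "\<xi> \<in> carrier (hom_group G H)" "\<eta> \<in> carrier (hom_group G H)"
    and "\<And>\<gamma>. \<gamma> \<in> carrier G \<Longrightarrow> \<xi> \<gamma> = \<eta> \<gamma>"
  shows "\<xi> = \<eta>"
  using assms by (auto simp: hom_group_simps intro: extensionalityI)

lemma hom_group_closed:
  "\<lbrakk>\<xi> \<in> carrier (hom_group G H); \<gamma> \<in> carrier G\<rbrakk> \<Longrightarrow> \<xi> \<gamma> \<in> carrier H"
  by (auto simp: hom_group_simps hom_def)

lemma hom_group_mult:
  "\<lbrakk>\<xi> \<in> carrier (hom_group G H); \<gamma> \<in> carrier G; \<delta> \<in> carrier G\<rbrakk> \<Longrightarrow> \<xi> (\<gamma> \<otimes>\<^bsub>G\<^esub> \<delta>) = \<xi> \<gamma> \<otimes>\<^bsub>H\<^esub> \<xi> \<delta>"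
  by (auto simp: hom_group_simps hom_def)

lemma hom_groupI:
  assumes "\<And>\<gamma>. \<gamma> \<in> carrier G \<Longrightarrow> \<xi> \<gamma> \<in> carrier H"
    and "\<And>\<gamma> \<delta>. \<lbrakk>\<gamma> \<in> carrier G; \<delta> \<in> carrier G\<rbrakk> \<Longrightarrow> \<xi> (\<gamma> \<otimes>\<^bsub>G\<^esub> \<delta>) = \<xi> \<gamma> \<otimes>\<^bsub>H\<^esub> \<xi> \<delta>"
    and "\<xi> \<in> extensional (carrier G)"
  shows "\<xi> \<in> carrier (hom_group G H)"
  using assms by (auto simp: hom_group_simps hom_def)

lemma comm_group_hom_group:
  assumes "group G" "comm_group H"
  shows "comm_group (hom_group G H)"
proof -
  interpret G: group G by fact
  interpret H: comm_group H by fact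
  show ?thesis
  proof (rule comm_groupI)
    fix x y assume xy: "x \<in> carrier (hom_group G H)" "y \<in> carrier (hom_group G H)"
    show "x \<otimes>\<^bsub>hom_group G H\<^esub> y \<in> carrier (hom_group G H)"
      using xy by (intro hom_groupI)
        (simp_all add: hom_group_simps(2) hom_group_closed hom_group_mult H.m_ac)
    show "x \<otimes>\<^bsub>hom_group G H\<^esub> y = y \<otimes>\<^bsub>hom_group G H\<^esub> x"
      unfolding hom_group_simps(2)
      by (rule restrict_ext) (simp add: hom_group_closed[OF xy(1)] hom_group_closed[OF xy(2)] H.m_comm)
    fix z assume z: "z \<in> carrier (hom_group G H)"
    show "x \<otimes>\<^bsub>hom_group G H\<^esub> y \<otimes>\<^bsub>hom_group G H\<^esub> z = x \<otimes>\<^bsub>hom_group G H\<^esub> (y \<otimes>\<^bsub>hom_group G H\<^esub> z)"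
      unfolding hom_group_simps(2)
      by (rule restrict_ext) (simp add: hom_group_closed[OF xy(1)] hom_group_closed[OF xy(2)]
          hom_group_closed[OF z] H.m_assoc)
  next
    show "\<one>\<^bsub>hom_group G H\<^esub> \<in> carrier (hom_group G H)"
      by (rule hom_groupI) (simp_all add: hom_group_simps(3))
  next
    fix x assume x: "x \<in> carrier (hom_group G H)"
    have "\<one>\<^bsub>hom_group G H\<^esub> \<otimes>\<^bsub>hom_group G H\<^esub> x = (\<lambda>\<gamma> \<in> carrier G. x \<gamma>)"
      unfolding hom_group_simps(2,3)
      by (rule restrict_ext) (simp add: hom_group_closed[OF x])
    then show "\<one>\<^bsub>hom_group G H\<^esub> \<otimes>\<^bsub>hom_group G H\<^esub> x = x"
      using x by (simp add: hom_group_simps(1) extensional_restrict)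
    let ?y = "\<lambda>\<gamma> \<in> carrier G. inv\<^bsub>H\<^esub> x \<gamma>"
    have "?y \<in> carrier (hom_group G H)"
      using x by (intro hom_groupI) (simp_all add: hom_group_closed hom_group_mult H.inv_mult)
    moreover have "?y \<otimes>\<^bsub>hom_group G H\<^esub> x = \<one>\<^bsub>hom_group G H\<^esub>"
      unfolding hom_group_simps(2,3)
      by (rule restrict_ext) (simp add: hom_group_closed[OF x])
    ultimately show "\<exists>y \<in> carrier (hom_group G H). y \<otimes>\<^bsub>hom_group G H\<^esub> x = \<one>\<^bsub>hom_group G H\<^esub>"
      by blast
  qed
qed

lemma eval_hom_group:
  assumes "\<gamma> \<in> carrier G"
  shows "(\<lambda>\<xi>. \<xi> \<gamma>) \<in> hom (hom_group G H) H"
  by (rule homI) (simp_all add: hom_group_closed hom_group_simps(2) assms)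

lemma hom_group_int_pow:
  assumes "group G" "comm_group H" "\<xi> \<in> carrier (hom_group G H)" "\<gamma> \<in> carrier G"
  shows "(\<xi> [^]\<^bsub>hom_group G H\<^esub> (k::int)) \<gamma> = \<xi> \<gamma> [^]\<^bsub>H\<^esub> k"
  using hom_int_pow[OF eval_hom_group[OF assms(4)] assms(3)]
    comm_group.axioms(2)[OF comm_group_hom_group[OF assms(1,2)]] comm_group.axioms(2)[OF assms(2)]
  by simp

lemma hom_group_int_pow_arg:
  assumes "group G" "comm_group H" "\<xi> \<in> carrier (hom_group G H)" "\<gamma> \<in> carrier G"
  shows "\<xi> (\<gamma> [^]\<^bsub>G\<^esub> (k::int)) = \<xi> \<gamma> [^]\<^bsub>H\<^esub> k"
  using assms comm_group.axioms(2)[OF assms(2)] hom_int_pow[of \<xi> G H \<gamma> k]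
  by (simp add: hom_group_simps(1))

text \<open>Write \<gamma> as the n-th power of \<delta>. Then the value at \<gamma> is the n-th
  power of the value at \<delta>, which is the value at \<delta> of the trivial n-th power.\<close>

lemma torsion_free_hom_group:
  assumes "group G" "comm_group H"
    and divisible: "\<And>\<gamma> n :: nat. \<lbrakk>\<gamma> \<in> carrier G; n > 0\<rbrakk> \<Longrightarrow> \<exists>\<delta> \<in> carrier G. \<delta> [^]\<^bsub>G\<^esub> n = \<gamma>"
  shows "torsion_free (hom_group G H)"
  unfolding torsion_free_def
proof safe
  fix \<xi> and n :: nat
  assume \<xi>: "\<xi> \<in> carrier (hom_group G H)" and n: "n > 0"
    and pow: "\<xi> [^]\<^bsub>hom_group G H\<^esub> n = \<one>\<^bsub>hom_group G H\<^esub>"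
  interpret E: comm_group "hom_group G H" by (rule comm_group_hom_group[OF assms(1,2)])
  show "\<xi> = \<one>\<^bsub>hom_group G H\<^esub>"
  proof (rule hom_group_eqI[OF \<xi> E.one_closed])
    fix \<gamma> assume \<gamma>: "\<gamma> \<in> carrier G"
    then obtain \<delta> where \<delta>: "\<delta> \<in> carrier G" "\<gamma> = \<delta> [^]\<^bsub>G\<^esub> int n"
      using divisible[OF \<gamma> n] by (metis int_pow_int)
    have "\<xi> \<gamma> = (\<xi> [^]\<^bsub>hom_group G H\<^esub> int n) \<delta>"
      unfolding \<delta>(2) hom_group_int_pow_arg[OF assms(1,2) \<xi> \<delta>(1)]
        hom_group_int_pow[OF assms(1,2) \<xi> \<delta>(1)] ..
    also have "\<dots> = \<one>\<^bsub>hom_group G H\<^esub> \<gamma>"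
      using pow \<gamma> \<delta>(1) by (simp add: int_pow_int hom_group_simps(3))
    finally show "\<xi> \<gamma> = \<one>\<^bsub>hom_group G H\<^esub> \<gamma>" .
  qed
qed

lemma compose_hom_group:
  assumes "group G" "\<xi> \<in> carrier (hom_group H K)" "\<alpha> \<in> carrier (hom_group G H)"
  shows "compose (carrier G) \<xi> \<alpha> \<in> carrier (hom_group G K)"
proof -
  interpret group G by fact
  show ?thesis
    using assms(2,3)
    by (intro hom_groupI) (auto simp: compose_def hom_group_closed hom_group_mult)
qed

lemma biadditive_compose:
  assumes "group G" "comm_group H" "comm_group K"
  shows "biadditive (hom_group G H) (hom_group H K) (hom_group G K) (\<lambda>\<alpha> \<xi>. compose (carrier G) \<xi> \<alpha>)"
proof -
  interpret G: group G by fact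
  interpret H: comm_group H by fact
  interpret K: comm_group K by fact
  interpret GH: comm_group "hom_group G H" by (rule comm_group_hom_group[OF assms(1,2)])
  interpret HK: comm_group "hom_group H K" by (rule comm_group_hom_group[OF H.is_group assms(3)])
  interpret GK: comm_group "hom_group G K" by (rule comm_group_hom_group[OF assms(1,3)])
  show ?thesis
  proof unfold_locales
    fix a b assume "a \<in> carrier (hom_group G H)" "b \<in> carrier (hom_group H K)"
    then show "compose (carrier G) b a \<in> carrier (hom_group G K)"
      by (intro compose_hom_group assms(1))
  next
    fix a a' b assume *: "a \<in> carrier (hom_group G H)" "a' \<in> carrier (hom_group G H)"
      "b \<in> carrier (hom_group H K)"
    show "compose (carrier G) b (a \<otimes>\<^bsub>hom_group G H\<^esub> a') =
        compose (carrier G) b a \<otimes>\<^bsub>hom_group G K\<^esub> compose (carrier G) b a'"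
      unfolding hom_group_simps(2) compose_def
      by (rule restrict_ext) (simp add: hom_group_mult[OF *(3)] hom_group_closed[OF *(1)] hom_group_closed[OF *(2)])
  next
    fix a b b' assume *: "a \<in> carrier (hom_group G H)" "b \<in> carrier (hom_group H K)"
      "b' \<in> carrier (hom_group H K)"
    show "compose (carrier G) (b \<otimes>\<^bsub>hom_group H K\<^esub> b') a =
        compose (carrier G) b a \<otimes>\<^bsub>hom_group G K\<^esub> compose (carrier G) b' a"
      unfolding hom_group_simps(2) compose_def
      by (rule restrict_ext) (simp add: hom_group_closed[OF *(1)])
  qed
qed

section \<open>The group of rationals modulo integers\<close>

definition qz :: "rat \<Rightarrow> rat set"
  where "qz r = \<int> #>\<^bsub>rat_group\<^esub> r"

lemma Ints_subgroup: "subgroup \<int> rat_group"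
proof -
  interpret comm_group rat_group by (rule comm_group_rat_group)
  have inv: "inv\<^bsub>rat_group\<^esub> y = - y" for y
    by (rule inv_equality) simp_all
  show ?thesis by unfold_locales (simp_all add: inv)
qed

lemma comm_group_QZ: "comm_group QZ"
  unfolding QZ_def rat_group_def[symmetric]
  by (rule comm_group.abelian_FactGroup[OF comm_group_rat_group Ints_subgroup])

lemma carrier_QZ: "carrier QZ = range qz"
  unfolding QZ_def rat_group_def[symmetric]
  by (auto simp: FactGroup_def RCOSETS_def qz_def)

lemma qz_closed [simp]: "qz r \<in> carrier QZ"
  by (simp add: carrier_QZ)

lemma qz_add: "qz (q + r) = qz q \<otimes>\<^bsub>QZ\<^esub> qz r"
proof -
  have "\<int> \<lhd> rat_group"
    by (rule comm_group.normal_iff_subgroup[THEN iffD2, OF comm_group_rat_group Ints_subgroup])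
  from normal.rcos_sum[OF this, of q r] show ?thesis
    unfolding QZ_def rat_group_def[symmetric] by (simp add: qz_def FactGroup_def)
qed

lemma qz_eq_iff: "qz q = qz r \<longleftrightarrow> q - r \<in> \<int>"
proof -
  interpret comm_group rat_group by (rule comm_group_rat_group)
  have "inv\<^bsub>rat_group\<^esub> y = - y" for y
    by (rule inv_equality) simp_all
  then show ?thesis
    unfolding qz_def using rcos_eq_iff[OF Ints_subgroup, of q r] by simp
qed

lemma qz_zero: "qz 0 = \<one>\<^bsub>QZ\<^esub>"
proof -
  interpret comm_group QZ by (rule comm_group_QZ)
  show ?thesis using qz_add[of 0 0] by (simp add: l_cancel_one)
qed

lemma qz_int_pow: "qz r [^]\<^bsub>QZ\<^esub> (k::int) = qz (of_int k * r)"
proof -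
  have "qz \<in> hom rat_group QZ" by (rule homI) (simp_all add: qz_add)
  from hom_int_pow[OF this, of r k] show ?thesis
    using comm_group.axioms(2)[OF comm_group_QZ] comm_group.axioms(2)[OF comm_group_rat_group]
    by (simp add: int_pow_rat_group)
qed

lemma group_QZ: "group QZ"
  by (rule comm_group.axioms(2)[OF comm_group_QZ])

lemma QZ_divisible:
  assumes "\<gamma> \<in> carrier QZ" "n > (0::nat)"
  shows "\<exists>\<delta> \<in> carrier QZ. \<delta> [^]\<^bsub>QZ\<^esub> n = \<gamma>"
proof -
  obtain r where "\<gamma> = qz r" using assms by (auto simp: carrier_QZ)
  then have "qz (r / of_nat n) [^]\<^bsub>QZ\<^esub> int n = \<gamma>" using assms by (simp only: qz_int_pow) simp
  then show ?thesis using qz_closed by (metis int_pow_int)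
qed

lemma rat_fracE:
  obtains a n :: int where "n > 0" "(r::rat) = of_int a * (1 / of_int n)"
  using rat_common_denom[of r r] by metis

text \<open>The image of 1/n modulo Z is killed by n, and a rational r with n r integral has the
  form k/n.\<close>

lemma hom_QZ_on_cyclic:
  assumes "\<alpha> \<in> carrier (hom_group QZ QZ)" "n > (0::int)"
  shows "\<exists>k::int. \<alpha> (qz (1 / of_int n)) = qz (1 / of_int n) [^]\<^bsub>QZ\<^esub> k"
proof -
  obtain r where r: "\<alpha> (qz (1 / of_int n)) = qz r"
    using hom_group_closed[OF assms(1) qz_closed] by (auto simp: carrier_QZ)
  note pow = hom_group_int_pow_arg[OF group_QZ comm_group_QZ assms(1) qz_closed]
  have "qz (of_int n * r) = \<alpha> (qz (1 / of_int n)) [^]\<^bsub>QZ\<^esub> n"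
    by (simp only: r qz_int_pow)
  also have "\<dots> = \<alpha> (qz (1 / of_int n) [^]\<^bsub>QZ\<^esub> n)"
    by (rule pow[symmetric])
  \<comment> \<open>The neutral class is written as a zeroth power, so that the power law itself
    computes its image.\<close>
  also have "qz (1 / of_int n) [^]\<^bsub>QZ\<^esub> n = qz 0 [^]\<^bsub>QZ\<^esub> (0::int)"
    using assms(2) by (simp only: qz_int_pow qz_eq_iff) simp
  also have "\<alpha> (qz 0 [^]\<^bsub>QZ\<^esub> (0::int)) = \<alpha> (qz 0) [^]\<^bsub>QZ\<^esub> (0::int)"
    by (rule pow)
  also have "\<dots> = qz 0"
    by (simp add: qz_zero)
  finally have "of_int n * r \<in> \<int>" by (simp add: qz_eq_iff)
  then obtain k where "of_int n * r = of_int k" by (auto elim: Ints_cases)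
  then have "r = of_int k * (1 / of_int n)" using assms(2) by (simp add: field_simps)
  then show ?thesis using r by (metis qz_int_pow)
qed

text \<open>A class a/n lies in the cyclic subgroup of 1/n, where both maps raise to fixed exponents
  k and l. The commutation is needed because the action on homomorphisms is precomposition, which
  reverses products.\<close>

lemma hom_QZ_commute:
  assumes "\<alpha> \<in> carrier (hom_group QZ QZ)" "\<beta> \<in> carrier (hom_group QZ QZ)" "\<gamma> \<in> carrier QZ"
  shows "\<alpha> (\<beta> \<gamma>) = \<beta> (\<alpha> \<gamma>)"
proof -
  interpret QZ: comm_group QZ by (rule comm_group_QZ)
  obtain r where "\<gamma> = qz r" using assms by (auto simp: carrier_QZ)
  then obtain a n :: int where n: "n > 0" "\<gamma> = qz (1 / of_int n) [^]\<^bsub>QZ\<^esub> a"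
    by (metis rat_fracE qz_int_pow)
  define \<epsilon> where "\<epsilon> = qz (1 / of_int n)"
  have \<epsilon>: "\<epsilon> \<in> carrier QZ" by (simp add: \<epsilon>_def)
  obtain k l :: int where kl: "\<alpha> \<epsilon> = \<epsilon> [^]\<^bsub>QZ\<^esub> k" "\<beta> \<epsilon> = \<epsilon> [^]\<^bsub>QZ\<^esub> l"
    unfolding \<epsilon>_def using hom_QZ_on_cyclic assms n(1) by metis
  note pow = hom_group_int_pow_arg[OF group_QZ comm_group_QZ]
  have "\<alpha> (\<beta> \<gamma>) = \<epsilon> [^]\<^bsub>QZ\<^esub> (k * l * a)" "\<beta> (\<alpha> \<gamma>) = \<epsilon> [^]\<^bsub>QZ\<^esub> (l * k * a)"
    unfolding n(2) \<epsilon>_def[symmetric]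
    by (simp_all only: pow[OF assms(1)] pow[OF assms(2)] \<epsilon> kl QZ.int_pow_closed QZ.int_pow_pow mult.assoc)
  then show ?thesis by (simp only: mult.commute[of k l])
qed

section \<open>The adele class hyperring\<close>

definition real_group :: "real monoid"
  where "real_group = add_monoid real_ring"

lemma real_group_simps [simp]:
  "carrier real_group = UNIV" "x \<otimes>\<^bsub>real_group\<^esub> y = x + y" "\<one>\<^bsub>real_group\<^esub> = 0"
  by (simp_all add: real_group_def ring_of_type_algebra_def)

lemma comm_group_real_group: "comm_group real_group"
  unfolding real_group_def
  by (metis abelian_group.a_comm_group cring_from_type_algebra ring.is_abelian_group cring.axioms(1))

lemma int_pow_real_group: "x [^]\<^bsub>real_group\<^esub> (k::int) = of_int k * x"
proof -
  interpret comm_group real_group by (rule comm_group_real_group)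
  have nat_case: "x [^]\<^bsub>real_group\<^esub> (n::nat) = of_nat n * x" for n
    by (induction n) (simp_all add: algebra_simps)
  have inv_case: "inv\<^bsub>real_group\<^esub> y = - y" for y
    by (rule inv_equality) simp_all
  show ?thesis
    by (cases k rule: int_cases2) (simp_all add: int_pow_int int_pow_neg nat_case inv_case)
qed

lemma add_monoid_zhat: "add_monoid zhat = hom_group QZ QZ"
  by (simp add: zhat_def hom_group_def)

text \<open>The two distributive laws are the two additivities of composition; in
  \<open>biadditive_compose\<close> the inner map comes first, hence \<open>mult_right\<close> gives
  additivity in the left factor of \<open>zhat\<close>.\<close>

lemma ring_zhat: "ring zhat"
proof (rule ringI)
  show "abelian_group zhat"
    using comm_group_hom_group[OF group_QZ comm_group_QZ]
    unfolding abelian_group_def abelian_group_axioms_def abelian_monoid_def add_monoid_zhat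
    by (simp add: comm_group.axioms)
  interpret biadditive "hom_group QZ QZ" "hom_group QZ QZ" "hom_group QZ QZ"
    "\<lambda>\<alpha> \<xi>. compose (carrier QZ) \<xi> \<alpha>"
    by (rule biadditive_compose[OF group_QZ comm_group_QZ comm_group_QZ])
  have zhat: "carrier zhat = carrier (hom_group QZ QZ)" "\<And>x y. x \<oplus>\<^bsub>zhat\<^esub> y = x \<otimes>\<^bsub>hom_group QZ QZ\<^esub> y"
    "\<And>x y. x \<otimes>\<^bsub>zhat\<^esub> y = compose (carrier QZ) x y" "\<one>\<^bsub>zhat\<^esub> = (\<lambda>\<gamma> \<in> carrier QZ. \<gamma>)"
    by (simp_all add: zhat_def hom_group_def)
  have one: "(\<lambda>\<gamma> \<in> carrier QZ. \<gamma>) \<in> carrier (hom_group QZ QZ)"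
    using group.is_monoid[OF group_QZ] by (intro hom_groupI) (auto simp: monoid.m_closed)
  have Pi: "x \<in> carrier QZ \<rightarrow> carrier QZ" "x \<in> extensional (carrier QZ)"
    if "x \<in> carrier (hom_group QZ QZ)" for x
    using that by (auto simp: hom_group_simps hom_def)
  show "monoid zhat"
    by (rule monoidI) (simp_all add: zhat closed one Pi Id_compose compose_Id[OF Pi] compose_assoc[of _ "carrier QZ" "carrier QZ"])
  show "(x \<oplus>\<^bsub>zhat\<^esub> y) \<otimes>\<^bsub>zhat\<^esub> z = x \<otimes>\<^bsub>zhat\<^esub> z \<oplus>\<^bsub>zhat\<^esub> y \<otimes>\<^bsub>zhat\<^esub> z"
    "z \<otimes>\<^bsub>zhat\<^esub> (x \<oplus>\<^bsub>zhat\<^esub> y) = z \<otimes>\<^bsub>zhat\<^esub> x \<oplus>\<^bsub>zhat\<^esub> z \<otimes>\<^bsub>zhat\<^esub> y"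
    if "x \<in> carrier zhat" "y \<in> carrier zhat" "z \<in> carrier zhat" for x y z
    using that by (simp_all add: zhat mult_left mult_right)
qed

lemma ring_zhat_real: "ring zhat_real"
  by (rule RDirProd_ring[OF ring_zhat ring_from_type_algebra])

text \<open>The additive group in product form, so that powers can be computed coordinate by
  coordinate.\<close>

definition zhat_real_group :: "((rat set \<Rightarrow> rat set) \<times> real) monoid"
  where "zhat_real_group = hom_group QZ QZ \<times>\<times> real_group"

lemma zhat_real_group: "zhat_real_group = add_monoid zhat_real"
  unfolding zhat_real_group_def RDirProd_add_monoid add_monoid_zhat real_group_def ..

lemma zhat_real_simps:
  "carrier zhat_real = carrier (hom_group QZ QZ) \<times> UNIV"
  "(\<alpha>, s) \<otimes>\<^bsub>zhat_real\<^esub> (\<beta>, t) = (compose (carrier QZ) \<alpha> \<beta>, s * t)"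
  "\<one>\<^bsub>zhat_real\<^esub> = (\<lambda>\<gamma> \<in> carrier QZ. \<gamma>, 1)"
  by (simp_all add: RDirProd_def DirProd_def monoid.defs zhat_def ring_of_type_algebra_def hom_group_def)

lemma comm_group_DirProd: "comm_group G \<Longrightarrow> comm_group H \<Longrightarrow> comm_group (G \<times>\<times> H)"
  by (rule group.group_comm_groupI[OF DirProd_group])
    (auto simp: comm_group.axioms comm_groupE)

lemma int_pow_DirProd:
  assumes "group G" "group H" "x \<in> carrier G" "y \<in> carrier H"
  shows "(x, y) [^]\<^bsub>G \<times>\<times> H\<^esub> (k::int) = (x [^]\<^bsub>G\<^esub> k, y [^]\<^bsub>H\<^esub> k)"
proof -
  have "fst \<in> hom (G \<times>\<times> H) G" "snd \<in> hom (G \<times>\<times> H) H"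
    by (auto intro!: homI simp: mult_DirProd')
  then have "fst ((x, y) [^]\<^bsub>G \<times>\<times> H\<^esub> k) = x [^]\<^bsub>G\<^esub> k" "snd ((x, y) [^]\<^bsub>G \<times>\<times> H\<^esub> k) = y [^]\<^bsub>H\<^esub> k"
    using assms hom_int_pow[OF _ _ DirProd_group] by fastforce+
  then show ?thesis by (metis prod.collapse)
qed

lemma comm_group_zhat_real_group: "comm_group zhat_real_group"
  unfolding zhat_real_group_def
  by (intro comm_group_DirProd comm_group_hom_group group_QZ comm_group_QZ comm_group_real_group)

lemma comm_group_pos_reals: "comm_group pos_reals"
proof (rule comm_groupI)
  fix x assume "x \<in> carrier pos_reals"
  then show "\<exists>y \<in> carrier pos_reals. y \<otimes>\<^bsub>pos_reals\<^esub> x = \<one>\<^bsub>pos_reals\<^esub>"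
    by (intro bexI[of _ "inverse x"]) (auto simp: pos_reals_def)
qed (auto simp: pos_reals_def)

lemma int_pow_pos_reals:
  assumes "x > 0"
  shows "x [^]\<^bsub>pos_reals\<^esub> (k::int) = x powi k"
proof -
  interpret comm_group pos_reals by (rule comm_group_pos_reals)
  have nat_case: "y [^]\<^bsub>pos_reals\<^esub> (n::nat) = y ^ n" for y n
    by (induction n) (simp_all add: nat_pow_def pos_reals_def)
  have inv_case: "inv\<^bsub>pos_reals\<^esub> y = inverse y" if "y > 0" for y
    by (rule inv_equality) (use that in \<open>simp_all add: pos_reals_def\<close>)
  have x: "x \<in> carrier pos_reals" using assms by (simp add: pos_reals_def)
  show ?thesis
    by (cases k rule: int_cases2)
      (simp_all add: int_pow_int int_pow_neg[OF x] nat_case inv_case assms power_int_minus)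
qed

lemma E_group_eq: "E_group A = hom_group QZ (units_of A)"
  by (simp add: E_group_def hom_group_def units_of_def)

lemma scalar_action_zhat_real:
  assumes "comm_group H"
  shows "scalar_action zhat_real zhat_real_group (hom_group QZ H \<times>\<times> pos_reals) zhat_real_act"
proof -
  interpret C: biadditive "hom_group QZ QZ" "hom_group QZ H" "hom_group QZ H"
    "\<lambda>\<alpha> \<xi>. compose (carrier QZ) \<xi> \<alpha>"
    by (rule biadditive_compose[OF group_QZ comm_group_QZ assms])
  show ?thesis
  proof (intro scalar_action.intro scalar_action_axioms.intro ring_zhat_real)
    show "zhat_real_group = add_monoid zhat_real" by (rule zhat_real_group)
    show "biadditive zhat_real_group (hom_group QZ H \<times>\<times> pos_reals) (hom_group QZ H \<times>\<times> pos_reals) zhat_real_act"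
      unfolding biadditive_def biadditive_axioms_def zhat_real_group_def
      by (intro conjI comm_group_DirProd C.G.comm_group_axioms C.H.comm_group_axioms
          comm_group_real_group comm_group_pos_reals)
        (auto simp: zhat_real_act_def C.closed C.mult_left C.mult_right pos_reals_def
          powr_add powr_mult)
  next
    fix r s x
    assume "r \<in> carrier zhat_real" "s \<in> carrier zhat_real" "x \<in> carrier (hom_group QZ H \<times>\<times> pos_reals)"
    then obtain \<alpha> a \<beta> b \<xi> y where *: "r = (\<alpha>, a)" "s = (\<beta>, b)" "x = (\<xi>, y)"
      "\<alpha> \<in> carrier (hom_group QZ QZ)" "\<beta> \<in> carrier (hom_group QZ QZ)"
      "\<xi> \<in> carrier (hom_group QZ H)" "y > 0"
      by (auto simp: zhat_real_simps pos_reals_def)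
    \<comment> \<open>The product acts as \<xi> after \<alpha> after \<beta>, while acting in
      succession yields \<xi> after \<beta> after \<alpha>.\<close>
    have "compose (carrier QZ) \<xi> (compose (carrier QZ) \<alpha> \<beta>) =
        compose (carrier QZ) (compose (carrier QZ) \<xi> \<beta>) \<alpha>"
      unfolding compose_def
      by (rule restrict_ext) (simp add: hom_group_closed[OF *(4)] hom_QZ_commute[OF *(4,5)])
    then show "zhat_real_act (r \<otimes>\<^bsub>zhat_real\<^esub> s) x = zhat_real_act r (zhat_real_act s x)"
      using *(7) by (simp add: *(1-3) zhat_real_act_def zhat_real_simps powr_powr mult.commute)
  next
    fix x assume "x \<in> carrier (hom_group QZ H \<times>\<times> pos_reals)"
    then obtain \<xi> y where *: "x = (\<xi>, y)" "\<xi> \<in> carrier (hom_group QZ H)" "y > 0"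
      by (auto simp: pos_reals_def)
    have "compose (carrier QZ) \<xi> (\<lambda>\<gamma> \<in> carrier QZ. \<gamma>) = \<xi>"
      using *(2) by (intro compose_Id) (auto simp: hom_group_simps hom_def)
    then show "zhat_real_act \<one>\<^bsub>zhat_real\<^esub> x = x"
      using *(3) by (simp add: *(1) zhat_real_act_def zhat_real_simps)
  qed
qed

text \<open>The real coordinate of the unit is 1, which has infinite order in the additive reals; a
  vanishing tensor would give a nonzero integer multiple of 1 equal to 0.\<close>

lemma zhat_real_qpure_unit: "qpure zhat_real_group \<one>\<^bsub>zhat_real\<^esub> 1 \<noteq> \<one>\<^bsub>qtensor zhat_real_group\<^esub>"
proof
  interpret comm_group zhat_real_group by (rule comm_group_zhat_real_group)
  interpret R: ring zhat_real by (rule ring_zhat_real)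
  have one: "\<one>\<^bsub>zhat_real\<^esub> \<in> carrier zhat_real_group"
    using R.one_closed by (simp add: zhat_real_group_def zhat_real_simps)
  have "group real_group" by (rule comm_group.axioms(2)[OF comm_group_real_group])
  then have snd_pow: "snd (u [^]\<^bsub>zhat_real_group\<^esub> (k::int)) = snd u [^]\<^bsub>real_group\<^esub> k"
    if "u \<in> carrier zhat_real_group" for u k
    using that comm_group_hom_group[OF group_QZ comm_group_QZ]
    by (auto simp: zhat_real_group_def int_pow_DirProd comm_group.axioms)
  assume "qpure zhat_real_group \<one>\<^bsub>zhat_real\<^esub> 1 = \<one>\<^bsub>qtensor zhat_real_group\<^esub>"
  then have "qpure zhat_real_group \<one>\<^bsub>zhat_real\<^esub> 1 = qpure zhat_real_group \<one>\<^bsub>zhat_real_group\<^esub> 1"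
    by (simp add: qpure_one)
  then obtain n a :: int where n: "n > 0" "of_int n * (1::rat) = of_int a"
    and pow: "\<one>\<^bsub>zhat_real\<^esub> [^]\<^bsub>zhat_real_group\<^esub> a = \<one>\<^bsub>zhat_real_group\<^esub>"
    using qpure_eq_iff[OF one one_closed] by auto
  have "(1::real) [^]\<^bsub>real_group\<^esub> a = 0"
    using arg_cong[OF pow, of snd] snd_pow[OF one] by (simp add: zhat_real_simps zhat_real_group_def)
  then show False using n by (simp add: int_pow_real_group)
qed

section \<open>The space attached to a commutative ring\<close>

text \<open>The closed form of the generated relation: two elements are related when one power step
  from each of them leads to a common element.\<close>

definition power_rel :: "('a, 'm) monoid_scheme \<Rightarrow> ('a \<times> 'a) set"
  where "power_rel G = {(u, v). u \<in> carrier G \<and> v \<in> carrier G \<and>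
    (\<exists>(a::int) (b::int). a \<noteq> 0 \<and> b \<noteq> 0 \<and> u [^]\<^bsub>G\<^esub> a = v [^]\<^bsub>G\<^esub> b)}"

context comm_group
begin

lemma equiv_power_rel: "equiv (carrier G) (power_rel G)"
proof (rule equivI)
  show "power_rel G \<subseteq> carrier G \<times> carrier G" by (auto simp: power_rel_def)
  show "refl_on (carrier G) (power_rel G)"
  proof (rule refl_onI)
    fix u assume "u \<in> carrier G"
    moreover have "(1::int) \<noteq> 0" by simp
    ultimately show "(u, u) \<in> power_rel G" unfolding power_rel_def by blast
  qed
  show "sym (power_rel G)" unfolding power_rel_def by (rule symI) (simp, metis)
  show "trans (power_rel G)"
  proof (rule transI)
    fix u v w assume "(u, v) \<in> power_rel G" "(v, w) \<in> power_rel G"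
    then obtain a b c d :: int where *: "u \<in> carrier G" "v \<in> carrier G" "w \<in> carrier G"
      "a \<noteq> 0" "b \<noteq> 0" "u [^] a = v [^] b" "c \<noteq> 0" "d \<noteq> 0" "v [^] c = w [^] d"
      by (auto simp: power_rel_def)
    then have "u [^] (a * c) = w [^] (d * b)"
      by (metis int_pow_pow mult.commute)
    moreover have "a * c \<noteq> 0" "d * b \<noteq> 0" using * by simp_all
    ultimately show "(u, w) \<in> power_rel G" using *(1,3) unfolding power_rel_def by blast
  qed
qed

text \<open>Zigzags of power steps collapse because \<open>power_rel\<close> is an equivalence
  containing every step; conversely u, u^a = v^b, v is a path of length two. The intersection
  removes the pairs (x, x) outside the group that the reflexive closure adds.\<close>

lemma closure_power_rel:
  fixes f :: "int \<Rightarrow> 'a \<Rightarrow> 'a"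
  defines "S \<equiv> {(u, f m u) | u m. u \<in> carrier G \<and> m \<noteq> 0}"
  assumes f: "\<And>m u. u \<in> carrier G \<Longrightarrow> f m u = u [^] m"
  shows "(S \<union> S\<inverse>)\<^sup>* \<inter> carrier G \<times> carrier G = power_rel G"
proof (intro equalityI subsetI)
  have step: "S \<union> S\<inverse> \<subseteq> power_rel G"
  proof -
    have "(u, u [^] m) \<in> power_rel G" if "u \<in> carrier G" "m \<noteq> 0" for u and m :: int
    proof -
      have "u [^] m = (u [^] m) [^] (1::int)" "(1::int) \<noteq> 0" using that by simp_all
      with that show ?thesis unfolding power_rel_def by blast
    qed
    then have "S \<subseteq> power_rel G" by (auto simp: S_def f)
    then show ?thesis using equiv_power_rel by (auto simp: equiv_def dest: symD)
  qed
  fix x assume x: "x \<in> (S \<union> S\<inverse>)\<^sup>* \<inter> carrier G \<times> carrier G"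
  then obtain u v where uv: "x = (u, v)" "(u, v) \<in> (S \<union> S\<inverse>)\<^sup>*" "u \<in> carrier G" by auto
  from uv(2) have "(u, v) \<in> power_rel G"
  proof (induction rule: rtrancl_induct)
    case base
    then show ?case using equiv_power_rel uv(3) by (auto simp: equiv_def refl_on_def)
  next
    case (step y z)
    then show ?case
      using \<open>S \<union> S\<inverse> \<subseteq> power_rel G\<close> equiv_power_rel unfolding equiv_def by (meson subsetD transD)
  qed
  then show "x \<in> power_rel G" using uv(1) by simp
next
  fix x assume "x \<in> power_rel G"
  then obtain u v and a b :: int where *: "x = (u, v)" "u \<in> carrier G" "v \<in> carrier G"
    "a \<noteq> 0" "b \<noteq> 0" "u [^] a = v [^] b"
    by (auto simp: power_rel_def)
  have "(u, u [^] a) \<in> S" "(v, u [^] a) \<in> S"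
    unfolding S_def using * f[of u a] f[of v b] by (metis (mono_tags, lifting) mem_Collect_eq)+
  then have "(u, v) \<in> (S \<union> S\<inverse>)\<^sup>*"
    by (meson UnI1 UnI2 converseI r_into_rtrancl rtrancl.rtrancl_into_rtrancl)
  then show "x \<in> (S \<union> S\<inverse>)\<^sup>* \<inter> carrier G \<times> carrier G" using * by simp
qed

lemma rorbit_qpure_eq_iff:
  assumes "u \<in> carrier G" "v \<in> carrier G"
  shows "rorbit G (qpure G u 1) = rorbit G (qpure G v 1) \<longleftrightarrow> (u, v) \<in> power_rel G"
proof -
  have "rorbit G (qpure G u 1) = rorbit G (qpure G v 1) \<longleftrightarrow> (\<exists>q. q \<noteq> 0 \<and> qpure G u 1 = qpure G v q)"
    using rorbit_eq_iff[OF qpure_closed[OF assms(1)] qpure_closed[OF assms(2)]]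
    by (simp add: rscale_qpure[OF assms(2)])
  also have "\<dots> \<longleftrightarrow> (u, v) \<in> power_rel G"
  proof
    assume "\<exists>q. q \<noteq> 0 \<and> qpure G u 1 = qpure G v q"
    then obtain q where q: "q \<noteq> 0" "qpure G u 1 = qpure G v q" by blast
    from q(2) obtain n a b :: int where "n > 0" "of_int n * (1::rat) = of_int a"
      "of_int n * q = of_int b" "u [^] a = v [^] b"
      unfolding qpure_eq_iff[OF assms] by blast
    moreover from this have "a \<noteq> 0" "b \<noteq> 0" using q(1) by auto
    ultimately show "(u, v) \<in> power_rel G" using assms unfolding power_rel_def by blast
  next
    assume "(u, v) \<in> power_rel G"
    then obtain a b :: int where ab: "a \<noteq> 0" "b \<noteq> 0" "u [^] a = v [^] b"
      by (auto simp: power_rel_def)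
    \<comment> \<open>The scalar is b/a: u (x) 1 = u^a (x) 1/a = v^b (x) 1/a = v (x) b/a.\<close>
    have "qpure G u 1 = qpure G u (of_int a * (1 / of_int a))"
      using ab(1) by simp
    also have "\<dots> = qpure G (u [^] a) (1 / of_int a)"
      by (rule qpure_int_pow[OF assms(1), symmetric])
    also have "\<dots> = qpure G v (of_int b * (1 / of_int a))"
      unfolding ab(3) by (rule qpure_int_pow[OF assms(2)])
    finally show "\<exists>q. q \<noteq> 0 \<and> qpure G u 1 = qpure G v q"
      using ab(1,2) by (intro exI[of _ "of_int b * (1 / of_int a)"]) simp
  qed
  finally show ?thesis .
qed

text \<open>A tensor g (x) q with q nonzero is a multiple of g (x) 1. For q = 0 it is the zero
  vector, which is represented by the neutral element instead of \<open>g\<close>.\<close>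

lemma rorbit_qpureE:
  assumes "v \<in> carrier (qtensor G)"
  obtains u where "u \<in> carrier G" "rorbit G v = rorbit G (qpure G u 1)"
proof -
  obtain g q where g: "g \<in> carrier G" "v = qpure G g q" by (rule qtensorE[OF assms])
  show thesis
  proof (cases "q = 0")
    case True
    with g have "v = qpure G \<one> 1" by (simp add: qpure_zero qpure_one)
    with that[of \<one>] show ?thesis by simp
  next
    case False
    with g have "rorbit G v = rorbit G (qpure G g 1)"
      using rorbit_rscale[of "qpure G g 1" q] by (simp add: rscale_qpure qpure_closed)
    with that g show ?thesis by blast
  qed
qed

text \<open>All the orbits in the union coincide and the class is nonempty, so taking the union
  amounts to choosing a representative.\<close>

lemma UN_rorbit_class:
  assumes "u \<in> carrier G"
  shows "(\<Union>v \<in> power_rel G `` {u}. rorbit G (qpure G v 1)) = rorbit G (qpure G u 1)"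
proof -
  have same: "rorbit G (qpure G v 1) = rorbit G (qpure G u 1)" if "v \<in> power_rel G `` {u}" for v
  proof -
    have "(u, v) \<in> power_rel G" "v \<in> carrier G" using that by (auto simp: power_rel_def)
    then show ?thesis using rorbit_qpure_eq_iff[OF assms, of v] by simp
  qed
  have "power_rel G `` {u} \<noteq> {}"
    using equiv_class_self[OF equiv_power_rel assms] by (metis empty_iff)
  then show ?thesis using same by (rule SUP_eq_const)
qed

lemma bij_betw_power_quotient:
  "bij_betw (\<lambda>c. \<Union>u \<in> c. rorbit G (qpure G u 1)) (carrier G // power_rel G) (carrier (rquotient G))"
  unfolding bij_betw_def rquotient_simps
proof
  show "inj_on (\<lambda>c. \<Union>u \<in> c. rorbit G (qpure G u 1)) (carrier G // power_rel G)"
  proof (rule inj_onI, elim quotientE)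
    fix c d u v
    assume eq: "(\<Union>u \<in> c. rorbit G (qpure G u 1)) = (\<Union>u \<in> d. rorbit G (qpure G u 1))"
      and u: "u \<in> carrier G" "c = power_rel G `` {u}" and v: "v \<in> carrier G" "d = power_rel G `` {v}"
    then have "(u, v) \<in> power_rel G"
      unfolding u(2) v(2) UN_rorbit_class[OF u(1)] UN_rorbit_class[OF v(1)]
      by (simp only: rorbit_qpure_eq_iff)
    then show "c = d"
      unfolding u(2) v(2) by (rule equiv_class_eq[OF equiv_power_rel])
  qed
  show "(\<lambda>c. \<Union>u \<in> c. rorbit G (qpure G u 1)) ` (carrier G // power_rel G) = rorbit G ` carrier (qtensor G)"
  proof (intro equalityI subsetI)
    fix x assume "x \<in> (\<lambda>c. \<Union>u \<in> c. rorbit G (qpure G u 1)) ` (carrier G // power_rel G)"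
    then obtain u where u: "u \<in> carrier G" "x = (\<Union>v \<in> power_rel G `` {u}. rorbit G (qpure G v 1))"
      by (auto elim!: quotientE)
    show "x \<in> rorbit G ` carrier (qtensor G)"
      unfolding u(2) UN_rorbit_class[OF u(1)] by (rule imageI) (rule qpure_closed[OF u(1)])
  next
    fix x assume "x \<in> rorbit G ` carrier (qtensor G)"
    then obtain u where u: "u \<in> carrier G" "x = rorbit G (qpure G u 1)"
      by (auto elim: rorbit_qpureE)
    show "x \<in> (\<lambda>c. \<Union>u \<in> c. rorbit G (qpure G u 1)) ` (carrier G // power_rel G)"
      unfolding u(2) UN_rorbit_class[OF u(1), symmetric] by (rule imageI) (rule quotientI[OF u(1)])
  qed
qed

end

section \<open>The space \<open>X_space A\<close> and its module structure\<close>

lemma comm_group_E_group: "cring A \<Longrightarrow> comm_group (E_group A)"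
  unfolding E_group_eq
  by (rule comm_group_hom_group[OF group_QZ comm_monoid.units_comm_group[OF cring.axioms(2)]])

lemma comm_group_EP_group: "cring A \<Longrightarrow> comm_group (EP_group A)"
  by (rule comm_group_DirProd[OF comm_group_E_group comm_group_pos_reals])

text \<open>A homomorphism turns the m-th power of its argument into the m-th power of its value, so
  precomposition with m is the m-th power in the group of homomorphisms.\<close>

lemma int_act_eq_pow:
  assumes "cring A" "u \<in> carrier (EP_group A)"
  shows "int_act m u = u [^]\<^bsub>EP_group A\<^esub> m"
proof -
  obtain \<xi> x where u: "u = (\<xi>, x)" "\<xi> \<in> carrier (E_group A)" "x > 0"
    using assms(2) by (auto simp: pos_reals_def)
  have \<xi>: "\<xi> \<in> carrier (hom_group QZ (units_of A))" using u(2) by (simp only: E_group_eq)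
  have x: "x \<in> carrier pos_reals" using u(3) by (simp add: pos_reals_def)
  have units: "comm_group (units_of A)"
    using assms(1) by (intro comm_monoid.units_comm_group) (simp add: cring_def)
  interpret E: comm_group "hom_group QZ (units_of A)"
    by (rule comm_group_hom_group[OF group_QZ units])
  interpret QZ: group QZ by (rule group_QZ)
  have "(\<lambda>\<gamma> \<in> carrier QZ. \<xi> (\<gamma> [^]\<^bsub>QZ\<^esub> m)) = \<xi> [^]\<^bsub>hom_group QZ (units_of A)\<^esub> m"
    using E.int_pow_closed[OF \<xi>, of m]
      hom_group_int_pow[OF group_QZ units \<xi>] hom_group_int_pow_arg[OF group_QZ units \<xi>]
    by (intro extensionalityI[of _ "carrier QZ"]) (simp_all add: hom_group_simps(1))
  then show ?thesis
    unfolding u(1) E_group_eq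
    using x \<xi> int_pow_pos_reals[OF u(3), of m]
    by (simp add: int_act_def int_pow_DirProd E.is_group comm_group.axioms(2)[OF comm_group_pos_reals])
qed

lemma X_rel_eq:
  assumes "cring A"
  shows "X_rel A = power_rel (EP_group A)"
proof -
  interpret comm_group "EP_group A" by (rule comm_group_EP_group[OF assms])
  show ?thesis
    unfolding X_rel_def Let_def by (rule closure_power_rel) (rule int_act_eq_pow[OF assms])
qed

lemma X_embed_bij_betw:
  assumes "cring A"
  shows "bij_betw (X_embed A) (X_space A) (carrier (rquotient (EP_group A)))"
proof -
  interpret comm_group "EP_group A" by (rule comm_group_EP_group[OF assms])
  have "X_embed A = (\<lambda>c. \<Union>u \<in> c. rorbit (EP_group A) (qpure (EP_group A) u 1))"
    unfolding X_embed_def rat_group_def ..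
  then show ?thesis
    using bij_betw_power_quotient by (simp only: X_space_def X_rel_eq[OF assms])
qed

lemma scalar_action_EP_group:
  assumes "cring A"
  shows "scalar_action zhat_real zhat_real_group (EP_group A) zhat_real_act"
  unfolding E_group_eq
  by (rule scalar_action_zhat_real[OF comm_monoid.units_comm_group[OF cring.axioms(2)[OF assms]]])

text \<open>The fields of \<open>X_module\<close> are pullbacks along \<open>X_embed\<close> of
  those of the orbit module, so both facts come from \<open>hypermodule_transport\<close>.\<close>

lemma
  assumes "cring A"
  shows hypermodule_X_module: "hypermodule adele_class_hyperring (X_module A)"
    and X_module_hact: "\<lbrakk>r \<in> carrier adele_class_hyperring; c \<in> X_space A\<rbrakk> \<Longrightarrow>
      hact (X_module A) r c \<in> X_space A \<and> X_embed A (hact (X_module A) r c) =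
        hact (rquotient_hypermodule zhat_real (EP_group A) zhat_real_act) r (X_embed A c)"
proof -
  let ?M = "rquotient_hypermodule zhat_real (EP_group A) zhat_real_act"
  interpret scalar_action zhat_real zhat_real_group "EP_group A" zhat_real_act
    by (rule scalar_action_EP_group[OF assms])
  have M: "hypermodule adele_class_hyperring ?M"
    unfolding adele_class_hyperring_def by (rule hypermodule_rquotient[OF zhat_real_qpure_unit])
  have bij: "bij_betw (X_embed A) (carrier (X_module A)) (carrier ?M)"
    using X_embed_bij_betw[OF assms] by (simp add: X_module_def rquotient_hypermodule_def)
  have hadd: "c \<boxplus>\<^bsub>X_module A\<^esub> d =
      {e \<in> carrier (X_module A). X_embed A e \<in> X_embed A c \<boxplus>\<^bsub>?M\<^esub> X_embed A d}" for c d
    by (simp add: X_module_def rquotient_hypermodule_def)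
  have zero: "hzero (X_module A) \<in> carrier (X_module A)"
    by (simp add: X_module_def X_space_def quotientI del: one_DirProd carrier_DirProd)
  have "X_embed A (hzero (X_module A)) = rorbit (EP_group A) (qpure (EP_group A) \<one>\<^bsub>EP_group A\<^esub> 1)"
    using H.UN_rorbit_class[OF H.one_closed]
    by (simp add: X_module_def X_embed_def X_rel_eq[OF assms] rat_group_def del: one_DirProd)
  then have zero': "X_embed A (hzero (X_module A)) = hzero ?M"
    by (simp only: rquotient_hypermodule_simps H.qpure_one)
  have act: "hact (X_module A) r c =
      inv_into (carrier (X_module A)) (X_embed A) (hact ?M r (X_embed A c))" for r c
    by (simp add: X_module_def rquotient_hypermodule_def)
  show "hypermodule adele_class_hyperring (X_module A)"
    by (rule hypermodule_transport(1)[OF M bij hadd zero zero' act])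
  have "carrier (X_module A) = X_space A" by (simp add: X_module_def)
  then show "hact (X_module A) r c \<in> X_space A \<and>
      X_embed A (hact (X_module A) r c) = hact ?M r (X_embed A c)"
    if "r \<in> carrier adele_class_hyperring" "c \<in> X_space A"
    using hypermodule_transport(2)[OF M bij hadd zero zero' act, of r c] that by simp
qed

text \<open>The generator is the class that \<open>X_embed\<close> sends to the orbit of g (x) 1.
  Bijectivity of its action is known on orbits and is pulled back along
  \<open>X_embed\<close>.\<close>

lemma free_X_module:
  assumes "cring A" "g \<in> carrier (EP_group A)"
    and "bij_betw (\<lambda>r. zhat_real_act r g) (carrier zhat_real) (carrier (EP_group A))"
  shows "free_of_rank_one adele_class_hyperring (X_module A)"
proof -
  let ?M = "rquotient_hypermodule zhat_real (EP_group A) zhat_real_act"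
  let ?g = "rorbit (EP_group A) (qpure (EP_group A) g 1)"
  interpret scalar_action zhat_real zhat_real_group "EP_group A" zhat_real_act
    by (rule scalar_action_EP_group[OF assms(1)])
  have carriers: "carrier (X_module A) = X_space A" "carrier (rquotient (EP_group A)) = carrier ?M"
    by (simp_all add: X_module_def rquotient_hypermodule_def)
  note bij = X_embed_bij_betw[OF assms(1), unfolded carriers]
  have "?g \<in> carrier ?M"
    using H.qpure_closed[OF assms(2)] by (simp add: rquotient_hypermodule_simps)
  then obtain c where c: "c \<in> X_space A" "X_embed A c = ?g"
    using bij by (metis bij_betw_def imageE)
  have "bij_betw (\<lambda>r. hact ?M r ?g) (carrier adele_class_hyperring) (carrier ?M)"
    unfolding adele_class_hyperring_def by (rule hact_unit_bij_betw[OF assms(2,3)])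
  then have "bij_betw (\<lambda>r. X_embed A (hact (X_module A) r c))
      (carrier adele_class_hyperring) (carrier ?M)"
    by (rule bij_betw_cong[THEN iffD1, rotated]) (simp add: X_module_hact[OF assms(1) _ c(1)] c(2))
  moreover have "(\<lambda>r. hact (X_module A) r c) ` carrier adele_class_hyperring \<subseteq> X_space A"
    using X_module_hact[OF assms(1) _ c(1)] by blast
  ultimately have "bij_betw (\<lambda>r. hact (X_module A) r c) (carrier adele_class_hyperring) (X_space A)"
    using bij_betw_comp_iff2[OF bij, of "\<lambda>r. hact (X_module A) r c" "carrier adele_class_hyperring"]
    by (simp add: comp_def)
  then show ?thesis
    using free_of_rank_oneI[OF hypermodule_X_module[OF assms(1)]] c(1) by (simp add: carriers)
qed

text \<open>Every element of Q/Z is torsion, so a homomorphism to \<open>H\<close> takes values in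
  the torsion of \<open>H\<close>, which is the image of \<open>j\<close>; it therefore factors
  through \<open>j\<close>.\<close>

lemma bij_betw_compose_torsion:
  assumes "comm_group H" "j \<in> carrier (hom_group QZ H)"
    and j: "bij_betw j (carrier QZ) {h \<in> carrier H. \<exists>n>0. h [^]\<^bsub>H\<^esub> (n::nat) = \<one>\<^bsub>H\<^esub>}"
  shows "bij_betw (\<lambda>\<alpha>. compose (carrier QZ) j \<alpha>) (carrier (hom_group QZ QZ)) (carrier (hom_group QZ H))"
proof (rule bij_betw_imageI)
  interpret H: comm_group H by fact
  interpret QZ: comm_group QZ by (rule comm_group_QZ)
  have j_eq: "j \<gamma> = j \<delta> \<longleftrightarrow> \<gamma> = \<delta>" if "\<gamma> \<in> carrier QZ" "\<delta> \<in> carrier QZ" for \<gamma> \<delta>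
    by (rule inj_on_eq_iff[OF bij_betw_imp_inj_on[OF j] that])
  show "inj_on (\<lambda>\<alpha>. compose (carrier QZ) j \<alpha>) (carrier (hom_group QZ QZ))"
  proof (rule inj_onI)
    fix \<alpha> \<beta> assume \<alpha>: "\<alpha> \<in> carrier (hom_group QZ QZ)" and \<beta>: "\<beta> \<in> carrier (hom_group QZ QZ)"
      and eq: "compose (carrier QZ) j \<alpha> = compose (carrier QZ) j \<beta>"
    show "\<alpha> = \<beta>"
    proof (rule hom_group_eqI[OF \<alpha> \<beta>])
      fix \<gamma> assume \<gamma>: "\<gamma> \<in> carrier QZ"
      then have "j (\<alpha> \<gamma>) = j (\<beta> \<gamma>)" using fun_cong[OF eq, of \<gamma>] by (simp add: compose_eq)
      then show "\<alpha> \<gamma> = \<beta> \<gamma>"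
        using j_eq[OF hom_group_closed[OF \<alpha> \<gamma>] hom_group_closed[OF \<beta> \<gamma>]] by simp
    qed
  qed
  show "(\<lambda>\<alpha>. compose (carrier QZ) j \<alpha>) ` carrier (hom_group QZ QZ) = carrier (hom_group QZ H)"
  proof (intro equalityI subsetI)
    fix \<xi> assume "\<xi> \<in> (\<lambda>\<alpha>. compose (carrier QZ) j \<alpha>) ` carrier (hom_group QZ QZ)"
    then show "\<xi> \<in> carrier (hom_group QZ H)"
      using compose_hom_group[OF group_QZ assms(2)] by auto
  next
    fix \<xi> assume \<xi>: "\<xi> \<in> carrier (hom_group QZ H)"
    have "\<exists>\<delta> \<in> carrier QZ. j \<delta> = \<xi> \<gamma>" if \<gamma>: "\<gamma> \<in> carrier QZ" for \<gamma>
    proof -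
      obtain a n :: int where n: "n > 0" "\<gamma> = qz (of_int a * (1 / of_int n))"
        using \<gamma> by (metis carrier_QZ imageE rat_fracE)
      have "\<gamma> [^]\<^bsub>QZ\<^esub> n = qz 0 [^]\<^bsub>QZ\<^esub> (0::int)"
        unfolding n(2) qz_int_pow qz_eq_iff using n(1) by simp
      then have "\<gamma> [^]\<^bsub>QZ\<^esub> n = \<one>\<^bsub>QZ\<^esub>" by (simp add: qz_zero)
      then have "\<xi> \<gamma> [^]\<^bsub>H\<^esub> n = \<xi> (\<one>\<^bsub>QZ\<^esub> [^]\<^bsub>QZ\<^esub> (0::int))"
        using hom_group_int_pow_arg[OF group_QZ assms(1) \<xi> \<gamma>, of n] by simp
      also have "\<dots> = \<one>\<^bsub>H\<^esub>"
        using hom_group_int_pow_arg[OF group_QZ assms(1) \<xi> QZ.one_closed, of 0] by simp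
      finally have "\<xi> \<gamma> [^]\<^bsub>H\<^esub> nat n = \<one>\<^bsub>H\<^esub>" using n(1) by (simp add: pow_nat)
      then have "\<xi> \<gamma> \<in> {h \<in> carrier H. \<exists>n>0. h [^]\<^bsub>H\<^esub> (n::nat) = \<one>\<^bsub>H\<^esub>}"
        using n(1) hom_group_closed[OF \<xi> \<gamma>] by (auto intro!: exI[of _ "nat n"])
      then have "\<xi> \<gamma> \<in> j ` carrier QZ" by (simp only: bij_betw_imp_surj_on[OF j])
      then show ?thesis by (elim imageE) (rule bexI, simp_all)
    qed
    \<comment> \<open>Preimages under \<open>j\<close> are chosen pointwise; injectivity of
      \<open>j\<close> makes the choice additive.\<close>
    then obtain a where a: "\<And>\<gamma>. \<gamma> \<in> carrier QZ \<Longrightarrow> a \<gamma> \<in> carrier QZ"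
      "\<And>\<gamma>. \<gamma> \<in> carrier QZ \<Longrightarrow> j (a \<gamma>) = \<xi> \<gamma>" by metis
    have hom: "(\<lambda>\<gamma> \<in> carrier QZ. a \<gamma>) \<in> carrier (hom_group QZ QZ)"
    proof (rule hom_groupI)
      fix \<gamma> \<delta> assume \<gamma>: "\<gamma> \<in> carrier QZ" and \<delta>: "\<delta> \<in> carrier QZ"
      have "j (a (\<gamma> \<otimes>\<^bsub>QZ\<^esub> \<delta>)) = j (a \<gamma> \<otimes>\<^bsub>QZ\<^esub> a \<delta>)"
        using \<gamma> \<delta> a by (simp add: hom_group_mult[OF \<xi>] hom_group_mult[OF assms(2)])
      then show "(\<lambda>\<gamma> \<in> carrier QZ. a \<gamma>) (\<gamma> \<otimes>\<^bsub>QZ\<^esub> \<delta>) =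
          (\<lambda>\<gamma> \<in> carrier QZ. a \<gamma>) \<gamma> \<otimes>\<^bsub>QZ\<^esub> (\<lambda>\<gamma> \<in> carrier QZ. a \<gamma>) \<delta>"
        using \<gamma> \<delta> a(1) by (simp add: j_eq)
    qed (use a(1) in auto)
    moreover have "compose (carrier QZ) j (\<lambda>\<gamma> \<in> carrier QZ. a \<gamma>) = \<xi>"
    proof (rule hom_group_eqI[OF compose_hom_group[OF group_QZ assms(2) hom] \<xi>])
      fix \<gamma> assume "\<gamma> \<in> carrier QZ"
      then show "compose (carrier QZ) j (\<lambda>\<gamma> \<in> carrier QZ. a \<gamma>) \<gamma> = \<xi> \<gamma>"
        using a(2) by (simp add: compose_eq)
    qed
    ultimately show "\<xi> \<in> (\<lambda>\<alpha>. compose (carrier QZ) j \<alpha>) ` carrier (hom_group QZ QZ)" by blast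
  qed
qed

lemma free_X_module_of_torsion:
  assumes "cring A" "j \<in> carrier (hom_group QZ (units_of A))"
    and "bij_betw j (carrier QZ) {h \<in> carrier (units_of A). \<exists>n>0. h [^]\<^bsub>units_of A\<^esub> (n::nat) = \<one>\<^bsub>units_of A\<^esub>}"
  shows "free_of_rank_one adele_class_hyperring (X_module A)"
proof (rule free_X_module[OF assms(1), of "(j, exp 1)"])
  have units: "comm_group (units_of A)"
    using assms(1) by (intro comm_monoid.units_comm_group) (simp add: cring_def)
  show "(j, exp 1) \<in> carrier (EP_group A)"
    using assms(2) by (simp add: E_group_eq pos_reals_def)
  have "bij_betw (\<lambda>t. exp 1 powr t) (UNIV :: real set) {0<..}"
    by (rule bij_betw_byWitness[where f' = ln]) (auto simp: powr_def)
  from bij_betw_map_prod[OF bij_betw_compose_torsion[OF units assms(2,3)] this]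
  have "bij_betw (map_prod (\<lambda>\<alpha>. compose (carrier QZ) j \<alpha>) (\<lambda>t::real. exp 1 powr t))
      (carrier (hom_group QZ QZ) \<times> UNIV) (carrier (hom_group QZ (units_of A)) \<times> {0<..})" .
  moreover have "map_prod (\<lambda>\<alpha>. compose (carrier QZ) j \<alpha>) (\<lambda>t. exp 1 powr t) =
      (\<lambda>r. zhat_real_act r (j, exp (1::real)))"
    by (auto simp: zhat_real_act_def fun_eq_iff)
  ultimately show "bij_betw (\<lambda>r. zhat_real_act r (j, exp 1)) (carrier zhat_real) (carrier (EP_group A))"
    by (simp add: zhat_real_simps E_group_eq pos_reals_def)
qed

section \<open>Compatible systems of roots of unity\<close>

context comm_group
begin

text \<open>Any q-th root \<open>x\<close> of \<open>z\<close> has order N q when q divides N, and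
  otherwise when x^N is not 1. In the remaining case multiplying \<open>x\<close> by \<eta> repairs
  it: the N-th power becomes that of \<eta>, which is not 1 because q does not divide N.\<close>

lemma exists_prime_root_ord:
  assumes z: "z \<in> carrier G" "ord z = N" "N > 0" and q: "Factorial_Ring.prime q"
    and P: "P \<subseteq> carrier G" "\<And>x y. \<lbrakk>x \<in> P; y \<in> P\<rbrakk> \<Longrightarrow> x \<otimes> y \<in> P"
    and root: "\<exists>x \<in> P. x [^] q = z"
    and unity: "\<exists>\<eta> \<in> P. \<eta> \<noteq> \<one> \<and> \<eta> [^] q = \<one>"
  shows "\<exists>x \<in> P. x [^] q = z \<and> ord x = N * q"
proof -
  obtain x where x: "x \<in> P" "x [^] q = z" using root by blast
  obtain \<eta> where \<eta>: "\<eta> \<in> P" "\<eta> \<noteq> \<one>" "\<eta> [^] q = \<one>" using unity by blast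
  have x_carrier: "x \<in> carrier G" and \<eta>_carrier: "\<eta> \<in> carrier G" using x \<eta> P(1) by auto
  have ord_prime: "ord y = q" if "y \<in> carrier G" "y [^] q = \<one>" "y \<noteq> \<one>" for y
  proof -
    have "ord y dvd q" using that pow_eq_id by blast
    then have "ord y = 1 \<or> ord y = q" using q by (metis prime_nat_iff)
    then show ?thesis using that ord_eq_1 by blast
  qed
  have "\<exists>y \<in> P. y [^] q = z \<and> (q dvd N \<or> y [^] N \<noteq> \<one>)"
  proof (cases "q dvd N \<or> x [^] N \<noteq> \<one>")
    case True
    with x show ?thesis by blast
  next
    case False
    have "(x \<otimes> \<eta>) [^] q = z"
      using x \<eta> x_carrier \<eta>_carrier z(1) by (simp add: pow_mult_distrib[OF m_comm])
    moreover have "\<eta> [^] N \<noteq> \<one>"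
      using pow_eq_id[OF \<eta>_carrier] ord_prime[OF \<eta>_carrier \<eta>(3,2)] False by simp
    then have "(x \<otimes> \<eta>) [^] N \<noteq> \<one>"
      using False x_carrier \<eta>_carrier by (simp add: pow_mult_distrib[OF m_comm])
    ultimately show ?thesis using P(2)[OF x(1) \<eta>(1)] by blast
  qed
  then obtain y where y: "y \<in> P" "y [^] q = z" "q dvd N \<or> y [^] N \<noteq> \<one>" by blast
  have y_carrier: "y \<in> carrier G" using y P(1) by auto
  \<comment> \<open>If y^k = 1 then z^k = 1, so k = N l. If q divides N, then y^k is a power of
    \<open>z\<close> whose exponent must be divisible by N; otherwise y^N has order exactly q.
    Either way q divides l.\<close>
  have "y [^] k = \<one> \<longleftrightarrow> N * q dvd k" for k :: nat
  proof
    assume "N * q dvd k"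
    then obtain l where "k = N * q * l" by (rule dvdE)
    then have k: "k = q * (N * l)" by simp
    have "y [^] k = z [^] (N * l)"
      unfolding k y(2)[symmetric] nat_pow_pow[OF y_carrier] ..
    then show "y [^] k = \<one>" using pow_eq_id[OF z(1)] z(2) by simp
  next
    assume k: "y [^] k = \<one>"
    have "z [^] k = (y [^] k) [^] q"
      unfolding y(2)[symmetric] nat_pow_pow[OF y_carrier] by (simp only: mult.commute)
    then have "z [^] k = \<one>" using k by simp
    then have "N dvd k" using pow_eq_id[OF z(1)] z(2) by simp
    then obtain l where l: "k = N * l" by (rule dvdE)
    show "N * q dvd k"
    proof (cases "q dvd N")
      case True
      then obtain N' where N': "N = q * N'" by (rule dvdE)
      have "z [^] (N' * l) = y [^] k"
        unfolding y(2)[symmetric] nat_pow_pow[OF y_carrier] l N' by (simp only: mult.assoc)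
      then have "N dvd N' * l" using k pow_eq_id[OF z(1)] z(2) by simp
      then show ?thesis using l N' \<open>N > 0\<close> by (simp add: mult_ac)
    next
      case False
      have "(y [^] N) [^] q = \<one>"
        using y(2) y_carrier z pow_ord_eq_1[OF z(1)] by (metis mult.commute nat_pow_pow)
      then have "ord (y [^] N) = q"
        using False y y_carrier by (intro ord_prime) auto
      moreover have "(y [^] N) [^] l = \<one>" using k l y_carrier by (simp add: nat_pow_pow)
      ultimately have "q dvd l" using pow_eq_id[of "y [^] N"] y_carrier by simp
      then show ?thesis using l by simp
    qed
  qed
  then have "ord y = N * q" using ord_unique[OF y_carrier] by blast
  with y show ?thesis by blast
qed

text \<open>\<open>P\<close> stands for the nonzero elements of an algebraically closed subfield
  inside the unit group of a larger field: roots are extracted in \<open>P\<close>, torsion is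
  counted in all of \<open>G\<close>.\<close>

context
  fixes P
  assumes P: "P \<subseteq> carrier G" "\<one> \<in> P" "\<And>x y. \<lbrakk>x \<in> P; y \<in> P\<rbrakk> \<Longrightarrow> x \<otimes> y \<in> P"
    and root: "\<And>z q. \<lbrakk>z \<in> P; Factorial_Ring.prime q\<rbrakk> \<Longrightarrow> \<exists>x \<in> P. x [^] (q::nat) = z"
    and unity: "\<And>q. Factorial_Ring.prime q \<Longrightarrow> \<exists>\<eta> \<in> P. \<eta> \<noteq> \<one> \<and> \<eta> [^] (q::nat) = \<one>"
begin

lemma exists_root_ord:
  assumes "z \<in> P" "ord z = N" "N > 0" "M > 0"
  shows "\<exists>x \<in> P. x [^] (M::nat) = z \<and> ord x = N * M"
  using assms
proof (induction M arbitrary: z N rule: less_induct)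
  case (less M)
  show ?case
  proof (cases "M = 1")
    case True
    with less P(1) show ?thesis by (auto intro!: bexI[of _ z])
  next
    case False
    then obtain q M' where q: "Factorial_Ring.prime q" "M = q * M'"
      by (metis prime_factor_nat dvdE)
    have M': "M' < M" "M' > 0" using q less.prems(4) prime_gt_1_nat[OF q(1)] by auto
    obtain y where y: "y \<in> P" "y [^] M' = z" "ord y = N * M'"
      using less.IH[OF M'(1) less.prems(1-3) M'(2)] by blast
    have "\<exists>x \<in> P. x [^] q = y \<and> ord x = N * M' * q"
      using y P less.prems M' by (intro exists_prime_root_ord root unity q(1)) auto
    then obtain x where x: "x \<in> P" "x [^] q = y" "ord x = N * M' * q" by blast
    have "x [^] M = z" unfolding q(2) using x y P(1) by (auto simp: nat_pow_pow[symmetric])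
    with x q(2) show ?thesis by (auto simp: mult_ac)
  qed
qed

text \<open>Taking the (n+1)-st root at stage n gives orders n!, a single chain suited to dependent
  choice, and any positive integer n divides n!.\<close>

lemma exists_root_system:
  obtains z where "\<And>n. z n \<in> P" "\<And>n. ord (z n) = fact n" "\<And>n. z (Suc n) [^] Suc n = z n"
proof -
  have "\<exists>z. \<forall>n. (z n \<in> P \<and> ord (z n) = fact n) \<and> z (Suc n) [^] Suc n = z n"
  proof (rule dependent_nat_choice)
    show "\<exists>x. x \<in> P \<and> ord x = fact 0" using P(2) ord_id by auto
    fix x n assume "x \<in> P \<and> ord x = fact n"
    then show "\<exists>y. (y \<in> P \<and> ord y = fact (Suc n)) \<and> y [^] Suc n = x"
      using exists_root_ord[of x "fact n" "Suc n"] by (auto simp: mult.commute)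
  qed
  then show thesis using that by blast
qed

text \<open>The map is J(a / n!) = (z n)^a, independent of the representation by compatibility of
  the roots. As \<open>z n\<close> has order exactly n!, the value is 1 precisely when n! divides
  a.\<close>

lemma exists_rat_hom:
  obtains J where "J \<in> hom rat_group G" "\<And>r. J r = \<one> \<longleftrightarrow> r \<in> \<int>"
proof -
  obtain z where z_P: "\<And>n. z n \<in> P" and z_ord: "\<And>n. ord (z n) = fact n"
    and z_Suc: "\<And>n. z (Suc n) [^] Suc n = z n"
    using exists_root_system by blast
  have z: "z n \<in> carrier G" for n using z_P P(1) by blast
  have z_add: "\<exists>c::nat. fact (n + d) = c * fact n \<and> z n = z (n + d) [^] c" for n d
  proof (induction d)
    case 0
    show ?case using z by (intro exI[of _ 1]) simp
  next
    case (Suc d)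
    then obtain c :: nat where c: "fact (n + d) = c * fact n" "z n = z (n + d) [^] c" by blast
    have "z n = (z (Suc (n + d)) [^] Suc (n + d)) [^] c" using c(2) by (simp only: z_Suc)
    then have "z n = z (n + Suc d) [^] (Suc (n + d) * c)" using z by (simp only: nat_pow_pow add_Suc_right)
    moreover have "fact (n + Suc d) = Suc (n + d) * c * fact n" using c(1) by (simp add: algebra_simps)
    ultimately show ?case by blast
  qed
  have z_le: "\<exists>c::int. fact m = c * fact n \<and> z n = z m [^] c" if nm: "n \<le> m" for n m
  proof -
    obtain c :: nat where c: "fact m = c * fact n" "z n = z m [^] c"
      using z_add[of n "m - n"] nm by auto
    have "(fact m :: int) = int c * fact n" using c(1) by (metis of_nat_fact of_nat_mult)
    with c(2) show ?thesis by (metis int_pow_int)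
  qed
  \<comment> \<open>Passing from level n to level m multiplies the numerator by m! / n!, which the
    compatibility of the roots cancels.\<close>
  have frac_mono: "\<exists>b::int. r * fact m = of_int b \<and> z m [^] b = z n [^] a"
    if le: "n \<le> m" and a: "(r::rat) * fact n = of_int a" for n m r and a :: int
  proof -
    obtain c :: int where c: "fact m = c * fact n" "z n = z m [^] c" using z_le[OF le] by blast
    have "(fact m :: rat) = of_int c * fact n"
      using arg_cong[OF c(1), of rat_of_int] by simp
    then have "r * fact m = of_int (c * a)" using a by simp
    moreover have "z m [^] (c * a) = z n [^] a" using c(2) z by (simp add: int_pow_pow)
    ultimately show ?thesis by blast
  qed
  have frac: "\<exists>n a. (r::rat) * fact n = of_int a" for r
  proof -
    obtain a n :: int where r: "n > 0" "r = of_int a * (1 / of_int n)" by (rule rat_fracE)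
    have "nat n dvd fact (nat n)" using r(1) by (intro dvd_fact) auto
    then have "n dvd fact (nat n)" using r(1) by (metis int_dvd_int_iff int_nat_eq of_nat_fact less_le)
    then obtain k where k: "fact (nat n) = n * k" by (rule dvdE)
    have "(fact (nat n) :: rat) = of_int n * of_int k"
      using arg_cong[OF k, of rat_of_int] by simp
    then have "r * fact (nat n) = of_int (a * k)" using r by simp
    then show ?thesis by blast
  qed
  then obtain N A where NA: "\<And>r::rat. r * fact (N r) = of_int (A r)" by metis
  define J where "J r = z (N r) [^] A r" for r
  have J_eq: "J r = z n [^] a" if a: "r * fact n = of_int a" for r n a
  proof -
    \<comment> \<open>Both representations of \<open>r\<close> are lifted to a common level, where
      the numerator is unique.\<close>
    define m where "m = max n (N r)"
    obtain b :: int where b: "r * fact m = of_int b" "z m [^] b = z n [^] a"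
      using frac_mono[OF _ a, of m] by (auto simp: m_def)
    obtain c :: int where c: "r * fact m = of_int c" "z m [^] c = J r"
      unfolding J_def using frac_mono[OF _ NA, of r m] by (auto simp: m_def)
    have "b = c" using b(1) c(1) by simp
    with b c show ?thesis by simp
  qed
  have "J \<in> hom rat_group G"
  proof (rule homI)
    show "J r \<in> carrier G" for r using z by (simp add: J_def)
    fix q r
    define m where "m = max (N q) (N r)"
    obtain b :: int where b: "q * fact m = of_int b"
      using frac_mono[OF _ NA, of q m] by (auto simp: m_def)
    obtain c :: int where c: "r * fact m = of_int c"
      using frac_mono[OF _ NA, of r m] by (auto simp: m_def)
    have "(q + r) * fact m = of_int (b + c)" using b c by (simp add: algebra_simps)
    then show "J (q \<otimes>\<^bsub>rat_group\<^esub> r) = J q \<otimes> J r"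
      using J_eq[OF b] J_eq[OF c] J_eq[of "q + r" m "b + c"] z by (simp add: int_pow_mult)
  qed
  moreover have "J r = \<one> \<longleftrightarrow> r \<in> \<int>" for r
  proof -
    have "J r = \<one> \<longleftrightarrow> fact (N r) dvd A r"
      unfolding J_def int_pow_eq_id[OF z] z_ord by simp
    also have "\<dots> \<longleftrightarrow> r \<in> \<int>"
    proof
      assume "fact (N r) dvd A r"
      then obtain k where "A r = fact (N r) * k" by (rule dvdE)
      then have "r * fact (N r) = of_int k * fact (N r)" using NA[of r] by simp
      then show "r \<in> \<int>" by simp
    next
      assume "r \<in> \<int>"
      then obtain k where "r = of_int k" by (rule Ints_cases)
      then have "rat_of_int (A r) = rat_of_int (k * fact (N r))" using NA[of r] by simp
      then have "A r = k * fact (N r)" by (simp only: of_int_eq_iff)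
      then show "fact (N r) dvd A r" by simp
    qed
    finally show ?thesis .
  qed
  ultimately show thesis by (rule that)
qed

text \<open>The kernel of \<open>J\<close> is Z, so \<open>J\<close> descends to an injection on
  Q/Z. Surjectivity onto the torsion is a count against \<open>bound\<close>.\<close>

lemma exists_QZ_hom:
  assumes bound: "\<And>n::nat. n > 0 \<Longrightarrow> finite {x \<in> carrier G. x [^] n = \<one>} \<and> card {x \<in> carrier G. x [^] n = \<one>} \<le> n"
  shows "\<exists>j \<in> carrier (hom_group QZ G).
    bij_betw j (carrier QZ) {h \<in> carrier G. \<exists>n>0. h [^] (n::nat) = \<one>}"
proof -
  obtain J where J: "J \<in> hom rat_group G" and J_one: "\<And>r. J r = \<one> \<longleftrightarrow> r \<in> \<int>"
    using exists_rat_hom by blast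
  interpret rat: comm_group rat_group by (rule comm_group_rat_group)
  have J_closed: "J r \<in> carrier G" for r using J by (auto simp: hom_def)
  have J_add: "J (q + r) = J q \<otimes> J r" for q r using hom_mult[OF J, of q r] by simp
  have J_pow: "J r [^] k = J (of_int k * r)" for r and k :: int
    using hom_int_pow[OF J, of r k] rat.is_group is_group by (simp add: int_pow_rat_group)
  have J_eq: "J q = J r \<longleftrightarrow> q - r \<in> \<int>" for q r
  proof -
    have "J q = J (q - r) \<otimes> J r" using J_add[of "q - r" r] by simp
    then have "J q = J r \<longleftrightarrow> J (q - r) = \<one>" using J_closed by (metis l_cancel_one' r_cancel_one)
    then show ?thesis by (simp add: J_one)
  qed
  \<comment> \<open>Any representative serves: two of them differ by an integer, and
    \<open>J\<close> kills the integers.\<close>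
  define j where "j = (\<lambda>\<gamma> \<in> carrier QZ. J (SOME r. \<gamma> = qz r))"
  have j_qz: "j (qz r) = J r" for r
  proof -
    have "qz r = qz (SOME s. qz r = qz s)" by (rule someI) (rule refl)
    then show ?thesis by (simp add: j_def J_eq qz_eq_iff) (metis Ints_minus minus_diff_eq)
  qed
  have "j \<in> carrier (hom_group QZ G)"
  proof (rule hom_groupI)
    show "j \<gamma> \<in> carrier G" if "\<gamma> \<in> carrier QZ" for \<gamma>
      using that J_closed by (auto simp: carrier_QZ j_qz)
    show "j (\<gamma> \<otimes>\<^bsub>QZ\<^esub> \<delta>) = j \<gamma> \<otimes> j \<delta>" if "\<gamma> \<in> carrier QZ" "\<delta> \<in> carrier QZ" for \<gamma> \<delta>
      using that by (auto simp: carrier_QZ j_qz J_add qz_add[symmetric])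
    show "j \<in> extensional (carrier QZ)" by (simp add: j_def)
  qed
  moreover have "bij_betw j (carrier QZ) {h \<in> carrier G. \<exists>n>0. h [^] (n::nat) = \<one>}"
  proof (rule bij_betw_imageI)
    show "inj_on j (carrier QZ)"
    proof (rule inj_onI)
      fix \<gamma> \<delta> assume "\<gamma> \<in> carrier QZ" "\<delta> \<in> carrier QZ" and eq: "j \<gamma> = j \<delta>"
      then obtain q r where "\<gamma> = qz q" "\<delta> = qz r" by (auto simp: carrier_QZ)
      then show "\<gamma> = \<delta>" using eq by (simp only: j_qz J_eq qz_eq_iff)
    qed
    show "j ` carrier QZ = {h \<in> carrier G. \<exists>n>0. h [^] (n::nat) = \<one>}"
    proof (intro equalityI subsetI)
      fix x assume "x \<in> j ` carrier QZ"
      then obtain r where x: "x = J r" by (auto simp: carrier_QZ j_qz)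
      obtain a n :: int where r: "n > 0" "r = of_int a * (1 / of_int n)" by (rule rat_fracE)
      have "x [^] n = \<one>" unfolding x J_pow J_one using r by simp
      then have "x [^] nat n = \<one>" using r(1) by (simp add: pow_nat)
      then show "x \<in> {h \<in> carrier G. \<exists>n>0. h [^] (n::nat) = \<one>}"
        using r(1) J_closed x by (auto intro!: exI[of _ "nat n"])
    next
      fix x assume "x \<in> {h \<in> carrier G. \<exists>n>0. h [^] (n::nat) = \<one>}"
      then obtain n :: nat where n: "n > 0" and x: "x \<in> carrier G" "x [^] n = \<one>" by auto
      let ?T = "{x \<in> carrier G. x [^] n = \<one>}"
      \<comment> \<open>The classes k/n with k < n give n distinct solutions of x^n = 1, hence all
        of them.\<close>
      define e where "e k = J (of_nat k * (1 / of_nat n))" for k :: nat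
      have "inj_on e {..<n}"
      proof (rule inj_onI)
        fix k l assume kl: "k \<in> {..<n}" "l \<in> {..<n}" "e k = e l"
        then have "of_nat k * (1 / of_nat n) - of_nat l * (1 / of_nat n) \<in> (\<int> :: rat set)"
          by (simp only: e_def J_eq)
        then obtain i where "of_nat k * (1 / of_nat n) - of_nat l * (1 / of_nat n) = rat_of_int i"
          by (rule Ints_cases)
        then have "rat_of_int (int k - int l) = rat_of_int (i * int n)"
          using n by (simp add: field_simps)
        then have "int k - int l = i * int n" by (simp only: of_int_eq_iff)
        then have "int k mod int n = int l mod int n" by (simp add: mod_eq_dvd_iff)
        then show "k = l" using kl by simp
      qed
      then have "card (e ` {..<n}) = n" by (simp add: card_image)
      moreover have "e ` {..<n} \<subseteq> ?T"
      proof -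
        have "e k [^] n = \<one>" for k
        proof -
          have "e k [^] int n = \<one>" unfolding e_def J_pow J_one using n by simp
          then show ?thesis by (simp add: int_pow_int)
        qed
        then show ?thesis using J_closed by (auto simp: e_def)
      qed
      ultimately have "e ` {..<n} = ?T"
        using bound[OF n] by (intro card_seteq) auto
      then obtain k where "x = e k" using x by blast
      then show "x \<in> j ` carrier QZ"
        unfolding e_def by (metis imageI j_qz qz_closed)
    qed
  qed
  ultimately show ?thesis by blast
qed

end

end

section \<open>Roots of unity in fields\<close>

lemma (in ring) eval_Cons: "eval (a # p) x = a \<otimes> x [^] length p \<oplus> eval p x"
  by simp

text \<open>Coefficient lists start with the leading coefficient, so the list stands for X^n + b;
  the n - 1 zeros fill the middle degrees, which is why n must be positive.\<close>

lemma (in ring) eval_binomial: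
  assumes "b \<in> carrier R" "x \<in> carrier R" "n > 0"
  shows "eval (\<one> # replicate (n - 1) \<zero> @ [b]) x = x [^] n \<oplus> b"
proof -
  have "eval (replicate m \<zero> @ [b]) x = b" for m
    by (induction m) (use assms in \<open>simp_all del: eval.simps(2) add: eval_Cons\<close>)
  then show ?thesis using assms by (simp del: eval.simps(2) add: eval_Cons)
qed

lemma (in field) binomial_poly:
  assumes "b \<in> carrier R"
  shows "\<one> # replicate (n - 1) \<zero> @ [b] \<in> carrier (poly_ring R)"
  using assms by (auto simp: univ_poly_def polynomial_def)

text \<open>The solutions are roots of X^n - 1, and the multiset of roots, which is at least as
  large as its support, has size at most the degree.\<close>

lemma (in field) nth_roots_bound:
  assumes "n > (0::nat)"
  shows "finite {x \<in> carrier R. x [^] n = \<one>} \<and> card {x \<in> carrier R. x [^] n = \<one>} \<le> n"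
proof -
  let ?p = "\<one> # replicate (n - 1) \<zero> @ [\<ominus> \<one>]"
  have p: "?p \<in> carrier (poly_ring R)" by (rule binomial_poly) simp
  have "x \<in># roots ?p" if "x \<in> carrier R" "x [^] n = \<one>" for x
    unfolding roots_mem_iff_is_root[OF p] is_root_def eval_binomial[OF a_inv_closed[OF one_closed] that(1) assms]
    using that by (simp add: r_neg)
  then have sub: "{x \<in> carrier R. x [^] n = \<one>} \<subseteq> set_mset (roots ?p)" by blast
  have "card (set_mset (roots ?p)) \<le> size (roots ?p)"
    by (metis mset_set_set_mset_msubset size_mset_mono size_mset_set)
  also have "\<dots> \<le> length ?p - 1" by (rule size_roots_le_degree[OF p])
  also have "length ?p - 1 = n" using assms by simp
  finally show ?thesis
    using card_mono[OF _ sub] finite_subset[OF sub] by simp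
qed

context algebraically_closed
begin

lemma exists_root:
  assumes "p \<in> carrier (poly_ring L)" "length p > 1"
  shows "\<exists>x \<in> carrier L. eval p x = \<zero>"
proof -
  have "size (roots p) > 0"
    using roots_over_carrier[OF assms(1)] assms(2) by (simp add: splitted_def)
  then obtain x where "x \<in># roots p" by fastforce
  then show ?thesis using roots_mem_iff_is_root[OF assms(1)] by (auto simp: is_root_def)
qed

lemma exists_nth_root:
  assumes "z \<in> carrier L" "n > (0::nat)"
  shows "\<exists>x \<in> carrier L. x [^] n = z"
proof -
  let ?p = "\<one> # replicate (n - 1) \<zero> @ [\<ominus> z]"
  obtain x where x: "x \<in> carrier L" "eval ?p x = \<zero>"
    using exists_root[OF binomial_poly, of "\<ominus> z" n] assms by auto
  then have "x [^] n \<oplus> \<ominus> z = \<zero>" using eval_binomial[of "\<ominus> z" x n] assms by simp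
  then show ?thesis using x(1) assms(1) by (metis minus_equality minus_minus nat_pow_closed a_inv_closed a_comm)
qed

text \<open>The list \<open>replicate n \<one>\<close> is 1 + X + ... + X^(n-1), nonconstant for n >
  1. Multiplying by X - 1 gives X^n - 1, so its roots are n-th roots of unity, and the second
  assumption keeps 1 from being one of those roots.\<close>

lemma exists_nontrivial_root_of_unity:
  assumes "n > (1::nat)" "eval (replicate n \<one>) \<one> \<noteq> \<zero>"
  shows "\<exists>x \<in> carrier L. x \<noteq> \<one> \<and> x [^] n = \<one>"
proof -
  have "replicate n \<one> \<in> carrier (poly_ring L)"
    using assms by (auto simp: univ_poly_def polynomial_def)
  then obtain x where x: "x \<in> carrier L" "eval (replicate n \<one>) x = \<zero>"
    using exists_root[of "replicate n \<one>"] assms by auto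
  have closed: "eval (replicate m \<one>) x \<in> carrier L" for m
    by (induction m) (use x(1) in \<open>simp_all del: eval.simps(2) add: eval_Cons\<close>)
  have "eval (replicate m \<one>) x \<otimes> (x \<ominus> \<one>) = x [^] m \<ominus> \<one>" for m
  proof (induction m)
    case 0
    then show ?case using x(1) by (simp add: minus_eq r_neg)
  next
    case (Suc m)
    have "eval (replicate (Suc m) \<one>) x \<otimes> (x \<ominus> \<one>) =
        x [^] m \<otimes> (x \<ominus> \<one>) \<oplus> eval (replicate m \<one>) x \<otimes> (x \<ominus> \<one>)"
      using x(1) closed by (simp del: eval.simps(2) add: eval_Cons l_distr)
    also have "\<dots> = x [^] m \<otimes> (x \<ominus> \<one>) \<oplus> (x [^] m \<ominus> \<one>)" by (simp only: Suc)
    also have "\<dots> = x [^] Suc m \<ominus> \<one>"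
    proof -
      have "x [^] m \<in> carrier L" using x(1) by simp
      then show ?thesis using x(1) unfolding nat_pow_Suc by algebra
    qed
    finally show ?case .
  qed
  then have "x [^] n \<ominus> \<one> = \<zero>" using x closed[of 0] by (metis l_null minus_closed one_closed)
  then have "x [^] n = \<one>" using x(1) by simp
  moreover have "x \<noteq> \<one>" using x assms(2) by auto
  ultimately show ?thesis using x(1) by blast
qed

end

text \<open>The value is n times the unit, that is, the image under \<open>i\<close> of the rational
  n, which is invertible. This is how characteristic zero enters.\<close>

lemma (in field) eval_replicate_one_neq_zero:
  assumes "i \<in> ring_hom rat_ring (R\<lparr>carrier := Q\<rparr>)" "Q \<subseteq> carrier R" "n > 0"
  shows "eval (replicate n \<one>) \<one> \<noteq> \<zero>"
proof -
  have i: "i x \<in> carrier R" "i (x * y) = i x \<otimes> i y" "i (x + y) = i x \<oplus> i y" "i 1 = \<one>" for x y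
    using assms(1,2) by (auto simp: ring_hom_def ring_of_type_algebra_def)
  have "i 0 \<oplus> i 0 = i 0" using i(3)[of 0 0] by simp
  then have i0: "i 0 = \<zero>" using i(1)[of 0] by (simp add: add.l_cancel_one)
  have "eval (replicate m \<one>) \<one> = i (of_nat m)" for m
    by (induction m) (simp_all del: eval.simps(2) add: eval_Cons i i0)
  moreover have "i (of_nat n) \<otimes> i (1 / of_nat n) = \<one>"
    using i(2)[of "of_nat n" "1 / of_nat n"] i(4) assms(3) by simp
  then have "i (of_nat n) \<noteq> \<zero>" using i(1) by auto
  ultimately show ?thesis by simp
qed

theorem proposition9p5:
  fixes A :: "('a, 'm) ring_scheme"
  assumes "cring A"
  shows
    "(comm_group (E_group A) \<and> torsion_free (E_group A)) \<and>
     (bij_betw (X_embed A) (X_space A) (carrier (rquotient (EP_group A))) \<and>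
      hypermodule adele_class_hyperring (X_module A)) \<and>
     (\<forall>(p :: nat) (C :: 'c ring) v. Factorial_Ring.prime p \<and> is_Cp p C v \<longrightarrow>
       free_of_rank_one adele_class_hyperring (X_module C))"
proof (intro conjI allI impI)
  show "comm_group (E_group A)" by (rule comm_group_E_group[OF assms])
  have "comm_group (units_of A)" by (rule comm_monoid.units_comm_group[OF cring.axioms(2)[OF assms]])
  then show "torsion_free (E_group A)"
    unfolding E_group_eq by (rule torsion_free_hom_group[OF group_QZ _ QZ_divisible])
  show "bij_betw (X_embed A) (X_space A) (carrier (rquotient (EP_group A)))"
    by (rule X_embed_bij_betw[OF assms])
  show "hypermodule adele_class_hyperring (X_module A)"
    by (rule hypermodule_X_module[OF assms])
next
  fix p :: nat and C :: "'c ring" and v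
  assume "Factorial_Ring.prime p \<and> is_Cp p C v"
  then obtain L Q i where L: "subfield L C" "algebraic_closure (C\<lparr>carrier := L\<rparr>) Q"
    and Q: "is_completion rat_ring (padic_abs p) i (C\<lparr>carrier := Q\<rparr>) v"
    and C: "is_completion (C\<lparr>carrier := L\<rparr>) v (\<lambda>x. x) C v"
    unfolding is_Cp_def by blast
  interpret C: field C using C by (simp add: is_completion_def absolute_value_def)
  interpret L: algebraic_closure "C\<lparr>carrier := L\<rparr>" Q by (rule L(2))
  have sub: "L \<subseteq> carrier C" using subfieldE(3)[OF L(1)] .
  have subring: "subring L C" by (rule subfieldE(1)[OF L(1)])
  have units: "carrier (units_of C) = carrier C - {\<zero>\<^bsub>C\<^esub>}"
    by (simp add: units_of_carrier C.field_Units)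
  have pow: "x [^]\<^bsub>units_of C\<^esub> n = x [^]\<^bsub>C\<^esub> n" for x and n :: nat
    by (simp add: nat_pow_def units_of_def)
  have pow_L: "x [^]\<^bsub>C\<lparr>carrier := L\<rparr>\<^esub> n = x [^]\<^bsub>C\<^esub> n" for x and n :: nat
    by (simp add: nat_pow_def)
  interpret U: comm_group "units_of C" by (rule C.units_comm_group)
  have "Q \<subseteq> L" using subfieldE(3)[OF L.subfield_axioms] by simp
  \<comment> \<open>The carrier is updated twice because characteristic zero will be used in the
    field on \<open>L\<close>, whose record then receives the carrier \<open>Q\<close>.\<close>
  have i: "i \<in> ring_hom rat_ring (C\<lparr>carrier := L, carrier := Q\<rparr>)"
    using Q by (simp add: is_completion_def)
  have "\<exists>j \<in> carrier (hom_group QZ (units_of C)). bij_betw j (carrier QZ)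
      {h \<in> carrier (units_of C). \<exists>n>0. h [^]\<^bsub>units_of C\<^esub> (n::nat) = \<one>\<^bsub>units_of C\<^esub>}"
  proof (rule U.exists_QZ_hom[of "L - {\<zero>\<^bsub>C\<^esub>}"])
    show "L - {\<zero>\<^bsub>C\<^esub>} \<subseteq> carrier (units_of C)" using sub units by auto
    show "\<one>\<^bsub>units_of C\<^esub> \<in> L - {\<zero>\<^bsub>C\<^esub>}"
      using subringE(3)[OF subring] C.one_not_zero by (simp add: units_of_one)
    show "x \<otimes>\<^bsub>units_of C\<^esub> y \<in> L - {\<zero>\<^bsub>C\<^esub>}" if "x \<in> L - {\<zero>\<^bsub>C\<^esub>}" "y \<in> L - {\<zero>\<^bsub>C\<^esub>}" for x y
      using that sub subringE(6)[OF subring, of x y] C.integral[of x y] by (auto simp: units_of_mult)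
    show "\<exists>x \<in> L - {\<zero>\<^bsub>C\<^esub>}. x [^]\<^bsub>units_of C\<^esub> q = z"
      if z: "z \<in> L - {\<zero>\<^bsub>C\<^esub>}" and q: "Factorial_Ring.prime q" for z and q :: nat
    proof -
      have "q > 0" by (rule prime_gt_0_nat[OF q])
      then obtain x where x: "x \<in> L" "x [^]\<^bsub>C\<^esub> q = z"
        using L.exists_nth_root[of z q] z by (auto simp: pow_L)
      moreover have "x \<noteq> \<zero>\<^bsub>C\<^esub>" using x z \<open>q > 0\<close> by (auto simp: C.nat_pow_zero)
      ultimately show ?thesis by (auto simp: pow)
    qed
    show "\<exists>\<eta> \<in> L - {\<zero>\<^bsub>C\<^esub>}. \<eta> \<noteq> \<one>\<^bsub>units_of C\<^esub> \<and> \<eta> [^]\<^bsub>units_of C\<^esub> q = \<one>\<^bsub>units_of C\<^esub>"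
      if q: "Factorial_Ring.prime q" for q :: nat
    proof -
      have "q > 1" by (rule prime_gt_1_nat[OF q])
      \<comment> \<open>The embedding of the rationals into \<open>Q\<close> gives \<open>L\<close>
        characteristic zero, so q times the unit does not vanish, even for q = p.\<close>
      moreover have "L.eval (replicate q \<one>\<^bsub>C\<^esub>) \<one>\<^bsub>C\<^esub> \<noteq> \<zero>\<^bsub>C\<^esub>"
        using L.eval_replicate_one_neq_zero[OF i, of q] \<open>Q \<subseteq> L\<close> \<open>q > 1\<close> by simp
      ultimately obtain x where x: "x \<in> L" "x \<noteq> \<one>\<^bsub>C\<^esub>" "x [^]\<^bsub>C\<^esub> q = \<one>\<^bsub>C\<^esub>"
        using L.exists_nontrivial_root_of_unity[of q] by (auto simp: pow_L)
      moreover have "x \<noteq> \<zero>\<^bsub>C\<^esub>" using x \<open>q > 1\<close> C.one_not_zero by (auto simp: C.nat_pow_zero)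
      ultimately show ?thesis by (auto simp: pow units_of_one)
    qed
    \<comment> \<open>The count takes place in all of \<open>C\<close>, so every root of unity of
      \<open>C\<close> lies in the image of \<open>j\<close>.\<close>
    show "finite {x \<in> carrier (units_of C). x [^]\<^bsub>units_of C\<^esub> n = \<one>\<^bsub>units_of C\<^esub>} \<and>
        card {x \<in> carrier (units_of C). x [^]\<^bsub>units_of C\<^esub> n = \<one>\<^bsub>units_of C\<^esub>} \<le> n"
      if n: "n > 0" for n :: nat
    proof -
      have sub: "{x \<in> carrier (units_of C). x [^]\<^bsub>units_of C\<^esub> n = \<one>\<^bsub>units_of C\<^esub>} \<subseteq>
          {x \<in> carrier C. x [^]\<^bsub>C\<^esub> n = \<one>\<^bsub>C\<^esub>}"
        by (auto simp: units pow units_of_one)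
      then show ?thesis
        using C.nth_roots_bound[OF n] by (meson card_mono finite_subset le_trans)
    qed
  qed
  then show "free_of_rank_one adele_class_hyperring (X_module C)"
    using free_X_module_of_torsion[OF C.is_cring] by blast
qed

end
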